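(* Let $G$ be a connected complex reductive group. A representation $\Phi$ of $\mathbb{C}\ltimes\mathbb{A}$ on a principal $G$-bundle $P$ is linearizable if and only if its monodromy $\Phi(2\pi i,1)$ is conjugate to $\exp(2\pi i\,\mathrm{Res}(\Phi))$. In particular, representations with semisimple monodromy can always be linearized.
   Context: Everything is holomorphic. $G$ is a connected complex reductive group. $\mathbb{A}$ is the complex affine line with coordinate $z$. $\mathbb{C}\ltimes\mathbb{A}$ is the action groupoid with arrows $(\lambda,z)\in\mathbb{C}\times\mathbb{A}$, source $z$, target $e^{\lambda}z$ and product $(\lambda_1,e^{\lambda_2}z)*(\lambda_2,z)=(\lambda_1+\lambda_2,z)$. A representation is a pair $(P,\Phi)$ with $P\to\mathbb{A}$ a holomorphic right principal $G$-bundle and $\Phi$ a holomorphic groupoid homomorphism to the gauge groupoid of $P$, i.e. $G$-equivariant maps $\Phi(\lambda,z):P_z\to P_{e^\lambda z}$, holomorphic in $(\lambda,z)$ and multiplicative. Morphisms are morphisms of principal bundles $T$ over $\mathrm{id}_{\mathbb A}$ with $T_{e^\lambda z}\Phi(\lambda,z)=\Phi'(\lambda,z)T_z$. The residue $\mathrm{Res}(\Phi)\in\mathfrak{aut}_G(P_0)$ is the unique element with $\Phi(\lambda,0)=\exp(\lambda\,\mathrm{Res}(\Phi))$ for all $\lambda$. The monodromy at $z\neq 0$ is $M(z)=\Phi(2\pi i,z)\in\mathrm{Aut}_G(P_z)$. The elements $\Phi(2\pi i,1)\in\mathrm{Aut}_G(P_1)$ and $\exp(2\pi i\,\mathrm{Res}(\Phi))\in\mathrm{Aut}_G(P_0)$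 are called conjugate if there is a $G$-equivariant map $g:P_0\to P_1$ with $\Phi(2\pi i,1)=g\exp(2\pi i\,\mathrm{Res}(\Phi))g^{-1}$ (equivalently, they become conjugate elements of $G$ in a trivialization of $P$). The linear approximation $L(\Phi)$ is the representation on $P_0\times\mathbb{A}$ given by $L(\Phi)(\lambda,z)=\exp(\lambda\,\mathrm{Res}(\Phi))$. A linearization of $\Phi$ is an isomorphism of representations $T:L(\Phi)\to\Phi$, and $\Phi$ is linearizable if one exists. *)

theory Defs
  imports "HOL-Complex_Analysis.Complex_Analysis" "HOL-Algebra.Coset"
begin

section \<open>Complex matrices\<close>

definition matrix_pow :: "complex^'n^'n \<Rightarrow> nat \<Rightarrow> complex^'n^'n" where
  "matrix_pow A k = (((**) A) ^^ k) (mat 1)"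

definition matrix_scale :: "complex \<Rightarrow> complex^'n^'n \<Rightarrow> complex^'n^'n" where
  "matrix_scale c = map_matrix ((*) c)"

definition matrix_exp :: "complex^'n^'n \<Rightarrow> complex^'n^'n" where
  "matrix_exp A = (\<Sum>k. (1 / fact k) *\<^sub>R matrix_pow A k)"

definition unipotent_matrix :: "complex^'n^'n \<Rightarrow> bool" where
  "unipotent_matrix A \<longleftrightarrow> (\<exists>k. matrix_pow (A - mat 1) k = 0)"

text \<open>Over the complex numbers, semisimple means diagonalizable.\<close>

definition semisimple_matrix :: "complex^'n^'n \<Rightarrow> bool" where
  "semisimple_matrix A \<longleftrightarrow>
     (\<exists>Q D :: complex^'n^'n. invertible Q \<and> (\<forall>i j. i \<noteq> j \<longrightarrow> D $ i $ j = 0) \<and> A = Q ** D ** matrix_inv Q)"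


section \<open>Connected complex reductive groups\<close>

definition GL :: "(complex^'n^'n) monoid" where
  "GL = \<lparr>carrier = {A. invertible A}, mult = (**), one = mat 1\<rparr>"

inductive matrix_polynomial :: "(complex^'n^'n \<Rightarrow> complex) \<Rightarrow> bool" where
  const: "matrix_polynomial (\<lambda>A. c)"
| entry: "matrix_polynomial (\<lambda>A. A $ i $ j)"
| add: "matrix_polynomial p \<Longrightarrow> matrix_polynomial q \<Longrightarrow> matrix_polynomial (\<lambda>A. p A + q A)"
| mult: "matrix_polynomial p \<Longrightarrow> matrix_polynomial q \<Longrightarrow> matrix_polynomial (\<lambda>A. p A * q A)"

text \<open>Regular functions on the general linear group are polynomials divided by powers of the
  determinant, so its closed subsets are already cut out by polynomials in the entries.\<close>

definition zariski_closed_in_GL :: "(complex^'n^'n) set \<Rightarrow> bool" where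
  "zariski_closed_in_GL X \<longleftrightarrow>
     (\<exists>S. (\<forall>p\<in>S. matrix_polynomial p) \<and> X = {A. invertible A \<and> (\<forall>p\<in>S. p A = 0)})"

definition linear_algebraic_group :: "(complex^'n^'n) set \<Rightarrow> bool" where
  "linear_algebraic_group G \<longleftrightarrow> subgroup G GL \<and> zariski_closed_in_GL G"

text \<open>A linear algebraic group is reductive if its unipotent radical, the largest closed connected
  normal unipotent subgroup, is trivial. Connectedness refers to the Euclidean topology; for complex
  algebraic groups it agrees with connectedness in the Zariski topology.\<close>

definition reductive_group :: "(complex^'n^'n) set \<Rightarrow> bool" where
  "reductive_group G \<longleftrightarrow> linear_algebraic_group G \<and>
     (\<forall>U. zariski_closed_in_GL U \<and> connected U \<and> normal U (GL\<lparr>carrier := G\<rparr>) \<and>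
          (\<forall>u\<in>U. unipotent_matrix u) \<longrightarrow> U = {mat 1})"

definition connected_reductive_group :: "(complex^'n^'n) set \<Rightarrow> bool" where
  "connected_reductive_group G \<longleftrightarrow> reductive_group G \<and> connected G"

definition lie_algebra :: "(complex^'n^'n) set \<Rightarrow> (complex^'n^'n) set" where
  "lie_algebra G = {X. \<forall>t::real. matrix_exp (t *\<^sub>R X) \<in> G}"


section \<open>Holomorphic maps into a matrix group\<close>

text \<open>A linear algebraic group is a closed complex submanifold of the space of matrices, so a map
  into it is holomorphic iff its matrix entries are.\<close>

definition matrix_holomorphic_on ::
    "(complex \<Rightarrow> complex^'n^'n) \<Rightarrow> complex set \<Rightarrow> bool" where
  "matrix_holomorphic_on h U \<longleftrightarrow> (\<forall>i j. (\<lambda>z. h z $ i $ j) holomorphic_on U)"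

definition holomorphic2_on ::
    "(complex \<times> complex \<Rightarrow> complex) \<Rightarrow> (complex \<times> complex) set \<Rightarrow> bool" where
  "holomorphic2_on f W \<longleftrightarrow>
     (\<forall>x\<in>W. \<exists>a b. (f has_derivative (\<lambda>(s, t). a * s + b * t)) (at x within W))"

definition matrix_holomorphic2_on ::
    "(complex \<times> complex \<Rightarrow> complex^'n^'n) \<Rightarrow> (complex \<times> complex) set \<Rightarrow> bool" where
  "matrix_holomorphic2_on h W \<longleftrightarrow> (\<forall>i j. holomorphic2_on (\<lambda>x. h x $ i $ j) W)"


section \<open>Holomorphic principal bundles over the complex line\<close>

text \<open>The holomorphic structure of a principal bundle is recorded by an atlas of local
  trivializations. A pair \<open>(U, \<tau>)\<close> in the atlas stands for the trivialization
  \<open>p \<mapsto> (proj p, \<tau> p)\<close> of the part of the bundle over \<open>U\<close>, so \<open>\<tau>\<close> is its group component.\<close>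

record ('p, 'n::finite) principal_bundle =
  total :: "'p set"
  proj :: "'p \<Rightarrow> complex"
  act :: "'p \<Rightarrow> complex^'n^'n \<Rightarrow> 'p"
  atlas :: "(complex set \<times> ('p \<Rightarrow> complex^'n^'n)) set"

definition fibre :: "('p, 'n::finite) principal_bundle \<Rightarrow> complex \<Rightarrow> 'p set" where
  "fibre P z = {p \<in> total P. proj P p = z}"

definition right_action_on_fibres :: "(complex^'n^'n) set \<Rightarrow> ('p, 'n) principal_bundle \<Rightarrow> bool" where
  "right_action_on_fibres G P \<longleftrightarrow>
     (\<forall>z. \<forall>p\<in>fibre P z. act P p (mat 1) = p \<and>
        (\<forall>g\<in>G. act P p g \<in> fibre P z \<and> (\<forall>h\<in>G. act P (act P p g) h = act P p (g ** h))))"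

definition local_trivialization ::
    "(complex^'n^'n) set \<Rightarrow> ('p, 'n) principal_bundle \<Rightarrow> complex set \<Rightarrow> ('p \<Rightarrow> complex^'n^'n) \<Rightarrow> bool" where
  "local_trivialization G P U \<tau> \<longleftrightarrow> open U \<and>
     bij_betw (\<lambda>p. (proj P p, \<tau> p)) {p \<in> total P. proj P p \<in> U} (U \<times> G) \<and>
     (\<forall>p\<in>total P. proj P p \<in> U \<longrightarrow> (\<forall>g\<in>G. \<tau> (act P p g) = \<tau> p ** g))"

definition holomorphic_principal_bundle ::
    "(complex^'n^'n) set \<Rightarrow> ('p, 'n) principal_bundle \<Rightarrow> bool" where
  "holomorphic_principal_bundle G P \<longleftrightarrow>
     right_action_on_fibres G P \<and>
     (\<forall>(U, \<tau>)\<in>atlas P. local_trivialization G P U \<tau>) \<and>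
     (\<forall>z. \<exists>(U, \<tau>)\<in>atlas P. z \<in> U) \<and>
     (\<forall>(U, \<sigma>)\<in>atlas P. \<forall>(V, \<tau>)\<in>atlas P. \<exists>c. matrix_holomorphic_on c (U \<inter> V) \<and>
        (\<forall>z\<in>U \<inter> V. c z \<in> G \<and> (\<forall>p\<in>fibre P z. \<tau> p = c z ** \<sigma> p)))"

definition equivariant_map ::
    "(complex^'n^'n) set \<Rightarrow> ('p, 'n) principal_bundle \<Rightarrow> complex \<Rightarrow> ('q, 'n) principal_bundle \<Rightarrow> complex
      \<Rightarrow> ('p \<Rightarrow> 'q) \<Rightarrow> bool" where
  "equivariant_map G P z Q w f \<longleftrightarrow>
     (\<forall>p\<in>fibre P z. f p \<in> fibre Q w \<and> (\<forall>g\<in>G. f (act P p g) = act Q (f p) g))"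

text \<open>A bundle morphism is given by its restrictions to the fibres.
  In trivializations it is left multiplication by a function of the base point.\<close>

definition bundle_morphism ::
    "(complex^'n^'n) set \<Rightarrow> ('p, 'n) principal_bundle \<Rightarrow> ('q, 'n) principal_bundle \<Rightarrow> (complex \<Rightarrow> 'p \<Rightarrow> 'q) \<Rightarrow> bool" where
  "bundle_morphism G P Q T \<longleftrightarrow>
     (\<forall>z. equivariant_map G P z Q z (T z)) \<and>
     (\<forall>(U, \<sigma>)\<in>atlas P. \<forall>(V, \<tau>)\<in>atlas Q. \<exists>h. matrix_holomorphic_on h (U \<inter> V) \<and>
        (\<forall>z\<in>U \<inter> V. h z \<in> G \<and> (\<forall>p\<in>fibre P z. \<tau> (T z p) = h z ** \<sigma> p)))"


section \<open>Representations of the action groupoid\<close>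

text \<open>The gauge groupoid of \<open>P\<close> has, over \<open>U \<times> V\<close>, the chart with coordinates
  \<open>(z, w, h) \<in> U \<times> V \<times> G\<close> that describes the equivariant map from the fibre over \<open>z\<close> to the
  fibre over \<open>w\<close> which is left multiplication by \<open>h\<close> in the two trivializations.\<close>

definition groupoid_representation ::
    "(complex^'n^'n) set \<Rightarrow> ('p, 'n) principal_bundle \<Rightarrow> (complex \<Rightarrow> complex \<Rightarrow> 'p \<Rightarrow> 'p) \<Rightarrow> bool" where
  "groupoid_representation G P \<Phi> \<longleftrightarrow>
     (\<forall>l z. equivariant_map G P z P (exp l * z) (\<Phi> l z)) \<and>
     (\<forall>z. \<forall>p\<in>fibre P z. \<Phi> 0 z p = p) \<and>
     (\<forall>l1 l2 z. \<forall>p\<in>fibre P z. \<Phi> (l1 + l2) z p = \<Phi> l1 (exp l2 * z) (\<Phi> l2 z p)) \<and>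
     (\<forall>(U, \<sigma>)\<in>atlas P. \<forall>(V, \<tau>)\<in>atlas P.
        \<exists>h. matrix_holomorphic2_on h {(l, z). z \<in> U \<and> exp l * z \<in> V} \<and>
          (\<forall>l z. z \<in> U \<and> exp l * z \<in> V \<longrightarrow>
             h (l, z) \<in> G \<and> (\<forall>p\<in>fibre P z. \<tau> (\<Phi> l z p) = h (l, z) ** \<sigma> p)))"

definition representation_morphism ::
    "(complex^'n^'n) set \<Rightarrow> ('p, 'n) principal_bundle \<Rightarrow> (complex \<Rightarrow> complex \<Rightarrow> 'p \<Rightarrow> 'p) \<Rightarrow>
     ('q, 'n) principal_bundle \<Rightarrow> (complex \<Rightarrow> complex \<Rightarrow> 'q \<Rightarrow> 'q) \<Rightarrow> (complex \<Rightarrow> 'p \<Rightarrow> 'q) \<Rightarrow> bool" where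
  "representation_morphism G P \<Phi> Q \<Psi> T \<longleftrightarrow> bundle_morphism G P Q T \<and>
     (\<forall>l z. \<forall>p\<in>fibre P z. T (exp l * z) (\<Phi> l z p) = \<Psi> l z (T z p))"

definition representation_isomorphism ::
    "(complex^'n^'n) set \<Rightarrow> ('p, 'n) principal_bundle \<Rightarrow> (complex \<Rightarrow> complex \<Rightarrow> 'p \<Rightarrow> 'p) \<Rightarrow>
     ('q, 'n) principal_bundle \<Rightarrow> (complex \<Rightarrow> complex \<Rightarrow> 'q \<Rightarrow> 'q) \<Rightarrow> (complex \<Rightarrow> 'p \<Rightarrow> 'q) \<Rightarrow> bool" where
  "representation_isomorphism G P \<Phi> Q \<Psi> T \<longleftrightarrow> representation_morphism G P \<Phi> Q \<Psi> T \<and>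
     (\<exists>S. representation_morphism G Q \<Psi> P \<Phi> S \<and>
        (\<forall>z. (\<forall>p\<in>fibre P z. S z (T z p) = p) \<and> (\<forall>q\<in>fibre Q z. T z (S z q) = q)))"


section \<open>Residue, monodromy and linearization\<close>

text \<open>The Lie algebra of the group of equivariant automorphisms of a fibre consists of the
  Ad-equivariant maps \<open>\<xi>\<close> from the fibre to the Lie algebra of \<open>G\<close>; such a map integrates to the
  automorphism \<open>p \<mapsto> p \<cdot> exp (\<xi> p)\<close>. Extensionality makes \<open>\<xi>\<close> unique as a HOL function.\<close>

definition aut_algebra ::
    "(complex^'n^'n) set \<Rightarrow> ('p, 'n) principal_bundle \<Rightarrow> complex \<Rightarrow> ('p \<Rightarrow> complex^'n^'n) set" where
  "aut_algebra G P z = {\<xi> \<in> fibre P z \<rightarrow>\<^sub>E lie_algebra G.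
     \<forall>p\<in>fibre P z. \<forall>g\<in>G. \<xi> (act P p g) = matrix_inv g ** \<xi> p ** g}"

definition aut_scale :: "complex \<Rightarrow> ('p \<Rightarrow> complex^'n^'n) \<Rightarrow> 'p \<Rightarrow> complex^'n^'n" where
  "aut_scale c \<xi> = (\<lambda>p. matrix_scale c (\<xi> p))"

definition aut_exp :: "('p, 'n::finite) principal_bundle \<Rightarrow> ('p \<Rightarrow> complex^'n^'n) \<Rightarrow> 'p \<Rightarrow> 'p" where
  "aut_exp P \<xi> p = act P p (matrix_exp (\<xi> p))"

definition residue_rep ::
    "(complex^'n^'n) set \<Rightarrow> ('p, 'n) principal_bundle \<Rightarrow> (complex \<Rightarrow> complex \<Rightarrow> 'p \<Rightarrow> 'p)
      \<Rightarrow> 'p \<Rightarrow> complex^'n^'n" where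
  "residue_rep G P \<Phi> = (THE \<xi>. \<xi> \<in> aut_algebra G P 0 \<and>
     (\<forall>l. \<forall>p\<in>fibre P 0. \<Phi> l 0 p = aut_exp P (aut_scale l \<xi>) p))"

definition monodromy :: "(complex \<Rightarrow> complex \<Rightarrow> 'p \<Rightarrow> 'p) \<Rightarrow> complex \<Rightarrow> 'p \<Rightarrow> 'p" where
  "monodromy \<Phi> z = \<Phi> (2 * of_real pi * \<i>) z"

definition conjugate_automorphisms ::
    "(complex^'n^'n) set \<Rightarrow> ('p, 'n) principal_bundle \<Rightarrow> complex \<Rightarrow> ('p \<Rightarrow> 'p) \<Rightarrow> complex \<Rightarrow> ('p \<Rightarrow> 'p) \<Rightarrow> bool" where
  "conjugate_automorphisms G P w b z a \<longleftrightarrow>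
     (\<exists>g. equivariant_map G P z P w g \<and>
        (\<forall>q\<in>fibre P w. b q = g (a (inv_into (fibre P z) g q))))"

text \<open>An equivariant automorphism \<open>a\<close> of a fibre corresponds, after choosing a point \<open>p\<close>, to the
  element \<open>m\<close> of \<open>G\<close> with \<open>a p = p \<cdot> m\<close>; other points give conjugates of \<open>m\<close>.\<close>

definition semisimple_automorphism ::
    "(complex^'n^'n) set \<Rightarrow> ('p, 'n) principal_bundle \<Rightarrow> complex \<Rightarrow> ('p \<Rightarrow> 'p) \<Rightarrow> bool" where
  "semisimple_automorphism G P z a \<longleftrightarrow>
     (\<forall>p\<in>fibre P z. \<exists>m\<in>G. a p = act P p m \<and> semisimple_matrix m)"

definition linear_bundle :: "('p, 'n::finite) principal_bundle \<Rightarrow> ('p \<times> complex, 'n) principal_bundle" where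
  "linear_bundle P = \<lparr>total = fibre P 0 \<times> UNIV, proj = snd, act = (\<lambda>(p, z) g. (act P p g, z)),
     atlas = {(UNIV, \<lambda>(p, z). \<tau> p) | U \<tau>. (U, \<tau>) \<in> atlas P \<and> 0 \<in> U}\<rparr>"

definition linear_approximation ::
    "(complex^'n^'n) set \<Rightarrow> ('p, 'n) principal_bundle \<Rightarrow> (complex \<Rightarrow> complex \<Rightarrow> 'p \<Rightarrow> 'p)
      \<Rightarrow> complex \<Rightarrow> complex \<Rightarrow> 'p \<times> complex \<Rightarrow> 'p \<times> complex" where
  "linear_approximation G P \<Phi> l z =
     (\<lambda>(p, _). (aut_exp P (aut_scale l (residue_rep G P \<Phi>)) p, exp l * z))"

definition linearizable ::
    "(complex^'n^'n) set \<Rightarrow> ('p, 'n) principal_bundle \<Rightarrow> (complex \<Rightarrow> complex \<Rightarrow> 'p \<Rightarrow> 'p) \<Rightarrow> bool" where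
  "linearizable G P \<Phi> \<longleftrightarrow>
     (\<exists>T. representation_isomorphism G (linear_bundle P) (linear_approximation G P \<Phi>) P \<Phi> T)"

end

theory Submission
  imports Defs
begin

(* Only vectors and matrices are indexed by the dollar sign below. *)
no_notation fps_nth (infixl "$" 75)

text \<open>
  A linearization restricts over the point \<open>1\<close> to an equivariant map that conjugates one
  monodromy into the other. The substance is the converse: to build a linearization out of
  information about the monodromy.

  The problem is local at the fixed point \<open>0\<close>. Every \<open>z\<close> is moved into a given disc around \<open>0\<close> by
  \<open>exp (- l)\<close> for suitable \<open>l\<close>, so an isomorphism with the linear approximation over the disc
  is transported by the action to all of the line. In a chart around \<open>0\<close> the representation becomes
  a cocycle \<open>F l z\<close> with values in \<open>G\<close>. Write \<open>a z\<close> for its \<open>l\<close>-derivative at \<open>l = 0\<close>, so that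
  \<open>a 0\<close> is the residue, and \<open>m z = F (2 pi i) z\<close> for the monodromy. A linearization over the disc
  is a holomorphic \<open>u\<close> with values in \<open>G\<close> and \<open>F l z u(z) = u(exp l * z) F l 0\<close>.

  The idea is to look first for an infinitesimal automorphism of the representation that extends the
  residue: a holomorphic \<open>D\<close> with values in the Lie algebra, \<open>D 0 = a 0\<close> and
  \<open>D (exp l * z) F l z = F l z D z\<close>. Such a \<open>D\<close> removes the singularity of the problem: \<open>a - D\<close> vanishes
  at \<open>0\<close>, so \<open>Y = (a - D) / z\<close> is holomorphic and \<open>u' = Y u\<close>, \<open>u 0 = 1\<close> is a regular linear differential
  equation. Its solution has values in \<open>G\<close> because those of \<open>Y\<close> are tangent to \<open>G\<close>
  (lemma \<open>ode_solution_in_group\<close>). Then \<open>u\<^sup>-\<^sup>1 D u\<close> has derivative \<open>0\<close>, hence is constantly equal to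
  \<open>a 0\<close>, and this forces \<open>u\<close> to linearize (theorem \<open>local_linearization\<close>).

  To find \<open>D\<close>, start from a holomorphic \<open>C\<close> with values in the Lie algebra that commutes with \<open>m\<close> and
  has \<open>C 0 = a 0\<close>. As \<open>C\<close> commutes with \<open>m\<close>, the function \<open>F l z\<^sup>-\<^sup>1 C (exp l * z) F l z\<close> of \<open>l\<close> has
  period \<open>2 pi i\<close>, and its mean over a period is a \<open>D\<close> as desired (lemma \<open>parallel_section_exists\<close>).

  The monodromy enters through the existence of \<open>C\<close>. If all \<open>m z\<close>, including \<open>m 0\<close>, are conjugate in
  \<open>G\<close>, then the linear maps \<open>X \<mapsto> X m(z) - m(z) X\<close> on the Lie algebra have the same rank for all \<open>z\<close>, so
  the vector \<open>a 0\<close> of the kernel at \<open>0\<close> extends to a holomorphic section of the kernels (lemma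
  \<open>centralizer_section_conjugate\<close>). If the \<open>m z\<close> with \<open>z \<noteq> 0\<close> are diagonalizable with common
  eigenvalues, the projection onto the centralizer of \<open>m z\<close> is a polynomial in \<open>Ad (m z)\<close> whose
  coefficients do not depend on \<open>z\<close>, and \<open>C z\<close> is the value of this polynomial at \<open>a 0\<close> (lemma
  \<open>centralizer_section_semisimple\<close>).
\<close>

section \<open>Holomorphic matrix functions\<close>

lemma matrix_scale_nth [simp]: "matrix_scale c A $ i $ j = c * A $ i $ j"
  by (simp add: matrix_scale_def map_matrix_def)

lemma matrix_mult_nth: "(A ** B) $ i $ j = (\<Sum>k\<in>UNIV. A $ i $ k * B $ k $ j)"
  by (simp add: matrix_matrix_mult_def)

lemma matrix_scale_left: "matrix_scale c A ** B = matrix_scale c (A ** B)"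
  by (simp add: vec_eq_iff matrix_mult_nth sum_distrib_left mult_ac)

lemma matrix_scale_right: "A ** matrix_scale c B = matrix_scale c (A ** B)"
  by (simp add: vec_eq_iff matrix_mult_nth sum_distrib_left mult_ac)

lemma matrix_diff_ldistrib:
  fixes A :: "'a::ring_1^'n^'m" shows "A ** (B - C) = A ** B - A ** C"
  by (simp add: vec_eq_iff matrix_mult_nth sum_subtractf algebra_simps)

lemma matrix_diff_rdistrib:
  fixes A :: "'a::ring_1^'n^'m" shows "(A - B) ** C = A ** C - B ** C"
  by (simp add: vec_eq_iff matrix_mult_nth sum_subtractf algebra_simps)

lemma matrix_add_rdistrib:
  fixes A :: "'a::ring_1^'n^'m" shows "(A + B) ** C = A ** C + B ** C"
  by (simp add: vec_eq_iff matrix_mult_nth sum.distrib algebra_simps)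

lemma matrix_minus_left:
  fixes A :: "'a::ring_1^'n^'m" shows "(- A) ** B = - (A ** B)"
  by (simp add: vec_eq_iff matrix_mult_nth sum_negf)

lemma matrix_scale_scale [simp]: "matrix_scale c (matrix_scale d A) = matrix_scale (c * d) A"
  by (simp add: vec_eq_iff)

lemma matrix_scale_1 [simp]: "matrix_scale 1 A = A"
  by (simp add: vec_eq_iff)

lemma matrix_scale_zero [simp]: "matrix_scale 0 A = 0" "matrix_scale c 0 = 0"
  by (simp_all add: vec_eq_iff)

lemma matrix_scale_add: "matrix_scale c (A + B) = matrix_scale c A + matrix_scale c B"
  by (simp add: vec_eq_iff algebra_simps)

lemma matrix_scale_diff: "matrix_scale c (A - B) = matrix_scale c A - matrix_scale c B"
  by (simp add: vec_eq_iff algebra_simps)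

lemma matrix_inv_mult:
  fixes A :: "complex^'n^'n"
  assumes "invertible A"
  shows "A ** matrix_inv A = mat 1" "matrix_inv A ** A = mat 1"
proof -
  have "\<exists>B. A ** B = mat 1 \<and> B ** A = mat 1"
    using assms unfolding invertible_def .
  then have "A ** matrix_inv A = mat 1 \<and> matrix_inv A ** A = mat 1"
    unfolding matrix_inv_def by (rule someI_ex)
  then show "A ** matrix_inv A = mat 1" "matrix_inv A ** A = mat 1" by auto
qed

lemma matrix_inv_cancel:
  fixes A :: "complex^'n^'n"
  assumes "invertible A"
  shows "B ** A ** matrix_inv A = B" "B ** matrix_inv A ** A = B"
  using matrix_inv_mult[OF assms] by (simp_all flip: matrix_mul_assoc)

lemma matrix_inv_cancel_left:
  fixes A :: "complex^'n^'n"
  assumes "invertible A"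
  shows "A ** (matrix_inv A ** B) = B" "matrix_inv A ** (A ** B) = B"
  using matrix_inv_mult[OF assms] by (simp_all add: matrix_mul_assoc)

lemma matrix_inv_unique:
  fixes A :: "complex^'n^'n"
  assumes "A ** B = mat 1"
  shows "matrix_inv A = B"
proof -
  have "invertible A" using assms invertible_right_inverse by blast
  then have "matrix_inv A = matrix_inv A ** (A ** B)" using assms by simp
  also have "\<dots> = B" by (simp add: matrix_inv_cancel_left \<open>invertible A\<close>)
  finally show ?thesis .
qed

lemma invertible_matrix_inv:
  fixes A :: "complex^'n^'n"
  shows "invertible A \<Longrightarrow> invertible (matrix_inv A)"
  using matrix_inv_mult[of A] invertible_def by blast

lemma matrix_inv_mat_1 [simp]: "matrix_inv (mat 1 :: complex^'n^'n) = mat 1"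
  by (rule matrix_inv_unique) simp

lemma matrix_inv_product:
  fixes A B :: "complex^'n^'n"
  assumes "invertible A" "invertible B"
  shows "matrix_inv (A ** B) = matrix_inv B ** matrix_inv A"
proof (rule matrix_inv_unique)
  have "A ** B ** (matrix_inv B ** matrix_inv A) = A ** (B ** matrix_inv B) ** matrix_inv A"
    by (simp add: matrix_mul_assoc)
  then show "A ** B ** (matrix_inv B ** matrix_inv A) = mat 1" using assms by (simp add: matrix_inv_mult)
qed

lemma matrix_mult_right_cancel:
  fixes A B g :: "complex^'n^'n"
  assumes "invertible g" "A ** g = B ** g" shows "A = B"
  using arg_cong[OF assms(2), of "\<lambda>M. M ** matrix_inv g"] assms(1) by (simp add: matrix_inv_cancel)

text \<open>Cramer's rule shows that the inverse depends holomorphically on the matrix.\<close>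

lemma matrix_inv_nth_cramer:
  fixes A :: "complex^'n^'n"
  assumes "invertible A"
  shows "matrix_inv A $ k $ j =
    det (\<chi> i l. if l = k then (if i = j then 1 else 0) else A $ i $ l) / det A"
proof -
  let ?x = "\<chi> k. matrix_inv A $ k $ j" and ?b = "(\<chi> i. if i = j then 1 else 0) :: complex^'n"
  have "A *v ?x = ?b"
    using arg_cong[OF matrix_inv_mult(1)[OF assms], of "\<lambda>M. (\<chi> i. M $ i $ j)"]
    by (simp add: matrix_vector_mult_def matrix_mult_nth mat_def)
  then have "?x = (\<chi> k. det (\<chi> i l. if l = k then ?b $ i else A $ i $ l) / det A)"
    using assms cramer invertible_det_nz by blast
  from arg_cong[OF this, of "\<lambda>v. v $ k"] show ?thesis by (simp cong: if_cong)
qed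

text \<open>Complex differentiability is expressed entry by entry because the type of matrices is only a real
  normed space.\<close>

definition has_matrix_derivative ::
    "(complex \<Rightarrow> complex^'n^'n) \<Rightarrow> complex^'n^'n \<Rightarrow> complex \<Rightarrow> bool" where
  "has_matrix_derivative F F' z \<longleftrightarrow> (\<forall>i j. ((\<lambda>w. F w $ i $ j) has_field_derivative F' $ i $ j) (at z))"

lemma has_matrix_derivative_const: "has_matrix_derivative (\<lambda>w. A) 0 z"
  by (simp add: has_matrix_derivative_def)

lemma has_matrix_derivative_mult:
  assumes "has_matrix_derivative F F' z" "has_matrix_derivative H H' z"
  shows "has_matrix_derivative (\<lambda>w. F w ** H w) (F' ** H z + F z ** H') z"
  unfolding has_matrix_derivative_def matrix_mult_nth
proof (intro allI)
  fix i j
  have "((\<lambda>w. \<Sum>k\<in>UNIV. F w $ i $ k * H w $ k $ j) has_field_derivative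
     (\<Sum>k\<in>UNIV. F' $ i $ k * H z $ k $ j + H' $ k $ j * F z $ i $ k)) (at z)"
    using assms unfolding has_matrix_derivative_def by (intro DERIV_sum DERIV_mult) auto
  then show "((\<lambda>w. \<Sum>k\<in>UNIV. F w $ i $ k * H w $ k $ j) has_field_derivative
        (F' ** H z + F z ** H') $ i $ j) (at z)"
    by (simp add: matrix_mult_nth sum.distrib mult.commute)
qed

lemma has_matrix_derivative_compose:
  assumes "has_matrix_derivative F F' (f z)" "(f has_field_derivative f') (at z)"
  shows "has_matrix_derivative (\<lambda>w. F (f w)) (matrix_scale f' F') z"
  using assms DERIV_chain2 unfolding has_matrix_derivative_def by (fastforce simp: mult.commute)

lemma has_matrix_derivative_line: "has_matrix_derivative (\<lambda>t. A + matrix_scale t B) B z"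
  unfolding has_matrix_derivative_def by (auto intro!: derivative_eq_intros)

lemma has_matrix_derivative_transform:
  assumes "has_matrix_derivative F F' z" "open U" "z \<in> U" "\<And>w. w \<in> U \<Longrightarrow> F w = H w"
  shows "has_matrix_derivative H F' z"
  unfolding has_matrix_derivative_def
proof (intro allI)
  fix i j
  show "((\<lambda>w. H w $ i $ j) has_field_derivative F' $ i $ j) (at z)"
    by (rule has_field_derivative_transform_within_open[of "\<lambda>w. F w $ i $ j" _ _ U])
       (use assms in \<open>auto simp: has_matrix_derivative_def\<close>)
qed

lemma has_matrix_derivative_unique:
  "has_matrix_derivative F A z \<Longrightarrow> has_matrix_derivative F B z \<Longrightarrow> A = B"
  unfolding has_matrix_derivative_def vec_eq_iff by (blast intro: DERIV_unique)

lemma has_matrix_derivative_eq_rhs: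
  "has_matrix_derivative F A z \<Longrightarrow> A = B \<Longrightarrow> has_matrix_derivative F B z"
  by simp

definition matrix_deriv :: "(complex \<Rightarrow> complex^'n^'n) \<Rightarrow> complex \<Rightarrow> complex^'n^'n" where
  "matrix_deriv F z = (\<chi> i j. deriv (\<lambda>w. F w $ i $ j) z)"

lemma has_matrix_derivative_imp_deriv:
  "has_matrix_derivative F F' z \<Longrightarrow> matrix_deriv F z = F'"
  by (auto simp: has_matrix_derivative_def matrix_deriv_def vec_eq_iff intro: DERIV_imp_deriv)

lemma matrix_holomorphic_has_derivative:
  assumes "matrix_holomorphic_on F U" "open U" "z \<in> U"
  shows "has_matrix_derivative F (matrix_deriv F z) z"
  using assms holomorphic_derivI
  unfolding matrix_holomorphic_on_def has_matrix_derivative_def matrix_deriv_def by fastforce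

lemma matrix_holomorphic_deriv:
  "matrix_holomorphic_on F U \<Longrightarrow> open U \<Longrightarrow> matrix_holomorphic_on (matrix_deriv F) U"
  by (auto simp: matrix_holomorphic_on_def matrix_deriv_def intro: holomorphic_deriv)

lemma matrix_holomorphicI:
  assumes "\<And>z. z \<in> U \<Longrightarrow> \<exists>F'. has_matrix_derivative F F' z"
  shows "matrix_holomorphic_on F U"
  unfolding matrix_holomorphic_on_def holomorphic_on_def field_differentiable_def
  using assms unfolding has_matrix_derivative_def
  by (meson DERIV_subset subset_UNIV)

lemma matrix_holomorphic_const: "matrix_holomorphic_on (\<lambda>z. A) U"
  by (simp add: matrix_holomorphic_on_def)

lemma matrix_holomorphic_mult:
  "matrix_holomorphic_on F U \<Longrightarrow> matrix_holomorphic_on H U \<Longrightarrow> matrix_holomorphic_on (\<lambda>z. F z ** H z) U"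
  by (auto simp: matrix_holomorphic_on_def matrix_mult_nth intro!: holomorphic_intros)

lemma matrix_holomorphic_add:
  "matrix_holomorphic_on F U \<Longrightarrow> matrix_holomorphic_on H U \<Longrightarrow> matrix_holomorphic_on (\<lambda>z. F z + H z) U"
  by (auto simp: matrix_holomorphic_on_def intro!: holomorphic_intros)

lemma matrix_holomorphic_diff:
  "matrix_holomorphic_on F U \<Longrightarrow> matrix_holomorphic_on H U \<Longrightarrow> matrix_holomorphic_on (\<lambda>z. F z - H z) U"
  by (auto simp: matrix_holomorphic_on_def intro!: holomorphic_intros)

lemma matrix_holomorphic_scale:
  "f holomorphic_on U \<Longrightarrow> matrix_holomorphic_on F U \<Longrightarrow> matrix_holomorphic_on (\<lambda>z. matrix_scale (f z) (F z)) U"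
  by (auto simp: matrix_holomorphic_on_def intro!: holomorphic_intros)

lemma matrix_holomorphic_compose:
  assumes "matrix_holomorphic_on F V" "f holomorphic_on U" "f ` U \<subseteq> V"
  shows "matrix_holomorphic_on (\<lambda>z. F (f z)) U"
  unfolding matrix_holomorphic_on_def
proof (intro allI)
  fix i j
  have "((\<lambda>w. F w $ i $ j) \<circ> f) holomorphic_on U"
    using assms by (intro holomorphic_on_compose_gen[where t = V]) (auto simp: matrix_holomorphic_on_def)
  then show "(\<lambda>z. F (f z) $ i $ j) holomorphic_on U" by (simp add: o_def)
qed

lemma matrix_holomorphic_subset:
  "matrix_holomorphic_on F U \<Longrightarrow> V \<subseteq> U \<Longrightarrow> matrix_holomorphic_on F V"
  by (auto simp: matrix_holomorphic_on_def intro: holomorphic_on_subset)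

lemma matrix_holomorphic_continuous:
  "matrix_holomorphic_on F U \<Longrightarrow> continuous_on U F"
proof -
  assume "matrix_holomorphic_on F U"
  then have "continuous_on U (\<lambda>z. \<chi> i j. F z $ i $ j)"
    unfolding matrix_holomorphic_on_def
    by (intro continuous_on_vec_lambda) (auto intro: holomorphic_on_imp_continuous_on)
  then show ?thesis by simp
qed

lemma holomorphic_on_det:
  fixes F :: "complex \<Rightarrow> complex^'n^'n"
  assumes "\<And>i j. (\<lambda>z. F z $ i $ j) holomorphic_on U"
  shows "(\<lambda>z. det (F z)) holomorphic_on U"
  unfolding det_def by (intro holomorphic_intros assms)

lemma matrix_holomorphic_inv:
  fixes F :: "complex \<Rightarrow> complex^'n^'n"
  assumes "matrix_holomorphic_on F U" "\<And>z. z \<in> U \<Longrightarrow> invertible (F z)"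
  shows "matrix_holomorphic_on (\<lambda>z. matrix_inv (F z)) U"
  unfolding matrix_holomorphic_on_def
proof (intro allI)
  fix k j
  let ?M = "\<lambda>z. ((\<chi> i l. if l = k then (if i = j then 1 else 0) else F z $ i $ l) :: complex^'n^'n)"
  have F: "(\<lambda>z. F z $ i $ l) holomorphic_on U" for i l
    using assms(1) by (simp add: matrix_holomorphic_on_def)
  have "(\<lambda>z. det (?M z)) holomorphic_on U"
  proof (rule holomorphic_on_det)
    fix i l
    show "(\<lambda>z. ?M z $ i $ l) holomorphic_on U"
      using F by (cases "l = k"; cases "i = j") auto
  qed
  then have "(\<lambda>z. det (?M z) / det (F z)) holomorphic_on U"
    using assms(2) by (intro holomorphic_on_divide holomorphic_on_det[OF F]) (auto simp: invertible_det_nz)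
  then show "(\<lambda>z. matrix_inv (F z) $ k $ j) holomorphic_on U"
    by (rule holomorphic_transform) (simp add: matrix_inv_nth_cramer assms(2))
qed

lemma has_matrix_derivative_inv:
  assumes F: "matrix_holomorphic_on F U" "\<And>z. z \<in> U \<Longrightarrow> invertible (F z)" and U: "open U" "z \<in> U"
    and F': "has_matrix_derivative F F' z"
  shows "has_matrix_derivative (\<lambda>w. matrix_inv (F w)) (- (matrix_inv (F z) ** F' ** matrix_inv (F z))) z"
proof -
  let ?I = "\<lambda>w. matrix_inv (F w)"
  note I = matrix_holomorphic_has_derivative[OF matrix_holomorphic_inv[OF F] U]
  let ?J = "matrix_deriv ?I z"
  have "has_matrix_derivative (\<lambda>w. F w ** ?I w) (F' ** ?I z + F z ** ?J) z"
    by (rule has_matrix_derivative_mult[OF F' I])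
  then have "has_matrix_derivative (\<lambda>w. mat 1) (F' ** ?I z + F z ** ?J) z"
    by (rule has_matrix_derivative_transform[OF _ U]) (simp add: matrix_inv_mult F(2))
  then have "F' ** ?I z + F z ** ?J = 0"
    by (rule has_matrix_derivative_unique) (rule has_matrix_derivative_const)
  then have "?I z ** (F' ** ?I z + F z ** ?J) = 0" by simp
  then have "?I z ** F' ** ?I z + ?J = 0"
    using F(2)[OF U(2)] by (simp add: matrix_add_ldistrib matrix_inv_cancel_left matrix_mul_assoc[symmetric])
  then have "?J = - (?I z ** F' ** ?I z)" by (simp add: eq_neg_iff_add_eq_0 add.commute)
  then show ?thesis using I by simp
qed

lemma matrix_derivative_zero_constant:
  assumes "convex U" "open U" "\<And>z. z \<in> U \<Longrightarrow> has_matrix_derivative F 0 z" "z \<in> U" "w \<in> U"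
  shows "F z = F w"
proof -
  have "F z $ i $ j = F w $ i $ j" for i j
  proof -
    have "\<exists>c. \<forall>x\<in>U. F x $ i $ j = c"
      using has_field_derivative_zero_constant[OF assms(1), of "\<lambda>x. F x $ i $ j"] assms(2,3)
      by (auto simp: has_matrix_derivative_def at_within_open[OF _ assms(2)])
    then show ?thesis using assms(4,5) by metis
  qed
  then show ?thesis by (simp add: vec_eq_iff)
qed

section \<open>The tangent algebra of a linear algebraic group\<close>

lemma linear_algebraic_group_invertible:
  "linear_algebraic_group G \<Longrightarrow> A \<in> G \<Longrightarrow> invertible A"
  unfolding linear_algebraic_group_def zariski_closed_in_GL_def by auto

lemma linear_algebraic_group_closed:
  fixes G :: "(complex^'n^'n) set"
  assumes "linear_algebraic_group G"
  shows "mat 1 \<in> G" "A \<in> G \<Longrightarrow> B \<in> G \<Longrightarrow> A ** B \<in> G" "A \<in> G \<Longrightarrow> matrix_inv A \<in> G"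
proof -
  interpret subgroup G GL using assms by (simp add: linear_algebraic_group_def)
  show "mat 1 \<in> G" using one_closed by (simp add: GL_def)
  show "A ** B \<in> G" if "A \<in> G" "B \<in> G" using m_closed[OF that] by (simp add: GL_def)
  show "matrix_inv A \<in> G" if A: "A \<in> G"
  proof -
    have inv: "invertible A" by (rule linear_algebraic_group_invertible[OF assms A])
    have "inv\<^bsub>GL\<^esub> A = matrix_inv A"
      unfolding m_inv_def
    proof (rule the_equality)
      show "matrix_inv A \<in> carrier GL \<and> A \<otimes>\<^bsub>GL\<^esub> matrix_inv A = \<one>\<^bsub>GL\<^esub> \<and> matrix_inv A \<otimes>\<^bsub>GL\<^esub> A = \<one>\<^bsub>GL\<^esub>"
        using inv by (simp add: GL_def invertible_matrix_inv matrix_inv_mult)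
    next
      fix B assume "B \<in> carrier GL \<and> A \<otimes>\<^bsub>GL\<^esub> B = \<one>\<^bsub>GL\<^esub> \<and> B \<otimes>\<^bsub>GL\<^esub> A = \<one>\<^bsub>GL\<^esub>"
      then show "B = matrix_inv A" by (simp add: GL_def matrix_inv_unique[of A B])
    qed
    then show ?thesis using m_inv_closed[OF A] by simp
  qed
qed

text \<open>These polynomials form the vanishing ideal of the group.\<close>

definition vanishing_polynomial :: "(complex^'n^'n) set \<Rightarrow> (complex^'n^'n \<Rightarrow> complex) \<Rightarrow> bool" where
  "vanishing_polynomial G p \<longleftrightarrow> matrix_polynomial p \<and> (\<forall>A\<in>G. p A = 0)"

lemma linear_algebraic_group_memI:
  assumes "linear_algebraic_group G" "invertible A" "\<And>p. vanishing_polynomial G p \<Longrightarrow> p A = 0"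
  shows "A \<in> G"
proof -
  obtain S where S: "\<forall>p\<in>S. matrix_polynomial p" "G = {A. invertible A \<and> (\<forall>p\<in>S. p A = 0)}"
    using assms(1) unfolding linear_algebraic_group_def zariski_closed_in_GL_def by auto
  have "vanishing_polynomial G p" if "p \<in> S" for p
    using S that unfolding vanishing_polynomial_def by auto
  then show ?thesis using S(2) assms(2,3) by auto
qed

lemma matrix_polynomial_sum:
  "finite I \<Longrightarrow> (\<And>k. k \<in> I \<Longrightarrow> matrix_polynomial (f k)) \<Longrightarrow> matrix_polynomial (\<lambda>A. \<Sum>k\<in>I. f k A)"
  by (induction I rule: finite_induct) (auto intro: matrix_polynomial.intros)

lemma matrix_polynomial_mult_entry: "matrix_polynomial (\<lambda>A. (X ** A) $ i $ j)"
  unfolding matrix_mult_nth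
  by (intro matrix_polynomial_sum matrix_polynomial.mult matrix_polynomial.const matrix_polynomial.entry) simp

lemma matrix_polynomial_left_translate:
  "matrix_polynomial p \<Longrightarrow> matrix_polynomial (\<lambda>A. p (X ** A))"
  by (induction rule: matrix_polynomial.induct)
    (auto intro: matrix_polynomial.intros matrix_polynomial_mult_entry)

definition poly_differential ::
    "(complex^'n^'n \<Rightarrow> complex) \<Rightarrow> complex^'n^'n \<Rightarrow> complex^'n^'n \<Rightarrow> complex" where
  "poly_differential p A B = deriv (\<lambda>t. p (A + matrix_scale t B)) 0"

text \<open>The chain rule along holomorphic curves determines the differential of a polynomial. The last
  conjunct says that the right invariant vector field \<open>A \<mapsto> X A\<close> acts on polynomials.\<close>

definition is_differential ::
    "(complex^'n^'n \<Rightarrow> complex) \<Rightarrow> (complex^'n^'n \<Rightarrow> complex^'n^'n \<Rightarrow> complex) \<Rightarrow> bool" where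
  "is_differential p d \<longleftrightarrow>
     (\<forall>\<gamma> \<gamma>' z. has_matrix_derivative \<gamma> \<gamma>' z \<longrightarrow>
        ((\<lambda>w. p (\<gamma> w)) has_field_derivative d (\<gamma> z) \<gamma>') (at z)) \<and>
     (\<forall>A B C. d A (B + C) = d A B + d A C) \<and> (\<forall>A c B. d A (matrix_scale c B) = c * d A B) \<and>
     (\<forall>X. matrix_polynomial (\<lambda>A. d A (X ** A)))"

lemma matrix_polynomial_differential_exists:
  "matrix_polynomial p \<Longrightarrow> \<exists>d. is_differential p d"
proof (induction rule: matrix_polynomial.induct)
  case (const c)
  show ?case
    by (rule exI[of _ "\<lambda>A B. 0"]) (auto simp: is_differential_def intro: matrix_polynomial.intros)
next
  case (entry i j)
  show ?case
    by (rule exI[of _ "\<lambda>A B. B $ i $ j"])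
       (auto simp: is_differential_def has_matrix_derivative_def intro: matrix_polynomial_mult_entry)
next
  case (add p q)
  then obtain d e where "is_differential p d" "is_differential q e" by blast
  then have "is_differential (\<lambda>A. p A + q A) (\<lambda>A B. d A B + e A B)"
    by (simp add: is_differential_def DERIV_add matrix_polynomial.add algebra_simps)
  then show ?case by blast
next
  case (mult p q)
  then obtain d e where de: "is_differential p d" "is_differential q e" by blast
  have "is_differential (\<lambda>A. p A * q A) (\<lambda>A B. d A B * q A + e A B * p A)"
    unfolding is_differential_def
  proof (intro conjI allI impI)
    fix \<gamma> :: "complex \<Rightarrow> complex^'a^'a" and \<gamma>' z assume "has_matrix_derivative \<gamma> \<gamma>' z"
    then show "((\<lambda>w. p (\<gamma> w) * q (\<gamma> w)) has_field_derivative
        d (\<gamma> z) \<gamma>' * q (\<gamma> z) + e (\<gamma> z) \<gamma>' * p (\<gamma> z)) (at z)"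
      using de unfolding is_differential_def by (intro DERIV_mult) auto
  next
    fix X
    show "matrix_polynomial (\<lambda>A. d A (X ** A) * q A + e A (X ** A) * p A)"
      using de mult.hyps unfolding is_differential_def
      by (intro matrix_polynomial.add matrix_polynomial.mult) auto
  qed (use de in \<open>simp_all add: is_differential_def algebra_simps\<close>)
  then show ?case by blast
qed

lemma is_differential_poly_differential:
  assumes "matrix_polynomial p"
  shows "is_differential p (poly_differential p)"
proof -
  obtain d where d: "is_differential p d"
    using matrix_polynomial_differential_exists[OF assms] by blast
  have "poly_differential p A B = d A B" for A B
  proof -
    have "((\<lambda>t. p (A + matrix_scale t B)) has_field_derivative d (A + matrix_scale 0 B) B) (at 0)"
      using d has_matrix_derivative_line[of A B 0] unfolding is_differential_def by blast
    then show ?thesis by (simp add: poly_differential_def DERIV_imp_deriv)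
  qed
  then have "poly_differential p = d" by (intro ext)
  then show ?thesis using d by simp
qed

lemma
  assumes "matrix_polynomial p"
  shows poly_differential_chain: "has_matrix_derivative \<gamma> \<gamma>' z \<Longrightarrow>
        ((\<lambda>w. p (\<gamma> w)) has_field_derivative poly_differential p (\<gamma> z) \<gamma>') (at z)"
    and poly_differential_add: "poly_differential p A (B + C) = poly_differential p A B + poly_differential p A C"
    and poly_differential_scale: "poly_differential p A (matrix_scale c B) = c * poly_differential p A B"
    and poly_differential_polynomial: "matrix_polynomial (\<lambda>A. poly_differential p A (X ** A))"
  using is_differential_poly_differential[OF assms] by (simp_all add: is_differential_def)

lemma poly_differential_sum:
  assumes "matrix_polynomial p" "finite I"
  shows "poly_differential p A (\<Sum>k\<in>I. B k) = (\<Sum>k\<in>I. poly_differential p A (B k))"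
  using assms(2)
proof (induction I rule: finite_induct)
  case empty
  show ?case using poly_differential_scale[OF assms(1), of A 0 0] by simp
qed (simp add: poly_differential_add[OF assms(1)])

text \<open>The Lie algebra in the form in which it is used here: \<open>X\<close> belongs to it if the right invariant
  vector field \<open>A \<mapsto> X A\<close> is tangent to the group, that is, if it maps the vanishing ideal into
  itself. In contrast to the definition by one-parameter subgroups this is visibly a complex linear condition.\<close>

definition tangent_algebra :: "(complex^'n^'n) set \<Rightarrow> (complex^'n^'n) set" where
  "tangent_algebra G = {X. \<forall>p. vanishing_polynomial G p \<longrightarrow> (\<forall>A\<in>G. poly_differential p A (X ** A) = 0)}"

lemma tangent_algebra_add: "X \<in> tangent_algebra G \<Longrightarrow> Y \<in> tangent_algebra G \<Longrightarrow> X + Y \<in> tangent_algebra G"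
  by (auto simp: tangent_algebra_def vanishing_polynomial_def matrix_add_rdistrib poly_differential_add)

lemma tangent_algebra_scale: "X \<in> tangent_algebra G \<Longrightarrow> matrix_scale c X \<in> tangent_algebra G"
  by (auto simp: tangent_algebra_def vanishing_polynomial_def matrix_scale_left poly_differential_scale)

lemma tangent_algebra_diff:
  assumes "X \<in> tangent_algebra G" "Y \<in> tangent_algebra G"
  shows "X - Y \<in> tangent_algebra G"
proof -
  have "X - Y = X + matrix_scale (-1) Y" by (simp add: vec_eq_iff)
  also have "\<dots> \<in> tangent_algebra G" by (intro tangent_algebra_add tangent_algebra_scale assms)
  finally show ?thesis .
qed

text \<open>A polynomial that vanishes on \<open>G\<close> vanishes along the translate \<open>\<gamma> B\<close> for every \<open>B \<in> G\<close>;
  choosing \<open>B\<close> such that the translated curve passes through a prescribed point \<open>A\<close> gives the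
  condition at \<open>A\<close>.\<close>

lemma tangent_algebra_velocity:
  assumes G: "linear_algebraic_group G" and \<gamma>: "has_matrix_derivative \<gamma> \<gamma>' z"
    and U: "open U" "z \<in> U" "\<And>w. w \<in> U \<Longrightarrow> \<gamma> w \<in> G"
  shows "\<gamma>' ** matrix_inv (\<gamma> z) \<in> tangent_algebra G"
  unfolding tangent_algebra_def
proof (clarify)
  fix p A assume p: "vanishing_polynomial G p" and A: "A \<in> G"
  define B where "B = matrix_inv (\<gamma> z) ** A"
  have B: "B \<in> G" unfolding B_def using G U A by (intro linear_algebraic_group_closed) auto
  have "has_matrix_derivative (\<lambda>w. \<gamma> w ** B) (\<gamma>' ** B) z"
    using has_matrix_derivative_mult[OF \<gamma> has_matrix_derivative_const[of B]] by simp
  then have "((\<lambda>w. p (\<gamma> w ** B)) has_field_derivative poly_differential p (\<gamma> z ** B) (\<gamma>' ** B)) (at z)"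
    using poly_differential_chain p unfolding vanishing_polynomial_def by blast
  moreover have "((\<lambda>w. p (\<gamma> w ** B)) has_field_derivative 0) (at z)"
  proof (rule has_field_derivative_transform_within_open[of "\<lambda>w. 0" _ _ U])
    show "\<And>w. w \<in> U \<Longrightarrow> 0 = p (\<gamma> w ** B)"
      using p U B G unfolding vanishing_polynomial_def by (simp add: linear_algebraic_group_closed)
  qed (use U in auto)
  ultimately have "poly_differential p (\<gamma> z ** B) (\<gamma>' ** B) = 0" by (rule DERIV_unique)
  moreover have "\<gamma> z ** B = A"
    unfolding B_def using linear_algebraic_group_invertible[OF G] U by (simp add: matrix_inv_cancel_left)
  ultimately show "poly_differential p A (\<gamma>' ** matrix_inv (\<gamma> z) ** A) = 0"
    by (simp add: B_def matrix_mul_assoc)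
qed

text \<open>Precomposing with the translation by \<open>g\<close> permutes the vanishing ideal.\<close>

lemma tangent_algebra_conjugate:
  assumes G: "linear_algebraic_group G" and g: "g \<in> G" and X: "X \<in> tangent_algebra G"
  shows "g ** X ** matrix_inv g \<in> tangent_algebra G"
  unfolding tangent_algebra_def
proof (clarify)
  fix p A assume p: "vanishing_polynomial G p" and A: "A \<in> G"
  define q where "q = (\<lambda>B. p (g ** B))"
  have q: "vanishing_polynomial G q"
    using p g G unfolding q_def vanishing_polynomial_def
    by (auto intro: matrix_polynomial_left_translate linear_algebraic_group_closed)
  define B where "B = matrix_inv g ** A"
  have B: "B \<in> G" unfolding B_def using G g A by (intro linear_algebraic_group_closed) auto
  have gB: "g ** B = A"
    unfolding B_def using linear_algebraic_group_invertible[OF G g] by (simp add: matrix_inv_cancel_left)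
  have line: "has_matrix_derivative (\<lambda>t. B + matrix_scale t (X ** B)) (X ** B) 0"
    by (rule has_matrix_derivative_line)
  have "((\<lambda>t. q (B + matrix_scale t (X ** B))) has_field_derivative poly_differential q B (X ** B)) (at 0)"
    using poly_differential_chain[OF _ line, of q] q unfolding vanishing_polynomial_def by simp
  moreover have "((\<lambda>t. q (B + matrix_scale t (X ** B))) has_field_derivative
      poly_differential p (g ** B) (g ** (X ** B))) (at 0)"
    using poly_differential_chain[OF _ has_matrix_derivative_mult[OF has_matrix_derivative_const[of g] line], of p] p
    unfolding vanishing_polynomial_def q_def by simp
  ultimately have "poly_differential p (g ** B) (g ** (X ** B)) = poly_differential q B (X ** B)"
    by (rule DERIV_unique[symmetric])
  also have "\<dots> = 0" using X q B unfolding tangent_algebra_def by auto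
  finally show "poly_differential p A (g ** X ** matrix_inv g ** A) = 0"
    unfolding gB by (simp add: B_def matrix_mul_assoc)
qed

lemma matrix_sum_mult:
  fixes M :: "'k \<Rightarrow> complex^'n^'n"
  assumes "finite I"
  shows "(\<Sum>k\<in>I. M k) ** A = (\<Sum>k\<in>I. M k ** A)"
  using assms by (induction I rule: finite_induct) (simp_all add: matrix_add_rdistrib)

definition matrix_unit :: "'n::finite \<Rightarrow> 'n \<Rightarrow> complex^'n^'n" where
  "matrix_unit i j = (\<chi> k l. if k = i \<and> l = j then 1 else 0)"

lemma matrix_unit_nth [simp]: "matrix_unit i j $ k $ l = (if k = i \<and> l = j then 1 else 0)"
  by (simp add: matrix_unit_def)

lemma matrix_unit_expansion:
  "X = (\<Sum>i\<in>UNIV. \<Sum>j\<in>UNIV. matrix_scale (X $ i $ j) (matrix_unit i j))"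
proof -
  have "(\<Sum>i\<in>UNIV. \<Sum>j\<in>UNIV. if k = i \<and> l = j then X $ i $ j else 0) = X $ k $ l" for k l
  proof -
    have "(\<Sum>i\<in>UNIV. \<Sum>j\<in>UNIV. if k = i \<and> l = j then X $ i $ j else 0) =
       (\<Sum>i\<in>UNIV. if k = i then \<Sum>j\<in>UNIV. if l = j then X $ i $ j else 0 else 0)"
      by (intro sum.cong) (auto simp: if_distrib)
    then show ?thesis by simp
  qed
  then show ?thesis by (simp add: vec_eq_iff if_distrib cong: if_cong)
qed

text \<open>Linear conditions on the entries pass to integrals and limits.\<close>

lemma tangent_algebra_functionals:
  "\<exists>\<Lambda>. \<forall>X. X \<in> tangent_algebra G \<longleftrightarrow> (\<forall>c\<in>\<Lambda>. (\<Sum>i\<in>UNIV. \<Sum>j\<in>UNIV. X $ i $ j * c i j) = 0)"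
proof
  let ?c = "\<lambda>(p, A) i j. poly_differential p A (matrix_unit i j ** A)"
  let ?V = "{(p, A). vanishing_polynomial G p \<and> A \<in> G}"
  have eq: "poly_differential p A (X ** A) = (\<Sum>i\<in>UNIV. \<Sum>j\<in>UNIV. X $ i $ j * ?c (p, A) i j)"
    if "(p, A) \<in> ?V" for p A X
  proof -
    have p: "matrix_polynomial p" using that by (simp add: vanishing_polynomial_def)
    have "X ** A = (\<Sum>i\<in>UNIV. \<Sum>j\<in>UNIV. matrix_scale (X $ i $ j) (matrix_unit i j ** A))"
      by (subst matrix_unit_expansion[of X]) (simp add: matrix_sum_mult matrix_scale_left)
    then show ?thesis
      by (simp add: poly_differential_sum[OF p] poly_differential_scale[OF p])
  qed
  show "\<forall>X. X \<in> tangent_algebra G \<longleftrightarrow> (\<forall>c\<in>?c ` ?V. (\<Sum>i\<in>UNIV. \<Sum>j\<in>UNIV. X $ i $ j * c i j) = 0)"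
  proof
    fix X
    have "X \<in> tangent_algebra G \<longleftrightarrow> (\<forall>(p, A)\<in>?V. poly_differential p A (X ** A) = 0)"
      by (auto simp: tangent_algebra_def)
    also have "\<dots> \<longleftrightarrow> (\<forall>x\<in>?V. (\<Sum>i\<in>UNIV. \<Sum>j\<in>UNIV. X $ i $ j * ?c x i j) = 0)"
      by (rule ball_cong) (use eq in auto)
    finally show "X \<in> tangent_algebra G \<longleftrightarrow>
        (\<forall>c\<in>?c ` ?V. (\<Sum>i\<in>UNIV. \<Sum>j\<in>UNIV. X $ i $ j * c i j) = 0)"
      by simp
  qed
qed

text \<open>Complex dimensions and matrices of complex linear maps refer to the scalar multiplication of
  \<open>complex^'m\<close>, so spaces of matrices are transported there.\<close>

definition vectorize :: "complex^'n^'n \<Rightarrow> complex^('n \<times> 'n)" where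
  "vectorize A = (\<chi> p. A $ fst p $ snd p)"

definition devectorize :: "complex^('n \<times> 'n) \<Rightarrow> complex^'n^'n" where
  "devectorize v = (\<chi> i j. v $ (i, j))"

lemma devectorize_nth [simp]: "devectorize v $ i $ j = v $ (i, j)"
  by (simp add: devectorize_def)

lemma vectorize_nth [simp]: "vectorize A $ p = A $ fst p $ snd p"
  by (simp add: vectorize_def)

lemma vectorize_inverse [simp]: "devectorize (vectorize A) = A" "vectorize (devectorize v) = v"
  by (simp_all add: vec_eq_iff)

lemma vectorize_linear:
  "vectorize (A + B) = vectorize A + vectorize B" "vectorize (matrix_scale c A) = c *s vectorize A"
  by (simp_all add: vec_eq_iff)

lemma devectorize_linear:
  "devectorize (v + w) = devectorize v + devectorize w" "devectorize (c *s v) = matrix_scale c (devectorize v)"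
  by (simp_all add: vec_eq_iff)

lemma devectorize_0 [simp]: "devectorize 0 = 0"
  by (simp add: vec_eq_iff)

lemma devectorize_sum: "finite I \<Longrightarrow> devectorize (\<Sum>k\<in>I. f k) = (\<Sum>k\<in>I. devectorize (f k))"
  by (simp add: vec_eq_iff)

lemma zero_in_tangent_algebra: "0 \<in> tangent_algebra G"
  using tangent_algebra_functionals[of G] by force

lemma subspace_flat_tangent_algebra: "vec.subspace {v. devectorize v \<in> tangent_algebra G}"
  by (simp add: vec.subspace_def devectorize_linear tangent_algebra_add tangent_algebra_scale
        zero_in_tangent_algebra)

text \<open>A linear projection onto the tangent algebra, evaluated on matrix units. It turns a holomorphic
  function with values in the tangent algebra into a combination of fixed elements \<open>B k\<close> with
  holomorphic coefficients.\<close>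

lemma tangent_algebra_projection:
  fixes G :: "(complex^'n^'n) set"
  obtains B :: "'n \<times> 'n \<Rightarrow> complex^'n^'n" where "\<And>k. B k \<in> tangent_algebra G"
    "\<And>X. X \<in> tangent_algebra G \<Longrightarrow> X = (\<Sum>k\<in>UNIV. matrix_scale (X $ fst k $ snd k) (B k))"
proof -
  let ?V = "{v. devectorize v \<in> tangent_algebra G}"
  obtain \<pi> where \<pi>: "range \<pi> \<subseteq> ?V" "Vector_Spaces.linear (*s) (*s) \<pi>" "\<And>v. v \<in> ?V \<Longrightarrow> \<pi> v = v"
    using vec.linear_exists_right_inverse_on[OF vec.linear_id subspace_flat_tangent_algebra[of G]]
    by auto
  interpret \<pi>: Vector_Spaces.linear "(*s)" "(*s)" \<pi> by (rule \<pi>(2))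
  define B where "B = (\<lambda>k. devectorize (\<pi> (axis k 1)))"
  show ?thesis
  proof
    show "B k \<in> tangent_algebra G" for k using \<pi>(1) by (auto simp: B_def)
    fix X assume "X \<in> tangent_algebra G"
    then have "vectorize X = \<pi> (vectorize X)" by (simp add: \<pi>(3))
    also have "\<dots> = \<pi> (\<Sum>k\<in>UNIV. vectorize X $ k *s axis k 1)"
      by (simp only: basis_expansion)
    also have "\<dots> = (\<Sum>k\<in>UNIV. vectorize X $ k *s \<pi> (axis k 1))"
      by (simp only: \<pi>.sum \<pi>.scale)
    finally have eq: "vectorize X = (\<Sum>k\<in>UNIV. vectorize X $ k *s \<pi> (axis k 1))" .
    have "X = devectorize (vectorize X)" by simp
    also have "\<dots> = devectorize (\<Sum>k\<in>UNIV. vectorize X $ k *s \<pi> (axis k 1))"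
      by (rule arg_cong[OF eq])
    finally show "X = (\<Sum>k\<in>UNIV. matrix_scale (X $ fst k $ snd k) (B k))"
      by (simp add: devectorize_sum devectorize_linear B_def)
  qed
qed

section \<open>Linear differential equations\<close>

text \<open>Differentiating a vanishing polynomial along the solution gives a combination, with holomorphic
  coefficients, of vanishing polynomials along the solution. Hence each Taylor coefficient at \<open>0\<close> of such a
  function is a combination of lower coefficients of such functions, which are zero by an induction that
  treats all vanishing polynomials simultaneously; the induction starts because \<open>u 0 = mat 1\<close> lies in the group.\<close>

lemma ode_solution_in_group:
  fixes G :: "(complex^'n^'n) set"
  assumes G: "linear_algebraic_group G" and r: "r > 0"
    and Y: "matrix_holomorphic_on Y (ball 0 r)" "\<And>z. z \<in> ball 0 r \<Longrightarrow> Y z \<in> tangent_algebra G"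
    and u: "\<And>z. z \<in> ball 0 r \<Longrightarrow> has_matrix_derivative u (Y z ** u z) z"
      "u 0 = mat 1" "\<And>z. z \<in> ball 0 r \<Longrightarrow> invertible (u z)"
    and z: "z \<in> ball 0 r"
  shows "u z \<in> G"
proof (rule linear_algebraic_group_memI[OF G])
  obtain B :: "'n \<times> 'n \<Rightarrow> complex^'n^'n" where B: "\<And>k. B k \<in> tangent_algebra G"
    "\<And>X. X \<in> tangent_algebra G \<Longrightarrow> X = (\<Sum>k\<in>UNIV. matrix_scale (X $ fst k $ snd k) (B k))"
    using tangent_algebra_projection[where G = G] by blast
  let ?V = "vanishing_polynomial G"
  define f where "f = (\<lambda>p w. p (u w) :: complex)"
  define D where "D = (\<lambda>p k A. poly_differential p A (B k ** A))"
  define y where "y = (\<lambda>k w. Y w $ fst k $ snd k)"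
  have VD: "?V (D p k)" if "?V p" for p k
    using that B(1)[of k] poly_differential_polynomial[of p "B k"]
    unfolding vanishing_polynomial_def D_def tangent_algebra_def by auto
  have deriv: "(f p has_field_derivative (\<Sum>k\<in>UNIV. y k w * f (D p k) w)) (at w)"
    if p: "?V p" and w: "w \<in> ball 0 r" for p w
  proof -
    have mp: "matrix_polynomial p" using p by (simp add: vanishing_polynomial_def)
    have "Y w ** u w = (\<Sum>k\<in>UNIV. matrix_scale (y k w) (B k ** u w))"
      by (subst B(2)[OF Y(2)[OF w]]) (simp add: matrix_sum_mult matrix_scale_left y_def)
    then have "poly_differential p (u w) (Y w ** u w) = (\<Sum>k\<in>UNIV. y k w * f (D p k) w)"
      by (simp add: poly_differential_sum[OF mp] poly_differential_scale[OF mp] f_def D_def)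
    then show ?thesis
      using poly_differential_chain[OF mp u(1)[OF w]] by (simp add: f_def)
  qed
  have hol: "f p holomorphic_on ball 0 r" if "?V p" for p
    unfolding holomorphic_on_open[OF open_ball] using deriv[OF that] by blast
  have holy: "y k holomorphic_on ball 0 r" for k
    using Y(1) by (simp add: matrix_holomorphic_on_def y_def)
  have r0: "(0::complex) \<in> ball 0 r" using r by simp
  have fps: "g has_fps_expansion fps_expansion g 0" if "g holomorphic_on ball 0 r" for g
    using has_fps_expansion_fps_expansion[OF open_ball r0 that] .
  have coeff: "fps_nth (fps_expansion (f p) 0) n = 0" if "?V p" for p n
    using that
  proof (induction n arbitrary: p rule: less_induct)
    case (less n)
    show ?case
    proof (cases n)
      case 0
      have "f p 0 = 0" using less.prems G u(2)
        by (simp add: f_def vanishing_polynomial_def linear_algebraic_group_closed)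
      then show ?thesis using 0 by (simp add: fps_expansion_def)
    next
      case (Suc m)
      let ?S = "\<Sum>k\<in>UNIV. fps_expansion (y k) 0 * fps_expansion (f (D p k)) 0"
      have "(\<lambda>w. \<Sum>k\<in>UNIV. y k w * f (D p k) w) has_fps_expansion ?S"
        by (intro has_fps_expansion_sum has_fps_expansion_mult fps holy hol VD less.prems)
      moreover have "eventually (\<lambda>w. (\<Sum>k\<in>UNIV. y k w * f (D p k) w) = deriv (f p) w) (nhds 0)"
        using eventually_nhds_in_open[OF open_ball r0]
        by eventually_elim (metis DERIV_imp_deriv deriv[OF less.prems])
      ultimately have "deriv (f p) has_fps_expansion ?S"
        using has_fps_expansion_cong[of "\<lambda>w. \<Sum>k\<in>UNIV. y k w * f (D p k) w" "deriv (f p)" ?S ?S] by simp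
      moreover have "deriv (f p) has_fps_expansion fps_deriv (fps_expansion (f p) 0)"
        by (intro has_fps_expansion_deriv fps hol less.prems)
      ultimately have "fps_deriv (fps_expansion (f p) 0) = ?S"
        using fps_expansion_unique_complex by blast
      then have "fps_nth (fps_deriv (fps_expansion (f p) 0)) m = fps_nth ?S m" by simp
      also have "\<dots> = 0"
      proof -
        have "fps_nth (fps_expansion (f (D p k)) 0) (m - i) = 0" for i k
          by (rule less.IH) (use Suc VD less.prems in auto)
        then show ?thesis by (simp add: fps_sum_nth fps_mult_nth)
      qed
      finally have "of_nat (Suc m) * fps_nth (fps_expansion (f p) 0) (Suc m) = 0"
        by (simp del: of_nat_Suc)
      then show ?thesis using Suc by (simp del: of_nat_Suc)
    qed
  qed
  show "p (u z) = 0" if "?V p" for p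
  proof -
    have "f p z = 0"
    proof (rule holomorphic_fun_eq_0_on_ball[OF hol[OF that] z])
      fix n show "(deriv ^^ n) (f p) 0 = 0"
        using coeff[OF that, of n] by (simp add: fps_expansion_def)
    qed
    then show ?thesis by (simp add: f_def)
  qed
  show "invertible (u z)" by (rule u(3)[OF z])
qed

text \<open>The Taylor coefficients of the solution of \<open>u' = Y u\<close>, \<open>u 0 = 1\<close>, in terms of those of \<open>Y\<close>.\<close>

fun ode_coeff :: "(nat \<Rightarrow> complex^'n^'n) \<Rightarrow> nat \<Rightarrow> complex^'n^'n" where
  "ode_coeff Y 0 = mat 1"
| "ode_coeff Y (Suc k) = matrix_scale (1 / of_nat (Suc k)) (\<Sum>j\<le>k. Y j ** ode_coeff Y (k - j))"

text \<open>The factor \<open>1 / (k + 1)\<close> of the recursion makes up for the \<open>k + 1\<close> summands, so the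
  coefficients grow at most geometrically.\<close>

lemma ode_coeff_bound:
  fixes Y :: "nat \<Rightarrow> complex^'n^'n"
  assumes Y: "\<And>k i j. cmod (Y k $ i $ j) \<le> M * K ^ k" and K: "real CARD('n) * M \<le> K" "0 \<le> M"
  shows "cmod (ode_coeff Y k $ i $ j) \<le> K ^ k"
proof (induction k arbitrary: i j rule: less_induct)
  case (less k)
  have K0: "K \<ge> 0" using K by (metis mult_nonneg_nonneg of_nat_0_le_iff order_trans)
  show ?case
  proof (cases k)
    case 0
    then show ?thesis by (simp add: mat_def)
  next
    case (Suc m)
    have step: "cmod ((Y l ** ode_coeff Y (m - l)) $ i $ j) \<le> K ^ k" if l: "l \<le> m" for l
    proof -
      have "cmod ((Y l ** ode_coeff Y (m - l)) $ i $ j) \<le> (\<Sum>q\<in>(UNIV::'n set). M * K ^ l * K ^ (m - l))"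
        unfolding matrix_mult_nth
      proof (rule order_trans[OF norm_sum sum_mono])
        fix q :: 'n
        show "cmod (Y l $ i $ q * ode_coeff Y (m - l) $ q $ j) \<le> M * K ^ l * K ^ (m - l)"
          unfolding norm_mult using Y K K0 less.IH[of "m - l" q j] Suc
          by (intro mult_mono) (auto intro: mult_nonneg_nonneg)
      qed
      also have "\<dots> = (real CARD('n) * M) * K ^ m"
        using l by (simp add: power_add[symmetric])
      also have "\<dots> \<le> K * K ^ m" using K K0 by (intro mult_right_mono) auto
      finally show ?thesis using Suc by simp
    qed
    have "cmod (\<Sum>l\<le>m. (Y l ** ode_coeff Y (m - l)) $ i $ j) \<le> (\<Sum>l\<le>m. K ^ k)"
      by (rule order_trans[OF norm_sum sum_mono]) (use step in auto)
    then have "cmod (\<Sum>l\<le>m. (Y l ** ode_coeff Y (m - l)) $ i $ j) \<le> real (Suc m) * K ^ k" by simp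
    then show ?thesis
      using Suc by (simp add: norm_mult norm_divide divide_simps mult.commute del: of_nat_Suc)
  qed
qed

lemma linear_ode_exists:
  fixes Y :: "complex \<Rightarrow> complex^'n^'n"
  assumes Y: "matrix_holomorphic_on Y (ball 0 r)" and r: "r > 0"
  obtains \<rho> u where "0 < \<rho>" "\<rho> \<le> r" "u 0 = mat 1"
    "\<And>z. z \<in> ball 0 \<rho> \<Longrightarrow> has_matrix_derivative u (Y z ** u z) z"
proof -
  define FY where "FY = (\<lambda>i j. fps_expansion (\<lambda>z. Y z $ i $ j) 0)"
  have r0: "(0::complex) \<in> ball 0 r" using r by simp
  have FY: "(\<lambda>z. Y z $ i $ j) has_fps_expansion FY i j" for i j
    unfolding FY_def using Y
    by (intro has_fps_expansion_fps_expansion[OF open_ball r0]) (simp add: matrix_holomorphic_on_def)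
  \<comment> \<open>Any radius below \<open>r\<close> will do: the Taylor series of \<open>Y\<close> is bounded there.\<close>
  define s where "s = r / 2"
  have s: "s > 0" "s < r" using r by (auto simp: s_def)
  have "\<exists>M. \<forall>k. cmod (fps_nth (FY i j) k) * s ^ k \<le> M" for i j
  proof -
    have "fps_conv_radius (FY i j) \<ge> ereal r"
      unfolding FY_def using Y by (intro conv_radius_fps_expansion) (simp add: matrix_holomorphic_on_def)
    then have "ereal (norm (complex_of_real s)) < fps_conv_radius (FY i j)"
      using s by (simp add: less_le_trans[of "ereal s" "ereal r"])
    then have "summable (\<lambda>k. norm (fps_nth (FY i j) k * of_real s ^ k))"
      by (rule norm_summable_fps)
    then have "Bseq (\<lambda>k. norm (fps_nth (FY i j) k * of_real s ^ k))"
      using summable_LIMSEQ_zero convergentI convergent_imp_Bseq by blast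
    then show ?thesis
      using s by (auto simp: Bseq_def norm_mult norm_power)
  qed
  then obtain M where M: "\<And>i j k. cmod (fps_nth (FY i j) k) * s ^ k \<le> M i j" by metis
  define M' where "M' = (\<Sum>i\<in>UNIV. \<Sum>j\<in>UNIV. M i j)"
  have M0: "M i j \<ge> 0" for i j using order_trans[OF norm_ge_zero, of "fps_nth (FY i j) 0"] M[of i j 0] by simp
  have MM': "M i j \<le> M'" for i j
  proof -
    have "M i j \<le> (\<Sum>j\<in>UNIV. M i j)" by (rule member_le_sum) (auto simp: M0)
    also have "\<dots> \<le> M'" unfolding M'_def
      by (rule member_le_sum[of i UNIV "\<lambda>i. \<Sum>j\<in>UNIV. M i j"]) (auto simp: M0 sum_nonneg)
    finally show ?thesis .
  qed
  have M'0: "M' \<ge> 0" unfolding M'_def by (intro sum_nonneg M0)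
  define K where "K = 1 / s + real CARD('n) * M'"
  have K: "K > 0" "1 / s \<le> K" "real CARD('n) * M' \<le> K"
    using s M'0 by (auto simp: K_def intro: add_pos_nonneg)
  define y where "y = (\<lambda>k. (\<chi> i j. fps_nth (FY i j) k) :: complex^'n^'n)"
  have y: "cmod (y k $ i $ j) \<le> M' * K ^ k" for k i j
  proof -
    have "cmod (y k $ i $ j) \<le> M' / s ^ k"
      using M[of i j k] MM'[of i j] s by (simp add: y_def field_simps)
    also have "\<dots> = M' * (1 / s) ^ k" by (simp add: power_divide)
    also have "\<dots> \<le> M' * K ^ k" using s K M'0 by (intro mult_left_mono power_mono) auto
    finally show ?thesis .
  qed
  define U where "U = (\<lambda>i j. Abs_fps (\<lambda>k. ode_coeff y k $ i $ j))"
  have bound: "cmod (fps_nth (U i j) k) \<le> K ^ k" for i j k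
    unfolding U_def using ode_coeff_bound[OF y K(3) M'0] by simp
  have rad: "fps_conv_radius (U i j) > 0" for i j
  proof -
    have "summable (\<lambda>k. norm (fps_nth (U i j) k * of_real (1 / (2 * K)) ^ k))"
    proof (rule summable_comparison_test)
      show "summable (\<lambda>k. (1 / 2 :: real) ^ k)" by (rule summable_geometric) simp
      have "cmod (fps_nth (U i j) k) * (1 / (2 * K)) ^ k \<le> K ^ k * (1 / (2 * K)) ^ k" for k
        using K by (intro mult_right_mono bound) auto
      also have "K ^ k * (1 / (2 * K)) ^ k = (1 / 2) ^ k" for k
        using K by (simp add: power_mult_distrib[symmetric])
      finally show "\<exists>N. \<forall>k\<ge>N. norm (norm (fps_nth (U i j) k * of_real (1 / (2 * K)) ^ k)) \<le> (1 / 2) ^ k"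
        using K by (auto simp: norm_mult norm_power norm_divide)
    qed
    then have "summable (\<lambda>k. fps_nth (U i j) k * of_real (1 / (2 * K)) ^ k)"
      by (rule summable_norm_cancel)
    then have "fps_conv_radius (U i j) \<ge> norm (complex_of_real (1 / (2 * K)))"
      unfolding fps_conv_radius_def by (rule conv_radius_geI)
    moreover have "norm (complex_of_real (1 / (2 * K))) > 0" using K by simp
    ultimately show ?thesis by (meson ereal_less(2) less_le_trans)
  qed
  have Uexp: "eval_fps (U i j) has_fps_expansion U i j" for i j
    by (rule eval_fps_has_fps_expansion[OF rad])
  have Uderiv: "fps_deriv (U i j) = (\<Sum>k\<in>UNIV. FY i k * U k j)" for i j
  proof (rule fps_ext)
    fix n
    have "fps_nth (fps_deriv (U i j)) n = (\<Sum>l\<le>n. (y l ** ode_coeff y (n - l)) $ i $ j)"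
      by (simp add: U_def del: of_nat_Suc)
    also have "\<dots> = (\<Sum>k\<in>UNIV. \<Sum>l\<le>n. fps_nth (FY i k) l * fps_nth (U k j) (n - l))"
      by (subst sum.swap) (simp add: matrix_mult_nth y_def U_def)
    finally show "fps_nth (fps_deriv (U i j)) n = fps_nth (\<Sum>k\<in>UNIV. FY i k * U k j) n"
      by (simp add: fps_sum_nth fps_mult_nth atLeast0AtMost)
  qed
  have "eventually (\<lambda>z. deriv (eval_fps (U i j)) z = (\<Sum>k\<in>UNIV. Y z $ i $ k * eval_fps (U k j) z)) (nhds 0)" for i j
  proof -
    have "deriv (eval_fps (U i j)) has_fps_expansion (\<Sum>k\<in>UNIV. FY i k * U k j)"
      using has_fps_expansion_deriv[OF Uexp[of i j]] by (simp add: Uderiv)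
    moreover have "(\<lambda>z. \<Sum>k\<in>UNIV. Y z $ i $ k * eval_fps (U k j) z) has_fps_expansion (\<Sum>k\<in>UNIV. FY i k * U k j)"
      by (intro has_fps_expansion_sum has_fps_expansion_mult FY Uexp)
    ultimately show ?thesis
      unfolding has_fps_expansion_def by (auto elim: eventually_elim2)
  qed
  moreover have "eventually (\<lambda>z. z \<in> eball 0 (fps_conv_radius (U i j))) (nhds 0)" for i j
    by (rule eventually_nhds_in_open) (use rad in \<open>auto simp: zero_ereal_def[symmetric]\<close>)
  ultimately have "eventually (\<lambda>z. \<forall>i j. z \<in> eball 0 (fps_conv_radius (U i j)) \<and>
      deriv (eval_fps (U i j)) z = (\<Sum>k\<in>UNIV. Y z $ i $ k * eval_fps (U k j) z)) (nhds 0)"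
    by (intro eventually_all_finite eventually_conj)
  then obtain \<rho> where \<rho>: "\<rho> > 0" "\<And>z. z \<in> ball 0 \<rho> \<Longrightarrow> (\<forall>i j. z \<in> eball 0 (fps_conv_radius (U i j)) \<and>
      deriv (eval_fps (U i j)) z = (\<Sum>k\<in>UNIV. Y z $ i $ k * eval_fps (U k j) z))"
    unfolding eventually_nhds_metric by (auto simp: dist_commute)
  define u where "u = (\<lambda>z. (\<chi> i j. eval_fps (U i j) z) :: complex^'n^'n)"
  show ?thesis
  proof (rule that[of "min \<rho> r" u])
    show "u 0 = mat 1" by (simp add: u_def U_def eval_fps_at_0 vec_eq_iff)
    fix z :: complex assume z: "z \<in> ball 0 (min \<rho> r)"
    show "has_matrix_derivative u (Y z ** u z) z"
      unfolding has_matrix_derivative_def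
    proof (intro allI)
      fix i j
      have z': "z \<in> eball 0 (fps_conv_radius (U i j))"
        and d: "deriv (eval_fps (U i j)) z = (\<Sum>k\<in>UNIV. Y z $ i $ k * eval_fps (U k j) z)"
        using \<rho>(2)[of z] z by auto
      have "(eval_fps (U i j) has_field_derivative deriv (eval_fps (U i j)) z) (at z)"
        by (rule holomorphic_derivI[OF holomorphic_on_eval_fps open_eball z']) auto
      then show "((\<lambda>w. u w $ i $ j) has_field_derivative (Y z ** u z) $ i $ j) (at z)"
        unfolding d by (simp add: u_def matrix_mult_nth)
    qed
  qed (use \<rho> r in auto)
qed

section \<open>Parameter integrals and kernels of constant rank\<close>

lemma contour_integral_parameter_continuous:
  fixes f :: "complex \<Rightarrow> complex \<Rightarrow> complex"
  assumes g: "valid_path g" "continuous_on {0..1} (\<lambda>t. vector_derivative g (at t))"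
    and f: "continuous_on (U \<times> path_image g) (\<lambda>(z, w). f z w)"
  shows "continuous_on U (\<lambda>z. contour_integral g (f z))"
proof -
  have cg: "continuous_on {0..1} g"
    using g(1) valid_path_imp_path path_def by blast
  have "continuous_on (U \<times> cbox 0 1) (\<lambda>(z, t). f z (g t) * vector_derivative g (at t))"
  proof -
    have "continuous_on (U \<times> {0..1}) (\<lambda>x. (\<lambda>(z, w). f z w) (fst x, g (snd x)))"
    proof (rule continuous_on_compose2[OF f])
      show "continuous_on (U \<times> {0..1}) (\<lambda>x. (fst x, g (snd x)))"
        by (intro continuous_intros continuous_on_compose2[OF cg]) auto
    qed (auto simp: path_image_def)
    moreover have "continuous_on (U \<times> {0..1}) (\<lambda>x. vector_derivative g (at (snd x)))"
      by (rule continuous_on_compose2[OF g(2)]) (auto intro: continuous_intros)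
    ultimately have "continuous_on (U \<times> {0..1}) (\<lambda>x. f (fst x) (g (snd x)) * vector_derivative g (at (snd x)))"
      by (intro continuous_on_mult) simp_all
    then show ?thesis by (simp add: case_prod_unfold)
  qed
  from integral_continuous_on_param[OF this] show ?thesis
    by (simp add: contour_integral_integral)
qed

text \<open>By Fubini the integral over a triangle may be taken inside, where it vanishes; this is Morera's
  criterion.\<close>

lemma contour_integral_parameter_holomorphic:
  fixes f :: "complex \<Rightarrow> complex \<Rightarrow> complex"
  assumes U: "open U"
    and g: "valid_path g" "continuous_on {0..1} (\<lambda>t. vector_derivative g (at t))"
    and f: "continuous_on (U \<times> path_image g) (\<lambda>(z, w). f z w)"
      "\<And>w. w \<in> path_image g \<Longrightarrow> (\<lambda>z. f z w) holomorphic_on U"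
  shows "(\<lambda>z. contour_integral g (f z)) holomorphic_on U"
proof -
  have "(\<lambda>z. contour_integral g (f z)) analytic_on U"
  proof (rule Morera_triangle[OF _ U], goal_cases)
    case 1
    show ?case by (rule contour_integral_parameter_continuous[OF g f(1)])
  next
    case (2 a b c)
    show ?case
    proof
      assume hull: "convex hull {a, b, c} \<subseteq> U"
      let ?I = "\<lambda>a b w. contour_integral (linepath a b) (\<lambda>z. f z w)"
      have seg: "closed_segment a b \<subseteq> U" "closed_segment b c \<subseteq> U" "closed_segment c a \<subseteq> U"
        by (rule order_trans[OF _ hull], rule segments_subset_convex_hull)+
      have lin: "continuous_on {0..1} (\<lambda>t. vector_derivative (linepath p q) (at t))" for p q :: complex
        by (simp add: vector_derivative_linepath_at)
      have swap: "contour_integral (linepath p q) (\<lambda>z. contour_integral g (f z)) = contour_integral g (?I p q)"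
        if "closed_segment p q \<subseteq> U" for p q
      proof (rule contour_integral_swap)
        show "continuous_on (path_image (linepath p q) \<times> path_image g) (\<lambda>(y1, y2). f y1 y2)"
          by (rule continuous_on_subset[OF f(1)]) (use that in auto)
      qed (use g lin in auto)
      have integrable: "?I p q contour_integrable_on g" if "closed_segment p q \<subseteq> U" for p q
      proof -
        have "continuous_on (path_image g) (?I p q)"
        proof (rule contour_integral_parameter_continuous[OF valid_path_linepath lin])
          have "continuous_on (path_image g \<times> closed_segment p q) (\<lambda>x. (\<lambda>(z, w). f z w) (prod.swap x))"
            by (rule continuous_on_compose2[OF f(1)]) (use that in \<open>auto intro: continuous_on_swap\<close>)
          then show "continuous_on (path_image g \<times> path_image (linepath p q)) (\<lambda>(z, w). f w z)"
            by (simp add: case_prod_unfold)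
        qed
        moreover have "continuous_on {0..1} g"
          using g(1) valid_path_imp_path path_def by blast
        ultimately have "continuous_on {0..1} (\<lambda>t. ?I p q (g t))"
          by (rule continuous_on_compose2) (auto simp: path_image_def)
        then show ?thesis
          unfolding contour_integrable_on
          by (intro integrable_continuous_interval continuous_on_mult g(2))
      qed
      have zero: "?I a b w + ?I b c w + ?I c a w = 0" if "w \<in> path_image g" for w
      proof -
        have hol: "(\<lambda>z. f z w) holomorphic_on convex hull {a, b, c}"
          using f(2)[OF that] hull holomorphic_on_subset by blast
        have "((\<lambda>z. f z w) has_contour_integral 0) (linepath a b +++ linepath b c +++ linepath c a)"
          by (rule Cauchy_theorem_triangle[OF hol])
        then have "contour_integral (linepath a b +++ linepath b c +++ linepath c a) (\<lambda>z. f z w) = 0"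
          by (rule contour_integral_unique)
        moreover have "(\<lambda>z. f z w) contour_integrable_on linepath p q" if "closed_segment p q \<subseteq> U" for p q
          using f(2)[OF \<open>w \<in> path_image g\<close>] that
          by (meson contour_integrable_continuous_linepath continuous_on_subset holomorphic_on_imp_continuous_on)
        ultimately show ?thesis using seg by (simp add: contour_integral_join contour_integrable_joinI add.assoc)
      qed
      have "contour_integral g (\<lambda>w. ?I a b w + ?I b c w + ?I c a w) = contour_integral g (\<lambda>w. 0)"
        by (rule contour_integral_eq) (rule zero)
      then show "contour_integral (linepath a b) (\<lambda>z. contour_integral g (f z)) +
          contour_integral (linepath b c) (\<lambda>z. contour_integral g (f z)) +
          contour_integral (linepath c a) (\<lambda>z. contour_integral g (f z)) = 0"
        using seg integrable
        by (simp add: swap contour_integral_add contour_integrable_add)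
    qed
  qed
  then show ?thesis by (rule analytic_imp_holomorphic)
qed

text \<open>Let \<open>g\<close> be a linear right inverse of \<open>L 0\<close> on the image of \<open>V\<close>. Then \<open>E z = 1 + (L z - L 0) g\<close> is
  invertible for small \<open>z\<close> and agrees with \<open>L z g\<close> on \<open>L 0 V\<close>. It therefore embeds \<open>L 0 V\<close> in
  \<open>L z V\<close>, and as the dimensions agree it maps onto it. So \<open>L z A = E z y = L z (g y)\<close> for some
  \<open>y \<in> L 0 V\<close>, and \<open>A - g y\<close> lies in the kernel; the formula \<open>y = E z\<^sup>-\<^sup>1 (L z A)\<close> shows that it depends
  holomorphically on \<open>z\<close>.\<close>

lemma constant_rank_kernel_section:
  fixes V :: "(complex^'m) set" and L :: "complex \<Rightarrow> complex^'m^'m"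
  assumes V: "vec.subspace V" and L: "matrix_holomorphic_on L (ball 0 r)" and r: "r > 0"
    and dim: "\<And>z. z \<in> ball 0 r \<Longrightarrow> vec.dim ((*v) (L z) ` V) = vec.dim ((*v) (L 0) ` V)"
    and A: "A \<in> V" "L 0 *v A = 0"
  obtains \<epsilon> C where "0 < \<epsilon>" "\<epsilon> \<le> r" "C 0 = A" "\<And>i. (\<lambda>z. C z $ i) holomorphic_on ball 0 \<epsilon>"
    "\<And>z. z \<in> ball 0 \<epsilon> \<Longrightarrow> C z \<in> V" "\<And>z. z \<in> ball 0 \<epsilon> \<Longrightarrow> L z *v C z = 0"
proof -
  let ?lin = "Vector_Spaces.linear (*s) (*s)"
  have linL: "?lin ((*v) M)" for M :: "complex^'m^'m" by (rule matrix_vector_mul_linear_gen)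
  obtain g where g: "range g \<subseteq> V" "?lin g" "\<And>v. v \<in> (*v) (L 0) ` V \<Longrightarrow> L 0 *v g v = v"
    using vec.linear_exists_right_inverse_on[OF linL V, of "L 0"] by auto
  define R where "R = matrix g"
  have R: "g v = R *v v" for v using matrix_works[OF g(2)] by (simp add: R_def)
  define E where "E = (\<lambda>z. mat 1 + (L z - L 0) ** R)"
  have Ehol: "matrix_holomorphic_on E (ball 0 r)"
    unfolding E_def
    by (intro matrix_holomorphic_add matrix_holomorphic_mult matrix_holomorphic_diff matrix_holomorphic_const L)
  have E0: "E 0 = mat 1" by (simp add: E_def)
  have "(\<lambda>z. det (E z)) holomorphic_on ball 0 r"
    by (rule holomorphic_on_det) (use Ehol in \<open>simp add: matrix_holomorphic_on_def\<close>)
  then have "isCont (\<lambda>z. det (E z)) 0"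
    using r by (meson holomorphic_on_imp_continuous_on continuous_on_eq_continuous_at open_ball centre_in_ball)
  moreover have "det (E 0) \<noteq> 0" by (simp add: E0)
  ultimately obtain e where e: "e > 0" "\<And>z. dist 0 z < e \<Longrightarrow> det (E z) \<noteq> 0"
    using continuous_at_avoid[of 0 "\<lambda>z. det (E z)" 0] by (auto simp: dist_commute)
  define \<epsilon> where "\<epsilon> = min e r"
  have \<epsilon>: "0 < \<epsilon>" "\<epsilon> \<le> r" "ball 0 \<epsilon> \<subseteq> ball 0 r" using e r by (auto simp: \<epsilon>_def)
  have Einv: "invertible (E z)" if "z \<in> ball 0 \<epsilon>" for z
    using e(2)[of z] that by (auto simp: \<epsilon>_def invertible_det_nz)
  define C where "C = (\<lambda>z. A - R *v (matrix_inv (E z) *v (L z *v A)))"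
  have key: "C z \<in> V \<and> L z *v C z = 0" if z: "z \<in> ball 0 \<epsilon>" for z
  proof -
    let ?W = "(*v) (L 0) ` V"
    have W: "vec.subspace ?W" by (rule vec.linear_subspace_image[OF linL V])
    have E_on_W: "E z *v y = L z *v (g y)" if "y \<in> ?W" for y
      using g(3)[OF that]
      by (simp add: E_def matrix_vector_mult_add_rdistrib matrix_vector_mult_diff_rdistrib R
          flip: matrix_vector_mul_assoc)
    have "(*v) (E z) ` ?W = (*v) (L z) ` V"
    proof (rule vec.subspace_dim_equal)
      show "vec.subspace ((*v) (E z) ` ?W)" by (rule vec.linear_subspace_image[OF linL W])
      show "vec.subspace ((*v) (L z) ` V)" by (rule vec.linear_subspace_image[OF linL V])
      show "(*v) (E z) ` ?W \<subseteq> (*v) (L z) ` V" using E_on_W g(1) by (fastforce simp: image_iff)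
      have "inj ((*v) (E z))"
        using Einv[OF z] matrix_left_invertible_injective invertible_left_inverse by blast
      then have "vec.dim ((*v) (E z) ` ?W) = vec.dim ?W"
        using vec.dim_image_eq[OF linL] inj_on_subset by blast
      also have "\<dots> = vec.dim ((*v) (L z) ` V)" using dim[of z] z \<epsilon> by auto
      finally show "vec.dim ((*v) (L z) ` V) \<le> vec.dim ((*v) (E z) ` ?W)" by simp
    qed
    then obtain y where y: "y \<in> ?W" "L z *v A = E z *v y" using A(1) by blast
    have "matrix_inv (E z) *v (L z *v A) = y"
      using y(2) Einv[OF z] by (simp add: matrix_vector_mul_assoc matrix_inv_mult)
    then have C: "C z = A - g y" by (simp add: C_def R)
    have "C z \<in> V" unfolding C using g(1) by (intro vec.subspace_diff[OF V A(1)]) auto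
    moreover have "L z *v C z = 0"
      unfolding C by (simp add: matrix_vector_mult_diff_distrib y(2) E_on_W[OF y(1)])
    ultimately show ?thesis ..
  qed
  show ?thesis
  proof (rule that[of \<epsilon> C])
    show "C 0 = A" by (simp add: C_def A(2))
    fix i
    have "matrix_holomorphic_on (\<lambda>z. R ** (matrix_inv (E z) ** L z)) (ball 0 \<epsilon>)"
      using Einv \<epsilon>(3)
      by (intro matrix_holomorphic_mult matrix_holomorphic_const matrix_holomorphic_inv
          matrix_holomorphic_subset[OF Ehol] matrix_holomorphic_subset[OF L]) auto
    then have "(\<lambda>z. (R ** (matrix_inv (E z) ** L z)) $ i $ k) holomorphic_on ball 0 \<epsilon>" for k
      by (simp add: matrix_holomorphic_on_def)
    then have "(\<lambda>z. A $ i - (\<Sum>k\<in>UNIV. (R ** (matrix_inv (E z) ** L z)) $ i $ k * A $ k)) holomorphic_on ball 0 \<epsilon>"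
      by (intro holomorphic_intros)
    moreover have "(\<lambda>z. C z $ i) = (\<lambda>z. A $ i - (\<Sum>k\<in>UNIV. (R ** (matrix_inv (E z) ** L z)) $ i $ k * A $ k))"
      unfolding C_def by (simp add: matrix_vector_mul_assoc) (simp add: matrix_vector_mult_def)
    ultimately show "(\<lambda>z. C z $ i) holomorphic_on ball 0 \<epsilon>" by simp
  qed (use \<epsilon> key in auto)
qed

section \<open>Local flows and their linearization\<close>

lemma holomorphic2_compose:
  assumes f: "holomorphic2_on f W" "open W" and U: "open U"
    and pq: "p holomorphic_on U" "q holomorphic_on U" "\<And>w. w \<in> U \<Longrightarrow> (p w, q w) \<in> W"
  shows "(\<lambda>w. f (p w, q w)) holomorphic_on U"
  unfolding holomorphic_on_open[OF U]
proof
  fix w assume w: "w \<in> U"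
  obtain a b where ab: "(f has_derivative (\<lambda>(s, t). a * s + b * t)) (at (p w, q w))"
    using f pq(3)[OF w] unfolding holomorphic2_on_def by (metis at_within_open)
  have p: "(p has_derivative (\<lambda>h. deriv p w * h)) (at w)"
    and q: "(q has_derivative (\<lambda>h. deriv q w * h)) (at w)"
    using holomorphic_derivI[OF pq(1) U w] holomorphic_derivI[OF pq(2) U w]
    by (simp_all add: has_field_derivative_def)
  have "((\<lambda>w. (p w, q w)) has_derivative (\<lambda>h. (deriv p w * h, deriv q w * h))) (at w)"
    by (rule has_derivative_Pair[OF p q])
  from diff_chain_at[OF this ab]
  moreover have "(\<lambda>h. a * (deriv p w * h) + b * (deriv q w * h)) = (*) (a * deriv p w + b * deriv q w)"
    by (simp add: fun_eq_iff algebra_simps)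
  ultimately have "((\<lambda>w. f (p w, q w)) has_field_derivative (a * deriv p w + b * deriv q w)) (at w)"
    by (simp add: o_def has_field_derivative_def)
  then show "\<exists>f'. ((\<lambda>w. f (p w, q w)) has_field_derivative f') (at w)" ..
qed

lemma matrix_holomorphic2_subset:
  assumes "matrix_holomorphic2_on f W" "S \<subseteq> W"
  shows "matrix_holomorphic2_on f S"
  using assms has_derivative_subset[OF _ assms(2)]
  unfolding matrix_holomorphic2_on_def holomorphic2_on_def by blast

lemma holomorphic2_continuous: "holomorphic2_on f W \<Longrightarrow> continuous_on W f"
  unfolding holomorphic2_on_def continuous_on_eq_continuous_within
  using has_derivative_continuous by blast

lemma continuous_on_matrix_iff:
  fixes F :: "'a::topological_space \<Rightarrow> complex^'n^'n"
  shows "continuous_on S F \<longleftrightarrow> (\<forall>i j. continuous_on S (\<lambda>x. F x $ i $ j))"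
proof
  assume "\<forall>i j. continuous_on S (\<lambda>x. F x $ i $ j)"
  then have "continuous_on S (\<lambda>x. \<chi> i j. F x $ i $ j)"
    by (intro continuous_on_vec_lambda) auto
  then show "continuous_on S F" by simp
qed (auto intro: continuous_intros)

lemma continuous_on_matrix_mult:
  fixes F H :: "'a::topological_space \<Rightarrow> complex^'n^'n"
  shows "continuous_on S F \<Longrightarrow> continuous_on S H \<Longrightarrow> continuous_on S (\<lambda>x. F x ** H x)"
  unfolding continuous_on_matrix_iff matrix_mult_nth by (intro allI continuous_on_sum continuous_on_mult) auto

definition matrix_contour_integral :: "(real \<Rightarrow> complex) \<Rightarrow> (complex \<Rightarrow> complex^'n^'n) \<Rightarrow> complex^'n^'n" where
  "matrix_contour_integral g K = (\<chi> i j. contour_integral g (\<lambda>l. K l $ i $ j))"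

lemma linear_functional_contour_integral:
  assumes "\<And>i j. (\<lambda>l. K l $ i $ j) contour_integrable_on g"
  shows "contour_integral g (\<lambda>l. \<Sum>i\<in>UNIV. \<Sum>j\<in>UNIV. K l $ i $ j * c i j) =
     (\<Sum>i\<in>UNIV. \<Sum>j\<in>UNIV. matrix_contour_integral g K $ i $ j * c i j)"
  using assms
  by (simp add: contour_integral_sum contour_integrable_sum contour_integrable_rmul
      contour_integral_rmul matrix_contour_integral_def)

lemma matrix_contour_integral_mult:
  fixes K :: "complex \<Rightarrow> complex^'n^'n"
  assumes K: "\<And>i j. (\<lambda>l. K l $ i $ j) contour_integrable_on g"
  shows "matrix_contour_integral g (\<lambda>l. A ** K l ** B) = A ** matrix_contour_integral g K ** B"
proof -
  have eq: "(A ** M ** B) $ i $ j = (\<Sum>a\<in>UNIV. \<Sum>b\<in>UNIV. M $ a $ b * (A $ i $ a * B $ b $ j))"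
    for M :: "complex^'n^'n" and i j
    by (subst sum.swap) (simp add: matrix_mult_nth sum_distrib_left sum_distrib_right mult_ac)
  show ?thesis
    unfolding vec_eq_iff
    by (simp add: eq linear_functional_contour_integral[OF K] flip: matrix_contour_integral_def)
       (simp add: matrix_contour_integral_def eq linear_functional_contour_integral[OF K, unfolded matrix_contour_integral_def])
qed

lemma tangent_algebra_contour_integral:
  assumes "\<And>i j. (\<lambda>l. K l $ i $ j) contour_integrable_on g" "\<And>l. l \<in> path_image g \<Longrightarrow> K l \<in> tangent_algebra G"
  shows "matrix_contour_integral g K \<in> tangent_algebra G"
proof -
  obtain \<Lambda> where \<Lambda>: "\<And>X. X \<in> tangent_algebra G \<longleftrightarrow> (\<forall>c\<in>\<Lambda>. (\<Sum>i\<in>UNIV. \<Sum>j\<in>UNIV. X $ i $ j * c i j) = 0)"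
    using tangent_algebra_functionals[of G] by blast
  have "(\<Sum>i\<in>UNIV. \<Sum>j\<in>UNIV. matrix_contour_integral g K $ i $ j * c i j) = 0" if "c \<in> \<Lambda>" for c
  proof -
    have "contour_integral g (\<lambda>l. \<Sum>i\<in>UNIV. \<Sum>j\<in>UNIV. K l $ i $ j * c i j) = contour_integral g (\<lambda>l. 0)"
      by (rule contour_integral_eq) (use assms(2) \<Lambda> that in blast)
    then show ?thesis by (simp add: linear_functional_contour_integral[OF assms(1)])
  qed
  then show ?thesis using \<Lambda> by blast
qed

lemma continuous_zero_punctured:
  fixes f :: "complex \<Rightarrow> complex"
  assumes "continuous_on (ball 0 r) f" "r > 0" "\<And>z. z \<in> ball 0 r \<Longrightarrow> z \<noteq> 0 \<Longrightarrow> f z = 0"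
  shows "f 0 = 0"
proof -
  have "isCont f 0"
    using assms(1,2) by (simp add: continuous_on_eq_continuous_at)
  then have "(f \<longlongrightarrow> f 0) (at 0)" by (simp add: isCont_def)
  moreover have "(f \<longlongrightarrow> 0) (at 0)"
  proof (rule tendsto_eventually)
    show "\<forall>\<^sub>F x in at 0. f x = 0"
      unfolding eventually_at using assms(2,3) by (intro exI[of _ r]) (auto simp: dist_commute)
  qed
  ultimately show ?thesis using LIM_unique by blast
qed

text \<open>The linear conditions that define the tangent algebra hold for the quotient away from \<open>0\<close>, and at
  \<open>0\<close> by continuity.\<close>

lemma tangent_algebra_divide:
  fixes b :: "complex \<Rightarrow> complex^'n^'n"
  assumes b: "matrix_holomorphic_on b (ball 0 r)" "r > 0" "b 0 = 0"
    "\<And>z. z \<in> ball 0 r \<Longrightarrow> b z \<in> tangent_algebra G"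
  obtains Y where "matrix_holomorphic_on Y (ball 0 r)" "\<And>z. z \<in> ball 0 r \<Longrightarrow> Y z \<in> tangent_algebra G"
    "\<And>z. matrix_scale z (Y z) = b z"
proof
  define Y where "Y = (\<lambda>z. if z = 0 then matrix_deriv b 0 else matrix_scale (1 / z) (b z))"
  show Yhol: "matrix_holomorphic_on Y (ball 0 r)"
    unfolding matrix_holomorphic_on_def
  proof (intro allI)
    fix i j
    have "(\<lambda>z. if z = 0 then deriv (\<lambda>w. b w $ i $ j) 0 else (b z $ i $ j - b 0 $ i $ j) / (z - 0)) holomorphic_on ball 0 r"
      by (rule pole_lemma_open) (use b in \<open>auto simp: matrix_holomorphic_on_def\<close>)
    moreover have "(\<lambda>z. Y z $ i $ j) = (\<lambda>z. if z = 0 then deriv (\<lambda>w. b w $ i $ j) 0 else (b z $ i $ j - b 0 $ i $ j) / (z - 0))"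
      by (auto simp: Y_def matrix_deriv_def b(3))
    ultimately show "(\<lambda>z. Y z $ i $ j) holomorphic_on ball 0 r" by simp
  qed
  show "matrix_scale z (Y z) = b z" for z
    by (simp add: Y_def b(3))
  have Y_ne: "Y z \<in> tangent_algebra G" if "z \<in> ball 0 r" "z \<noteq> 0" for z
    using that b(4) by (simp add: Y_def tangent_algebra_scale)
  obtain \<Lambda> where \<Lambda>: "\<And>X. X \<in> tangent_algebra G \<longleftrightarrow> (\<forall>c\<in>\<Lambda>. (\<Sum>i\<in>UNIV. \<Sum>j\<in>UNIV. X $ i $ j * c i j) = 0)"
    using tangent_algebra_functionals[of G] by blast
  have "(\<Sum>i\<in>UNIV. \<Sum>j\<in>UNIV. Y 0 $ i $ j * c i j) = 0" if "c \<in> \<Lambda>" for c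
  proof (rule continuous_zero_punctured[of r "\<lambda>z. \<Sum>i\<in>UNIV. \<Sum>j\<in>UNIV. Y z $ i $ j * c i j"])
    show "continuous_on (ball 0 r) (\<lambda>z. \<Sum>i\<in>UNIV. \<Sum>j\<in>UNIV. Y z $ i $ j * c i j)"
      using Yhol unfolding matrix_holomorphic_on_def
      by (intro continuous_on_sum continuous_on_mult continuous_on_const)
         (auto intro: holomorphic_on_imp_continuous_on)
  qed (use b(2) Y_ne \<Lambda> that in auto)
  then show "Y z \<in> tangent_algebra G" if "z \<in> ball 0 r" for z
    using \<Lambda> Y_ne[OF that] by (cases "z = 0") auto
qed

lemma convex_exp_orbit: "r > 0 \<Longrightarrow> convex {l. cmod (exp l * z) < r}"
proof (cases "z = 0")
  case False
  assume "r > 0"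
  then have "cmod (exp l * z) < r \<longleftrightarrow> Re l < ln (r / cmod z)" for l
  proof -
    have "cmod (exp l * z) < r \<longleftrightarrow> exp (Re l) < r / cmod z"
      using False by (simp add: norm_mult field_simps)
    also have "\<dots> \<longleftrightarrow> Re l < ln (r / cmod z)"
      using False \<open>r > 0\<close> by (metis divide_pos_pos exp_less_cancel_iff exp_ln zero_less_norm_iff)
    finally show ?thesis .
  qed
  then show ?thesis by (simp add: convex_halfspace_Re_lt)
qed simp

lemma open_exp_orbit: "open {l. cmod (exp l * z) < r}"
  by (intro open_Collect_less continuous_intros)

lemma exp_two_pi_i_add: "exp (2 * of_real pi * \<i> + l) = exp l" "exp (l + 2 * of_real pi * \<i>) = exp l"
  by (simp_all add: exp_add)

text \<open>A change of trivialization over a disc that turns the cocycle \<open>F\<close> into the one of its linear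
  approximation.\<close>

definition linearizing_gauge ::
    "(complex^'n^'n) set \<Rightarrow> (complex \<Rightarrow> complex \<Rightarrow> complex^'n^'n) \<Rightarrow> real \<Rightarrow> (complex \<Rightarrow> complex^'n^'n) \<Rightarrow> bool" where
  "linearizing_gauge G F \<rho> u \<longleftrightarrow> 0 < \<rho> \<and> matrix_holomorphic_on u (ball 0 \<rho>) \<and> (\<forall>z\<in>ball 0 \<rho>. u z \<in> G) \<and>
     (\<forall>z\<in>ball 0 \<rho>. \<forall>l. exp l * z \<in> ball 0 \<rho> \<longrightarrow> F l z ** u z = u (exp l * z) ** F l 0)"

text \<open>What a representation of the action groupoid looks like in a trivialization over a disc around
  the fixed point: a cocycle, defined for those pairs \<open>(l, z)\<close> for which both source and target lie in
  the disc.\<close>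

locale local_flow =
  fixes G :: "(complex^'n^'n) set" and r :: real and F :: "complex \<Rightarrow> complex \<Rightarrow> complex^'n^'n"
  assumes algebraic: "linear_algebraic_group G" and radius: "r > 0"
    and flow_in_group: "cmod z < r \<Longrightarrow> cmod (exp l * z) < r \<Longrightarrow> F l z \<in> G"
    and flow_0: "cmod z < r \<Longrightarrow> F 0 z = mat 1"
    and flow_add: "cmod z < r \<Longrightarrow> cmod (exp k * z) < r \<Longrightarrow> cmod (exp (l + k) * z) < r \<Longrightarrow>
       F (l + k) z = F l (exp k * z) ** F k z"
    and flow_holomorphic: "matrix_holomorphic2_on (\<lambda>(l, z). F l z) {(l, z). cmod z < r \<and> cmod (exp l * z) < r}"
begin

lemma flow_domain_open: "open {(l, z). cmod z < r \<and> cmod (exp l * z) < r}"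
proof -
  have "open {x :: complex \<times> complex. cmod (snd x) < r \<and> cmod (exp (fst x) * snd x) < r}"
    by (intro open_Collect_conj open_Collect_less continuous_intros)
  then show ?thesis by (simp add: case_prod_unfold)
qed

lemma flow_holomorphic_compose:
  assumes U: "open U" and pq: "p holomorphic_on U" "q holomorphic_on U"
    "\<And>w. w \<in> U \<Longrightarrow> cmod (q w) < r \<and> cmod (exp (p w) * q w) < r"
  shows "matrix_holomorphic_on (\<lambda>w. F (p w) (q w)) U"
  unfolding matrix_holomorphic_on_def
proof (intro allI)
  fix i j
  have "(\<lambda>w. (\<lambda>x. (case x of (l, z) \<Rightarrow> F l z) $ i $ j) (p w, q w)) holomorphic_on U"
    by (rule holomorphic2_compose[OF _ flow_domain_open U pq(1,2)])
       (use flow_holomorphic pq(3) in \<open>auto simp: matrix_holomorphic2_on_def\<close>)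
  then show "(\<lambda>w. F (p w) (q w) $ i $ j) holomorphic_on U" by simp
qed

lemma flow_continuous: "continuous_on {(l, z). cmod z < r \<and> cmod (exp l * z) < r} (\<lambda>(l, z). F l z)"
  using flow_holomorphic unfolding continuous_on_matrix_iff matrix_holomorphic2_on_def
  by (auto intro: holomorphic2_continuous)

lemma flow_holomorphic_time: "cmod z < r \<Longrightarrow> matrix_holomorphic_on (\<lambda>l. F l z) {l. cmod (exp l * z) < r}"
  by (rule flow_holomorphic_compose) (auto intro: open_exp_orbit)

lemma flow_inverse:
  assumes "cmod z < r" "cmod (exp l * z) < r"
  shows "F (- l) (exp l * z) ** F l z = mat 1" "F l z ** F (- l) (exp l * z) = mat 1"
    "matrix_inv (F l z) = F (- l) (exp l * z)" "invertible (F l z)"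
proof -
  have "F (- l + l) z = F (- l) (exp l * z) ** F l z" using assms by (intro flow_add) auto
  then show "F (- l) (exp l * z) ** F l z = mat 1" using flow_0[OF assms(1)] by simp
  then show "F l z ** F (- l) (exp l * z) = mat 1" by (simp add: matrix_left_right_inverse)
  then show "matrix_inv (F l z) = F (- l) (exp l * z)" by (rule matrix_inv_unique)
  show "invertible (F l z)"
    by (rule linear_algebraic_group_invertible[OF algebraic flow_in_group[OF assms]])
qed

definition generator :: "complex \<Rightarrow> complex^'n^'n" where
  "generator z = matrix_deriv (\<lambda>l. F l z) 0"

lemma flow_derivative_0:
  assumes "cmod z < r" shows "has_matrix_derivative (\<lambda>l. F l z) (generator z) 0"
  unfolding generator_def
  by (rule matrix_holomorphic_has_derivative[OF flow_holomorphic_time[OF assms] open_exp_orbit])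
     (use assms in simp)

lemma flow_derivative:
  assumes z: "cmod z < r" and l: "cmod (exp l * z) < r"
  shows "has_matrix_derivative (\<lambda>l. F l z) (generator (exp l * z) ** F l z) l"
proof -
  let ?w = "exp l * z"
  have "has_matrix_derivative (\<lambda>k. F k ?w ** F l z) (generator ?w ** F l z) 0"
    using has_matrix_derivative_mult[OF flow_derivative_0[OF l] has_matrix_derivative_const[of "F l z"]]
    by simp
  then have "has_matrix_derivative (\<lambda>k. F k ?w ** F l z) (generator ?w ** F l z) (l - l)" by simp
  moreover have "((\<lambda>x. x - l) has_field_derivative 1) (at l)" by (auto intro!: derivative_eq_intros)
  ultimately have "has_matrix_derivative (\<lambda>x. F (x - l) ?w ** F l z) (matrix_scale 1 (generator ?w ** F l z)) l"
    by (rule has_matrix_derivative_compose)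
  then have "has_matrix_derivative (\<lambda>x. F (x - l) ?w ** F l z) (generator ?w ** F l z) l" by simp
  then show ?thesis
  proof (rule has_matrix_derivative_transform[OF _ open_exp_orbit])
    fix k assume "k \<in> {k. cmod (exp k * z) < r}"
    then show "F (k - l) ?w ** F l z = F k z"
      using flow_add[of z l "k - l"] z l by simp
  qed (use l in simp)
qed

lemma generator_tangent:
  assumes "cmod z < r" shows "generator z \<in> tangent_algebra G"
proof -
  have "generator z ** matrix_inv (F 0 z) \<in> tangent_algebra G"
    by (rule tangent_algebra_velocity[OF algebraic flow_derivative_0[OF assms] open_exp_orbit[of z r]])
       (use assms flow_in_group in auto)
  then show ?thesis by (simp add: flow_0[OF assms])
qed

text \<open>Joint differentiability of \<open>F\<close> gives the derivative in \<open>l\<close> at each \<open>z\<close> separately. Its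
  dependence on \<open>z\<close> is holomorphic because Cauchy's formula expresses it as an integral of \<open>F\<close> over
  a circle of the \<open>l\<close>-plane that serves all \<open>z\<close> of a smaller disc.\<close>

lemma generator_holomorphic: "matrix_holomorphic_on generator (ball 0 r)"
  unfolding matrix_holomorphic_on_def
proof (intro allI)
  fix i j
  have "(\<lambda>z. generator z $ i $ j) holomorphic_on ball 0 s" if s: "0 < s" "s < r" for s
  proof -
    \<comment> \<open>Moving for a time of modulus at most \<open>\<delta>\<close> does not leave the disc of radius \<open>r\<close> from that of radius \<open>s\<close>.\<close>
    define \<delta> where "\<delta> = ln (r / s)"
    have \<delta>: "\<delta> > 0" "exp \<delta> * s = r" using s by (auto simp: \<delta>_def)
    have dom: "cmod z < r \<and> cmod (exp l * z) < r" if "cmod z < s" "cmod l \<le> \<delta>" for z l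
    proof -
      have "exp (Re l) \<le> exp \<delta>" using that(2) complex_Re_le_cmod[of l] by simp
      then have "exp (Re l) * cmod z \<le> exp \<delta> * cmod z" by (rule mult_right_mono) simp
      also have "\<dots> < exp \<delta> * s" using that(1) by simp
      finally show ?thesis using \<delta> s that(1) by (simp add: norm_mult)
    qed
    let ?c = "circlepath 0 \<delta>"
    have "(\<lambda>z. contour_integral ?c (\<lambda>l. F l z $ i $ j / l\<^sup>2)) holomorphic_on ball 0 s"
    proof (rule contour_integral_parameter_holomorphic[OF open_ball])
      show "continuous_on {0..1} (\<lambda>t. vector_derivative ?c (at t))"
        by (simp add: vector_derivative_circlepath) (intro continuous_intros)
      have "continuous_on (ball 0 s \<times> path_image ?c) (\<lambda>x. (\<lambda>(l, z). F l z) (snd x, fst x))"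
      proof (rule continuous_on_compose2[OF flow_continuous])
        show "continuous_on (ball 0 s \<times> path_image ?c) (\<lambda>x. (snd x, fst x))" by (intro continuous_intros)
        have "(snd x, fst x) \<in> {(l, z). cmod z < r \<and> cmod (exp l * z) < r}"
          if "x \<in> ball 0 s \<times> path_image ?c" for x
          using dom[of "fst x" "snd x"] that \<delta>(1) by auto
        then show "(\<lambda>x. (snd x, fst x)) ` (ball 0 s \<times> path_image ?c) \<subseteq> {(l, z). cmod z < r \<and> cmod (exp l * z) < r}"
          by blast
      qed
      then have "continuous_on (ball 0 s \<times> path_image ?c) (\<lambda>x. F (snd x) (fst x) $ i $ j)"
        by (simp add: continuous_on_matrix_iff)
      then have "continuous_on (ball 0 s \<times> path_image ?c) (\<lambda>x. F (snd x) (fst x) $ i $ j / (snd x)\<^sup>2)"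
        using \<delta> by (intro continuous_on_divide continuous_on_power continuous_on_snd continuous_on_id) auto
      then show "continuous_on (ball 0 s \<times> path_image ?c) (\<lambda>(z, l). F l z $ i $ j / l\<^sup>2)"
        by (simp add: case_prod_unfold)
      fix l assume l: "l \<in> path_image ?c"
      then have l': "cmod l = \<delta>" using \<delta> by simp
      have "matrix_holomorphic_on (\<lambda>z. F l z) (ball 0 s)"
        by (rule flow_holomorphic_compose) (use dom l' in auto)
      then show "(\<lambda>z. F l z $ i $ j / l\<^sup>2) holomorphic_on ball 0 s"
        using l' \<delta> by (auto simp: matrix_holomorphic_on_def intro!: holomorphic_intros)
    qed auto
    then have "(\<lambda>z. 1 / (2 * of_real pi * \<i>) * contour_integral ?c (\<lambda>l. F l z $ i $ j / l\<^sup>2)) holomorphic_on ball 0 s"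
      by (intro holomorphic_intros) auto
    moreover have "generator z $ i $ j = 1 / (2 * of_real pi * \<i>) * contour_integral ?c (\<lambda>l. F l z $ i $ j / l\<^sup>2)"
      if z: "z \<in> ball 0 s" for z
    proof -
      have hol: "(\<lambda>l. F l z $ i $ j) holomorphic_on cball 0 \<delta>"
      proof (rule holomorphic_on_subset)
        have "cmod z < r" using dom[of z 0] z \<delta>(1) by simp
        then show "(\<lambda>l. F l z $ i $ j) holomorphic_on {l. cmod (exp l * z) < r}"
          using flow_holomorphic_time by (simp add: matrix_holomorphic_on_def)
        show "cball 0 \<delta> \<subseteq> {l. cmod (exp l * z) < r}" using dom[of z] z by auto
      qed
      have "((\<lambda>l. F l z $ i $ j) has_field_derivative
          1 / (2 * of_real pi * \<i>) * contour_integral ?c (\<lambda>l. F l z $ i $ j / (l - 0)\<^sup>2)) (at 0)"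
        by (rule Cauchy_derivative_integral_circlepath(2))
           (use hol \<delta> in \<open>auto intro: holomorphic_on_imp_continuous_on holomorphic_on_subset\<close>)
      then show ?thesis by (simp add: generator_def matrix_deriv_def DERIV_imp_deriv)
    qed
    ultimately show ?thesis by (metis (no_types, lifting) holomorphic_transform)
  qed
  note hol = this
  show "(\<lambda>z. generator z $ i $ j) holomorphic_on ball 0 r"
    unfolding holomorphic_on_open[OF open_ball]
  proof
    fix z :: complex assume "z \<in> ball 0 r"
    then obtain s where "cmod z < s" "s < r" using dense by auto
    moreover then have "0 < s" using le_less_trans norm_ge_zero by blast
    ultimately show "\<exists>f'. ((\<lambda>z. generator z $ i $ j) has_field_derivative f') (at z)"
      using hol[of s] unfolding holomorphic_on_open[OF open_ball] by simp
  qed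
qed

text \<open>At the fixed point the flow is a one-parameter group, so \<open>F k 0\<close> and \<open>F l 0\<close> commute.\<close>

lemma generator_0_commutes: "F l 0 ** generator 0 = generator 0 ** F l 0"
proof -
  have "F (k + l) 0 = F k 0 ** F l 0" "F (l + k) 0 = F l 0 ** F k 0" for k
    using flow_add[of 0 l k] flow_add[of 0 k l] radius by simp_all
  then have eq: "(\<lambda>k. F l 0 ** F k 0) = (\<lambda>k. F k 0 ** F l 0)"
    by (metis add.commute)
  have d: "has_matrix_derivative (\<lambda>k. F k 0) (generator 0) 0" using flow_derivative_0 radius by simp
  have "has_matrix_derivative (\<lambda>k. F l 0 ** F k 0) (F l 0 ** generator 0) 0"
    "has_matrix_derivative (\<lambda>k. F k 0 ** F l 0) (generator 0 ** F l 0) 0"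
    using has_matrix_derivative_mult[OF has_matrix_derivative_const[of "F l 0"] d]
      has_matrix_derivative_mult[OF d has_matrix_derivative_const[of "F l 0"]] by simp_all
  then show ?thesis using eq has_matrix_derivative_unique by metis
qed

abbreviation period_map :: "complex \<Rightarrow> complex^'n^'n" where
  "period_map \<equiv> F (2 * of_real pi * \<i>)"

lemma flow_period: "cmod z < r \<Longrightarrow> cmod (exp l * z) < r \<Longrightarrow>
    F (l + 2 * of_real pi * \<i>) z = F (2 * of_real pi * \<i>) (exp l * z) ** F l z"
  using flow_add[of z l "2 * of_real pi * \<i>"] by (simp add: exp_two_pi_i_add add.commute)

text \<open>An extension of the residue to a holomorphic family of elements of the centralizer of the
  monodromy.\<close>

definition centralizer_section :: "real \<Rightarrow> (complex \<Rightarrow> complex^'n^'n) \<Rightarrow> bool" where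
  "centralizer_section s C \<longleftrightarrow> matrix_holomorphic_on C (ball 0 s) \<and>
     (\<forall>z\<in>ball 0 s. C z \<in> tangent_algebra G \<and> C z ** period_map z = period_map z ** C z) \<and>
     C 0 = generator 0"

text \<open>The family \<open>K z l = F l z\<^sup>-\<^sup>1 C (exp l * z) F l z\<close> is periodic in \<open>l\<close>, so its mean over a period does
  not change when the interval of integration is shifted by \<open>m\<close>. The cocycle identity turns such a
  shift into conjugation by \<open>F m z\<close>, which is the asserted equivariance.\<close>

lemma parallel_section_exists:
  assumes C: "centralizer_section r C"
  obtains D where "matrix_holomorphic_on D (ball 0 r)" "\<And>z. z \<in> ball 0 r \<Longrightarrow> D z \<in> tangent_algebra G"
    "D 0 = generator 0"
    "\<And>l z. cmod z < r \<Longrightarrow> cmod (exp l * z) < r \<Longrightarrow> D (exp l * z) ** F l z = F l z ** D z"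
proof -
  have C: "matrix_holomorphic_on C (ball 0 r)" "\<And>z. z \<in> ball 0 r \<Longrightarrow> C z \<in> tangent_algebra G"
    "C 0 = generator 0" "\<And>z. z \<in> ball 0 r \<Longrightarrow> C z ** period_map z = period_map z ** C z"
    using C unfolding centralizer_section_def by blast+
  let ?p = "2 * of_real pi * \<i> :: complex"
  let ?g = "linepath 0 ?p"
  let ?H = "\<lambda>z. {l. cmod (exp l * z) < r}"
  \<comment> \<open>By \<open>flow_inverse\<close>, \<open>F (- l) (exp l * z)\<close> is the inverse of \<open>F l z\<close>.\<close>
  define K where "K = (\<lambda>z l. F (- l) (exp l * z) ** C (exp l * z) ** F l z)"
  have segH: "l \<in> ?H z" if l: "l \<in> path_image ?g" and z: "cmod z < r" for l z
  proof -
    have "Re l = 0" using l by (auto simp: closed_segment_def)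
    then show ?thesis using z by (simp add: norm_mult)
  qed
  have Khol: "matrix_holomorphic_on (\<lambda>w. K (q w) (p w)) U"
    if U: "open U" and pq: "p holomorphic_on U" "q holomorphic_on U"
      "\<And>w. w \<in> U \<Longrightarrow> cmod (q w) < r \<and> cmod (exp (p w) * q w) < r" for U p q
  proof -
    have e: "(\<lambda>w. exp (p w) * q w) holomorphic_on U" using pq by (intro holomorphic_intros)
    have m: "(\<lambda>w. - p w) holomorphic_on U" using pq by (intro holomorphic_intros)
    have "cmod (exp (- p w) * (exp (p w) * q w)) < r" if "w \<in> U" for w
      using pq(3)[OF that] by (simp add: exp_minus flip: mult.assoc)
    then show ?thesis
      unfolding K_def using pq(3)
      by (intro matrix_holomorphic_mult flow_holomorphic_compose[OF U m e] flow_holomorphic_compose[OF U pq(1,2)]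
          matrix_holomorphic_compose[OF C(1) e]) auto
  qed
  have Kcont: "continuous_on (ball 0 r \<times> path_image ?g) (\<lambda>x. K (fst x) (snd x))"
  proof -
    let ?S = "ball 0 r \<times> path_image ?g"
    have dom: "cmod (fst x) < r \<and> cmod (exp (snd x) * fst x) < r" if "x \<in> ?S" for x
      using segH[of "snd x" "fst x"] that by auto
    have 1: "continuous_on ?S (\<lambda>x. (\<lambda>(l, z). F l z) (snd x, fst x))"
      by (rule continuous_on_compose2[OF flow_continuous])
         (use dom in \<open>force intro!: continuous_intros simp del: path_image_linepath\<close>)+
    have 2: "continuous_on ?S (\<lambda>x. (\<lambda>(l, z). F l z) (- snd x, exp (snd x) * fst x))"
    proof (rule continuous_on_compose2[OF flow_continuous])
      have "(- snd x, exp (snd x) * fst x) \<in> {(l, z). cmod z < r \<and> cmod (exp l * z) < r}" if "x \<in> ?S" for x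
        using dom[OF that] by (simp add: exp_minus flip: mult.assoc)
      then show "(\<lambda>x. (- snd x, exp (snd x) * fst x)) ` ?S \<subseteq> {(l, z). cmod z < r \<and> cmod (exp l * z) < r}"
        by blast
    qed (intro continuous_intros)
    have 3: "continuous_on ?S (\<lambda>x. C (exp (snd x) * fst x))"
      by (rule continuous_on_compose2[OF matrix_holomorphic_continuous[OF C(1)]])
         (use dom in \<open>force intro!: continuous_intros simp del: path_image_linepath\<close>)+
    show ?thesis unfolding K_def
      by (intro continuous_on_matrix_mult) (use 1 2 3 in simp_all)
  qed
  \<comment> \<open>The additional period contributes the monodromy at \<open>exp l * z\<close>, which commutes with \<open>C\<close>.\<close>
  have K_period: "K z (l + ?p) = K z l" if "cmod z < r" "l \<in> ?H z" for z l
  proof -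
    let ?w = "exp l * z" and ?m = "F ?p (exp l * z)"
    have w: "cmod ?w < r" using that by simp
    have ex: "exp (l + ?p) * z = ?w" by (simp add: exp_two_pi_i_add)
    have inv: "invertible ?m"
      by (rule linear_algebraic_group_invertible[OF algebraic flow_in_group]) (use w in auto)
    have "F (- (l + ?p)) ?w = matrix_inv (F (l + ?p) z)"
      using flow_inverse(3)[of z "l + ?p"] that ex by simp
    also have "\<dots> = F (- l) ?w ** matrix_inv ?m"
    proof (rule matrix_inv_unique)
      have "F (l + ?p) z ** (F (- l) ?w ** matrix_inv ?m) = ?m ** (F l z ** F (- l) ?w) ** matrix_inv ?m"
        using flow_period[of z l] that by (simp add: matrix_mul_assoc)
      also have "\<dots> = mat 1"
        using flow_inverse(2)[of z l] that inv by (simp add: matrix_inv_mult)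
      finally show "F (l + ?p) z ** (F (- l) ?w ** matrix_inv ?m) = mat 1" .
    qed
    finally have Fm: "F (- (l + ?p)) ?w = F (- l) ?w ** matrix_inv ?m" .
    have "K z (l + ?p) = F (- l) ?w ** matrix_inv ?m ** C ?w ** (?m ** F l z)"
      unfolding K_def ex Fm using flow_period[of z l] that by simp
    also have "\<dots> = F (- l) ?w ** matrix_inv ?m ** (C ?w ** ?m) ** F l z"
      by (simp add: matrix_mul_assoc)
    also have "C ?w ** ?m = ?m ** C ?w" using C(4)[of ?w] w by simp
    also have "F (- l) ?w ** matrix_inv ?m ** (?m ** C ?w) ** F l z = K z l"
      using inv by (simp add: K_def matrix_mul_assoc matrix_inv_cancel)
    finally show ?thesis .
  qed
  have integrable: "(\<lambda>l. K z (l + m) $ i $ j) contour_integrable_on ?g"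
    if "cmod z < r" "m \<in> ?H z" for z m i j
  proof -
    have hol: "matrix_holomorphic_on (\<lambda>l. K z (l + m)) (?H (exp m * z))"
    proof (rule Khol[OF open_exp_orbit, where p = "\<lambda>l. l + m" and q = "\<lambda>l. z"])
      fix l assume "l \<in> ?H (exp m * z)"
      then show "cmod z < r \<and> cmod (exp (l + m) * z) < r"
        using that(1) by (simp add: exp_add mult.assoc)
    qed (auto intro!: holomorphic_intros)
    have "path_image ?g \<subseteq> ?H (exp m * z)" using segH[of _ "exp m * z"] that by blast
    then have "continuous_on (path_image ?g) (\<lambda>l. K z (l + m) $ i $ j)"
      using hol unfolding matrix_holomorphic_on_def
      by (meson continuous_on_subset holomorphic_on_imp_continuous_on)
    then show ?thesis by (simp add: contour_integrable_continuous_linepath)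
  qed
  have shift: "matrix_contour_integral ?g (\<lambda>l. K z (l + m)) = matrix_contour_integral ?g (K z)"
    if z: "cmod z < r" and m: "m \<in> ?H z" for z m
    unfolding matrix_contour_integral_def vec_eq_iff
  proof (simp, intro allI)
    fix i j
    let ?k = "\<lambda>l. K z l $ i $ j"
    have conv: "convex (?H z)" by (rule convex_exp_orbit[OF radius])
    have op: "open (?H z)" by (rule open_exp_orbit)
    have "matrix_holomorphic_on (K z) (?H z)"
      by (rule Khol[of _ "\<lambda>l. l" "\<lambda>l. z"]) (use z op in auto)
    then have "?k holomorphic_on ?H z" by (simp add: matrix_holomorphic_on_def)
    then obtain P where P: "\<And>l. l \<in> ?H z \<Longrightarrow> (P has_field_derivative ?k l) (at l)"
      using holomorphic_convex_primitive'[OF conv op] by (metis at_within_open op)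
    \<comment> \<open>A primitive turns the integral into a difference of two values, whose derivative in \<open>m\<close> vanishes by
    periodicity.\<close>
    have ci: "contour_integral ?g (\<lambda>l. ?k (l + m)) = P (?p + m) - P m" if m: "m \<in> ?H z" for m
    proof -
      have "((\<lambda>l. ?k (l + m)) has_contour_integral (\<lambda>l. P (l + m)) (pathfinish ?g) - (\<lambda>l. P (l + m)) (pathstart ?g)) ?g"
      proof (rule contour_integral_primitive[of "?H (exp m * z)"])
        fix l assume "l \<in> ?H (exp m * z)"
        then have "l + m \<in> ?H z" by (simp add: exp_add mult_ac)
        then have "((\<lambda>l. P (l + m)) has_field_derivative ?k (l + m)) (at l)"
          using P by (simp only: DERIV_shift[symmetric])
        then show "((\<lambda>l. P (l + m)) has_field_derivative ?k (l + m)) (at l within ?H (exp m * z))"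
          by (rule has_field_derivative_at_within)
      next
        show "valid_path ?g" by (rule valid_path_linepath)
        show "path_image ?g \<subseteq> ?H (exp m * z)" using segH[of _ "exp m * z"] m by blast
      qed
      then show ?thesis by (simp add: contour_integral_unique)
    qed
    have pH: "?p + m \<in> ?H z \<longleftrightarrow> m \<in> ?H z" for m by (simp add: exp_two_pi_i_add)
    have "((\<lambda>m. P (?p + m) - P m) has_field_derivative 0) (at m within ?H z)" if "m \<in> ?H z" for m
    proof -
      have "((\<lambda>m. P (?p + m)) has_field_derivative ?k (?p + m)) (at m)"
        using P pH[of m] that by (simp only: add.commute[of ?p] DERIV_shift[symmetric])
      then have "((\<lambda>m. P (?p + m) - P m) has_field_derivative ?k (?p + m) - ?k m) (at m)"
        using P[OF that] by (intro DERIV_diff) auto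
      moreover have "?k (?p + m) = ?k m" using K_period[OF z that] by (simp add: add.commute)
      ultimately show ?thesis by (simp add: has_field_derivative_at_within)
    qed
    from has_field_derivative_zero_constant[OF conv this]
    obtain c where c: "\<And>m. m \<in> ?H z \<Longrightarrow> P (?p + m) - P m = c"
      by blast
    have "0 \<in> ?H z" using z by simp
    then show "contour_integral ?g (\<lambda>l. ?k (l + m)) = contour_integral ?g ?k"
      using ci[OF m] ci[of 0] c[OF m] c[of 0] by simp
  qed
  define D where "D = (\<lambda>z. matrix_scale (1 / ?p) (matrix_contour_integral ?g (K z)))"
  show ?thesis
  proof (rule that[of D])
    show "matrix_holomorphic_on D (ball 0 r)"
      unfolding matrix_holomorphic_on_def
    proof (intro allI)
      fix i j
      have "(\<lambda>z. contour_integral ?g (\<lambda>l. K z l $ i $ j)) holomorphic_on ball 0 r"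
      proof (rule contour_integral_parameter_holomorphic[OF open_ball])
        show "continuous_on (ball 0 r \<times> path_image ?g) (\<lambda>(z, l). K z l $ i $ j)"
          using Kcont by (simp add: continuous_on_matrix_iff case_prod_unfold del: path_image_linepath)
        fix l assume l: "l \<in> path_image ?g"
        have "matrix_holomorphic_on (\<lambda>z. K z l) (ball 0 r)"
          by (rule Khol[of _ "\<lambda>z. l" "\<lambda>z. z"]) (use segH[OF l] in auto)
        then show "(\<lambda>z. K z l $ i $ j) holomorphic_on ball 0 r" by (simp add: matrix_holomorphic_on_def)
      qed (simp_all add: vector_derivative_linepath_at)
      then show "(\<lambda>z. D z $ i $ j) holomorphic_on ball 0 r"
        unfolding D_def matrix_contour_integral_def by (auto intro!: holomorphic_intros)
    qed
    show "D z \<in> tangent_algebra G" if z: "z \<in> ball 0 r" for z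
    proof -
      have zr: "cmod z < r" using z by simp
      have "K z l \<in> tangent_algebra G" if l: "l \<in> path_image ?g" for l
      proof -
        have l': "cmod (exp l * z) < r" using segH[OF l zr] by simp
        have "F (- l) (exp l * z) \<in> G"
          using flow_in_group[of "exp l * z" "- l"] l' zr by (simp add: exp_minus flip: mult.assoc)
        moreover have "matrix_inv (F (- l) (exp l * z)) = F l z"
          by (rule matrix_inv_unique) (rule flow_inverse(1)[OF zr l'])
        ultimately show ?thesis
          using tangent_algebra_conjugate[OF algebraic _ C(2)[of "exp l * z"], of "F (- l) (exp l * z)"] l'
          by (simp add: K_def)
      qed
      then show ?thesis unfolding D_def
        using integrable[OF zr, of 0] zr
        by (intro tangent_algebra_scale tangent_algebra_contour_integral) auto
    qed
    show "D 0 = generator 0"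
    proof -
      have "K 0 l = generator 0" for l
      proof -
        have "F (- l) 0 ** F l 0 = mat 1" using flow_inverse(1)[of 0 l] radius by simp
        then show ?thesis
          by (simp add: K_def C(3) generator_0_commutes[symmetric] flip: matrix_mul_assoc)
             (simp add: matrix_mul_assoc)
      qed
      then show ?thesis by (simp add: D_def matrix_contour_integral_def vec_eq_iff)
    qed
    show "D (exp m * z) ** F m z = F m z ** D z" if z: "cmod z < r" and m: "cmod (exp m * z) < r" for m z
    proof -
      have mH: "m \<in> ?H z" using m by simp
      have eq: "K (exp m * z) l = F m z ** K z (l + m) ** F (- m) (exp m * z)" if l: "l \<in> path_image ?g" for l
      proof -
        let ?w = "exp m * z" and ?v = "exp (l + m) * z"
        have lw: "cmod (exp l * ?w) < r" using segH[OF l] m by simp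
        have v: "exp l * ?w = ?v" by (simp add: exp_add mult_ac)
        have mw: "exp (- m) * ?w = z" by (simp add: exp_minus flip: mult.assoc)
        have mv: "exp (- (l + m)) * ?v = z"
          by (simp only: mult.assoc[symmetric] exp_add[symmetric]) simp
        have "F l ?w = F ((l + m) + - m) ?w" by simp
        also have "\<dots> = F (l + m) z ** F (- m) ?w"
          by (subst flow_add) (use lw m mw z in \<open>auto simp: algebra_simps\<close>)
        finally have 1: "F l ?w = F (l + m) z ** F (- m) ?w" .
        have e: "m + - (l + m) = - l" by simp
        have el: "exp (- l) * ?v = ?w"
          by (simp only: mult.assoc[symmetric] exp_add[symmetric]) simp
        have "cmod (exp (m + - (l + m)) * ?v) < r" unfolding e el by (rule m)
        moreover have "cmod ?v < r" using lw unfolding v .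
        moreover have "cmod (exp (- (l + m)) * ?v) < r" using z unfolding mv .
        ultimately have "F (m + - (l + m)) ?v = F m (exp (- (l + m)) * ?v) ** F (- (l + m)) ?v"
          by (intro flow_add)
        then have 2: "F (- l) ?v = F m z ** F (- (l + m)) ?v" unfolding e mv .
        show ?thesis unfolding K_def v 1 2 by (simp add: matrix_mul_assoc)
      qed
      have "matrix_contour_integral ?g (K (exp m * z)) =
          matrix_contour_integral ?g (\<lambda>l. F m z ** K z (l + m) ** F (- m) (exp m * z))"
        unfolding matrix_contour_integral_def vec_eq_iff
        by (auto simp: eq intro!: contour_integral_eq)
      also have "\<dots> = F m z ** matrix_contour_integral ?g (K z) ** F (- m) (exp m * z)"
        by (simp add: matrix_contour_integral_mult[OF integrable[OF z mH]] shift[OF z mH])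
      finally have "D (exp m * z) = F m z ** D z ** F (- m) (exp m * z)"
        by (simp add: D_def matrix_scale_left matrix_scale_right)
      then show ?thesis
        using flow_inverse(1)[OF z m] by (simp flip: matrix_mul_assoc)
    qed
  qed
qed

text \<open>With \<open>D\<close> the parallel section and \<open>z Y = a - D\<close>, the equivariance of \<open>D\<close> reads \<open>z D' = a D - D a\<close>
  infinitesimally. For the solution \<open>u\<close> of \<open>u' = Y u\<close> this makes \<open>E = u\<^sup>-\<^sup>1 D u\<close> constant, so
  \<open>u\<^sup>-\<^sup>1 D = a(0) u\<^sup>-\<^sup>1\<close>. It follows that \<open>l \<mapsto> u(exp l * z)\<^sup>-\<^sup>1 F l z u(z)\<close> solves the same differential
  equation \<open>h' = a(0) h\<close>, with the same initial value, as \<open>l \<mapsto> F l 0\<close>.\<close>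

theorem local_linearization:
  assumes C: "centralizer_section r C"
  obtains \<rho> u where "\<rho> \<le> r" "linearizing_gauge G F \<rho> u"
proof -
  obtain D where D: "matrix_holomorphic_on D (ball 0 r)" "\<And>z. z \<in> ball 0 r \<Longrightarrow> D z \<in> tangent_algebra G"
    "D 0 = generator 0"
    "\<And>l z. cmod z < r \<Longrightarrow> cmod (exp l * z) < r \<Longrightarrow> D (exp l * z) ** F l z = F l z ** D z"
    using parallel_section_exists[OF C] by blast
  let ?a = generator
  \<comment> \<open>Compare the \<open>l\<close>-derivatives at \<open>l = 0\<close> of the two sides of the equivariance.\<close>
  have Dderiv: "matrix_scale z (matrix_deriv D z) + D z ** ?a z = ?a z ** D z" if z: "z \<in> ball 0 r" for z
  proof -
    have zr: "cmod z < r" using z by simp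
    have "((\<lambda>l. exp l * z) has_field_derivative z) (at 0)" by (auto intro!: derivative_eq_intros)
    moreover have "has_matrix_derivative D (matrix_deriv D z) (exp 0 * z)"
      using matrix_holomorphic_has_derivative[OF D(1) open_ball z] by simp
    ultimately have "has_matrix_derivative (\<lambda>l. D (exp l * z)) (matrix_scale z (matrix_deriv D z)) 0"
      by (intro has_matrix_derivative_compose)
    from has_matrix_derivative_mult[OF this flow_derivative_0[OF zr]]
    have 1: "has_matrix_derivative (\<lambda>l. D (exp l * z) ** F l z)
        (matrix_scale z (matrix_deriv D z) + D z ** ?a z) 0"
      by (simp add: flow_0[OF zr])
    have "has_matrix_derivative (\<lambda>l. F l z ** D z) (?a z ** D z) 0"
      using has_matrix_derivative_mult[OF flow_derivative_0[OF zr] has_matrix_derivative_const[of "D z"]] by simp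
    then have "has_matrix_derivative (\<lambda>l. D (exp l * z) ** F l z) (?a z ** D z) 0"
      by (rule has_matrix_derivative_transform[OF _ open_exp_orbit[of z r]]) (use zr D(4) in auto)
    with 1 show ?thesis by (rule has_matrix_derivative_unique)
  qed
  define b where "b = (\<lambda>z. ?a z - D z)"
  obtain Y where Y: "matrix_holomorphic_on Y (ball 0 r)" "\<And>z. z \<in> ball 0 r \<Longrightarrow> Y z \<in> tangent_algebra G"
    "\<And>z. matrix_scale z (Y z) = b z"
  proof (rule tangent_algebra_divide[of b r G])
    show "matrix_holomorphic_on b (ball 0 r)"
      unfolding b_def by (intro matrix_holomorphic_diff generator_holomorphic D(1))
    show "\<And>z. z \<in> ball 0 r \<Longrightarrow> b z \<in> tangent_algebra G"
      unfolding b_def by (intro tangent_algebra_diff generator_tangent D(2)) auto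
  qed (use radius D(3) in \<open>auto simp: b_def\<close>)
  obtain \<rho>0 u where u0: "0 < \<rho>0" "\<rho>0 \<le> r" "u 0 = mat 1"
    "\<And>z. z \<in> ball 0 \<rho>0 \<Longrightarrow> has_matrix_derivative u (Y z ** u z) z"
    using linear_ode_exists[OF Y(1) radius] by blast
  have "isCont (\<lambda>z. det (u z)) 0"
  proof -
    have "matrix_holomorphic_on u (ball 0 \<rho>0)" by (rule matrix_holomorphicI) (use u0(4) in blast)
    then have "(\<lambda>z. det (u z)) holomorphic_on ball 0 \<rho>0"
      by (intro holomorphic_on_det) (simp add: matrix_holomorphic_on_def)
    then show ?thesis
      using u0(1) by (meson holomorphic_on_imp_continuous_on continuous_on_eq_continuous_at open_ball centre_in_ball)
  qed
  then obtain e where e: "e > 0" "\<And>z. dist 0 z < e \<Longrightarrow> det (u z) \<noteq> 0"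
    using continuous_at_avoid[of 0 "\<lambda>z. det (u z)" 0] u0(3) by auto
  \<comment> \<open>The solution is invertible on this disc.\<close>
  define \<rho> where "\<rho> = min e \<rho>0"
  have \<rho>: "0 < \<rho>" "\<rho> \<le> r" "ball 0 \<rho> \<subseteq> ball 0 r" "\<rho> \<le> \<rho>0" using e u0 by (auto simp: \<rho>_def)
  have inv: "invertible (u z)" if "z \<in> ball 0 \<rho>" for z
    using e(2)[of z] that by (auto simp: \<rho>_def invertible_det_nz)
  have ud: "has_matrix_derivative u (Y z ** u z) z" if "z \<in> ball 0 \<rho>" for z
    using u0(4)[of z] that \<rho> by auto
  have uhol: "matrix_holomorphic_on u (ball 0 \<rho>)" by (rule matrix_holomorphicI) (use ud in blast)
  have uG: "u z \<in> G" if "z \<in> ball 0 \<rho>" for z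
    by (rule ode_solution_in_group[OF algebraic \<rho>(1) matrix_holomorphic_subset[OF Y(1) \<rho>(3)] Y(2) ud u0(3) inv that])
       (use \<rho>(2) in auto)
  define E where "E = (\<lambda>z. matrix_inv (u z) ** D z ** u z)"
  have Ehol: "matrix_holomorphic_on E (ball 0 \<rho>)"
    unfolding E_def
    by (intro matrix_holomorphic_mult matrix_holomorphic_inv uhol inv matrix_holomorphic_subset[OF D(1) \<rho>(3)])
  have E': "has_matrix_derivative E 0 z" if z: "z \<in> ball 0 \<rho>" "z \<noteq> 0" for z
  proof -
    let ?I = "matrix_inv (u z)"
    have zr: "z \<in> ball 0 r" using z \<rho> by auto
    have I: "has_matrix_derivative (\<lambda>w. matrix_inv (u w)) (- (?I ** (Y z ** u z) ** ?I)) z"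
      by (rule has_matrix_derivative_inv[OF uhol inv open_ball z(1) ud[OF z(1)]])
    have II: "- (?I ** (Y z ** u z) ** ?I) = - (?I ** Y z)"
      using inv[OF z(1)] by (simp add: matrix_mul_assoc matrix_inv_cancel)
    have d: "has_matrix_derivative E ((- (?I ** Y z) ** D z + ?I ** matrix_deriv D z) ** u z + ?I ** D z ** (Y z ** u z)) z"
      unfolding E_def
      using has_matrix_derivative_mult[OF has_matrix_derivative_mult[OF I[unfolded II]
            matrix_holomorphic_has_derivative[OF D(1) open_ball zr]] ud[OF z(1)]] .
    let ?X = "matrix_deriv D z + D z ** Y z - Y z ** D z"
    have "(- (?I ** Y z) ** D z + ?I ** matrix_deriv D z) ** u z + ?I ** D z ** (Y z ** u z) = ?I ** ?X ** u z"
      by (simp add: matrix_add_ldistrib matrix_add_rdistrib matrix_diff_ldistrib matrix_diff_rdistrib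
          matrix_minus_left matrix_mul_assoc)
    moreover have "matrix_scale z ?X = 0"
    proof -
      have "matrix_scale z ?X = matrix_scale z (matrix_deriv D z) + D z ** b z - b z ** D z"
        by (simp add: matrix_scale_add matrix_scale_diff Y(3)[symmetric] matrix_scale_left matrix_scale_right)
      also have "\<dots> = 0"
        using Dderiv[OF zr] by (simp add: b_def matrix_diff_ldistrib matrix_diff_rdistrib algebra_simps)
      finally show ?thesis .
    qed
    then have "?X = 0" using z(2) by (simp add: vec_eq_iff)
    ultimately show ?thesis using d by simp
  qed
  \<comment> \<open>The previous computation divides by \<open>z\<close>; the value at \<open>0\<close> follows by continuity.\<close>
  have E'0: "has_matrix_derivative E 0 z" if z: "z \<in> ball 0 \<rho>" for z
  proof (cases "z = 0")
    case True
    have "matrix_deriv E 0 $ i $ j = 0" for i j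
    proof (rule continuous_zero_punctured[OF _ \<rho>(1)])
      show "continuous_on (ball 0 \<rho>) (\<lambda>z. matrix_deriv E z $ i $ j)"
        using matrix_holomorphic_deriv[OF Ehol open_ball]
        by (auto simp: matrix_holomorphic_on_def intro: holomorphic_on_imp_continuous_on)
    qed (use has_matrix_derivative_imp_deriv[OF E'] in auto)
    then have "matrix_deriv E 0 = 0" by (simp add: vec_eq_iff)
    then show ?thesis
      using matrix_holomorphic_has_derivative[OF Ehol open_ball z] True by simp
  qed (use E' z in blast)
  have E: "E z = ?a 0" if z: "z \<in> ball 0 \<rho>" for z
  proof -
    have "E z = E 0"
      by (rule matrix_derivative_zero_constant[OF convex_ball[of 0 \<rho>] open_ball E'0]) (use z \<rho> in auto)
    then show ?thesis by (simp add: E_def u0(3) D(3))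
  qed
  have ID: "matrix_inv (u w) ** D w = ?a 0 ** matrix_inv (u w)" if w: "w \<in> ball 0 \<rho>" for w
  proof -
    have "matrix_inv (u w) ** D w = E w ** matrix_inv (u w)"
      using inv[OF w] by (simp add: E_def matrix_inv_cancel)
    then show ?thesis by (simp add: E[OF w])
  qed
  have "F l z ** u z = u (exp l * z) ** F l 0" if z: "z \<in> ball 0 \<rho>" and l: "exp l * z \<in> ball 0 \<rho>" for l z
  proof -
    let ?H = "{l. cmod (exp l * z) < \<rho>}"
    \<comment> \<open>The claim is that \<open>M\<close> is constantly \<open>1\<close>.\<close>
    define M where "M = (\<lambda>l. F (- l) 0 ** (matrix_inv (u (exp l * z)) ** F l z) ** u z)"
    have "has_matrix_derivative M 0 l" if l: "l \<in> ?H" for l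
    proof -
      let ?w = "exp l * z"
      let ?I = "matrix_inv (u ?w)"
      have w: "?w \<in> ball 0 \<rho>" using l by simp
      have wr: "cmod z < r" "cmod ?w < r" using w z \<rho> by auto
      have ex: "((\<lambda>l. exp l * z) has_field_derivative ?w) (at l)" by (auto intro!: derivative_eq_intros)
      have "has_matrix_derivative (\<lambda>w. matrix_inv (u w)) (- (?I ** (Y ?w ** u ?w) ** ?I)) ?w"
        by (rule has_matrix_derivative_inv[OF uhol inv open_ball w ud[OF w]])
      from has_matrix_derivative_compose[OF this ex]
      have I: "has_matrix_derivative (\<lambda>l. matrix_inv (u (exp l * z))) (- (?I ** b ?w)) l"
      proof (rule has_matrix_derivative_eq_rhs)
        have "matrix_scale ?w (- (?I ** (Y ?w ** u ?w) ** ?I)) = - (?I ** matrix_scale ?w (Y ?w))"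
          using inv[OF w]
          by (simp add: matrix_mul_assoc matrix_inv_cancel matrix_scale_right) (simp add: vec_eq_iff)
        then show "matrix_scale ?w (- (?I ** (Y ?w ** u ?w) ** ?I)) = - (?I ** b ?w)" by (simp add: Y(3))
      qed
      have "has_matrix_derivative (\<lambda>l. matrix_inv (u (exp l * z)) ** F l z) (?a 0 ** (?I ** F l z)) l"
      proof (rule has_matrix_derivative_eq_rhs[OF has_matrix_derivative_mult[OF I flow_derivative[OF wr]]])
        have "- (?I ** b ?w) ** F l z + ?I ** (?a ?w ** F l z) = ?I ** D ?w ** F l z"
          by (simp add: b_def matrix_diff_ldistrib matrix_diff_rdistrib matrix_minus_left matrix_mul_assoc)
        then show "- (?I ** b ?w) ** F l z + ?I ** (?a ?w ** F l z) = ?a 0 ** (?I ** F l z)"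
          using ID[OF w] by (simp add: matrix_mul_assoc)
      qed
      note G = this
      have F0: "has_matrix_derivative (\<lambda>l. F (- l) 0) (- (?a 0 ** F (- l) 0)) l"
      proof (rule has_matrix_derivative_eq_rhs[OF has_matrix_derivative_compose])
        show "has_matrix_derivative (\<lambda>k. F k 0) (?a 0 ** F (- l) 0) (- l)"
          using flow_derivative[of 0 "- l"] radius by simp
        show "(uminus has_field_derivative - 1) (at l)" by (auto intro!: derivative_eq_intros)
      qed (simp add: vec_eq_iff)
      show ?thesis
        unfolding M_def
      proof (rule has_matrix_derivative_eq_rhs[OF has_matrix_derivative_mult[OF has_matrix_derivative_mult[OF F0 G] has_matrix_derivative_const]])
        show "(- (?a 0 ** F (- l) 0) ** (?I ** F l z) + F (- l) 0 ** (?a 0 ** (?I ** F l z))) ** u z +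
            F (- l) 0 ** (?I ** F l z) ** 0 = 0"
          by (simp add: matrix_mul_assoc matrix_minus_left generator_0_commutes)
      qed
    qed
    then have "M l = M 0"
      by (rule matrix_derivative_zero_constant[OF convex_exp_orbit[OF \<rho>(1)] open_exp_orbit])
         (use z l in auto)
    also have "M 0 = mat 1"
      using z \<rho> radius inv[OF z] by (simp add: M_def flow_0 matrix_inv_mult)
    finally have M1: "M l = mat 1" .
    have "u (exp l * z) ** F l 0 ** M l = u (exp l * z) ** (F l 0 ** F (- l) 0) ** (matrix_inv (u (exp l * z)) ** F l z) ** u z"
      by (simp add: M_def matrix_mul_assoc)
    also have "\<dots> = F l z ** u z"
      using flow_inverse(2)[of 0 l] radius inv[OF l] by (simp add: matrix_mul_assoc matrix_inv_mult)
    finally show ?thesis by (simp add: M1)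
  qed
  then have "linearizing_gauge G F \<rho> u"
    using \<rho>(1) uhol uG by (simp add: linearizing_gauge_def)
  then show ?thesis by (rule that[OF \<rho>(2)])
qed

end

section \<open>Sections of the centralizer of the monodromy\<close>

lemma matrix_mult_diagonal:
  fixes X D :: "complex^'n^'n"
  assumes "\<forall>i j. i \<noteq> j \<longrightarrow> D $ i $ j = 0"
  shows "(X ** D) $ i $ j = X $ i $ j * D $ j $ j" "(D ** X) $ i $ j = D $ i $ i * X $ i $ j"
proof -
  have "(\<Sum>k\<in>UNIV. X $ i $ k * D $ k $ j) = (\<Sum>k\<in>UNIV. if k = j then X $ i $ j * D $ j $ j else 0)"
    by (rule sum.cong) (auto simp: assms)
  then show "(X ** D) $ i $ j = X $ i $ j * D $ j $ j" by (simp add: matrix_mult_nth)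
  have "(\<Sum>k\<in>UNIV. D $ i $ k * X $ k $ j) = (\<Sum>k\<in>UNIV. if k = i then D $ i $ i * X $ i $ j else 0)"
    by (rule sum.cong) (auto simp: assms)
  then show "(D ** X) $ i $ j = D $ i $ i * X $ i $ j" by (simp add: matrix_mult_nth)
qed

text \<open>One factor of the interpolation polynomial in \<open>Ad m\<close> that is \<open>1\<close> at the eigenvalue \<open>1\<close> and \<open>0\<close> at
  the other eigenvalues: this factor annihilates the eigenspace of \<open>c\<close> and fixes that of \<open>1\<close>.\<close>

definition eigenvalue_filter :: "complex^'n^'n \<Rightarrow> complex \<Rightarrow> complex^'n^'n \<Rightarrow> complex^'n^'n" where
  "eigenvalue_filter m c X = matrix_scale (1 / (1 - c)) (m ** X ** matrix_inv m - matrix_scale c X)"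

text \<open>In an eigenbasis of \<open>m\<close> the matrix units are eigenvectors of \<open>Ad m\<close>, with the quotients of two
  eigenvalues of \<open>m\<close> as eigenvalues.\<close>

lemma eigenvalue_filter_conjugate_nth:
  fixes m Q D X :: "complex^'n^'n"
  assumes m: "m = Q ** D ** matrix_inv Q" "invertible m" and Q: "invertible Q"
    and D: "\<forall>i j. i \<noteq> j \<longrightarrow> D $ i $ j = 0"
  shows "(matrix_inv Q ** eigenvalue_filter m c X ** Q) $ i $ j =
     (D $ i $ i / D $ j $ j - c) / (1 - c) * (matrix_inv Q ** X ** Q) $ i $ j"
proof -
  let ?I = "matrix_inv Q"
  have mQ: "m ** Q = Q ** D" and Qm: "?I ** m = D ** ?I"
    using Q by (simp_all add: m(1) matrix_inv_cancel matrix_inv_mult matrix_mul_assoc)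
  have "D = ?I ** m ** Q" using Q by (simp add: Qm matrix_inv_cancel)
  then have "invertible D" using Q m(2) by (simp add: invertible_mult invertible_matrix_inv)
  then have Dj: "D $ j $ j \<noteq> 0"
    using D by (simp add: invertible_det_nz det_diagonal)
  let ?Z = "?I ** (m ** X ** matrix_inv m) ** Q"
  have "?Z ** D = (?I ** m) ** X ** (matrix_inv m ** m) ** Q"
    by (simp add: mQ[symmetric] flip: matrix_mul_assoc)
  also have "\<dots> = D ** (?I ** X ** Q)"
    using m(2) by (simp add: Qm matrix_inv_mult matrix_mul_assoc)
  finally have "(?Z ** D) $ i $ j = (D ** (?I ** X ** Q)) $ i $ j" by simp
  then have "?Z $ i $ j * D $ j $ j = D $ i $ i * (?I ** X ** Q) $ i $ j"
    by (simp only: matrix_mult_diagonal[OF D])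
  then have Z: "?Z $ i $ j = D $ i $ i / D $ j $ j * (?I ** X ** Q) $ i $ j"
    using Dj by (simp add: field_simps)
  have "?I ** eigenvalue_filter m c X ** Q = matrix_scale (1 / (1 - c)) (?Z - matrix_scale c (?I ** X ** Q))"
    by (simp add: eigenvalue_filter_def matrix_scale_left matrix_scale_right matrix_diff_ldistrib matrix_diff_rdistrib)
  then show ?thesis by (simp add: Z algebra_simps diff_divide_distrib)
qed

context local_flow
begin

lemma period_map_in_group: "cmod z < r \<Longrightarrow> period_map z \<in> G"
  by (rule flow_in_group) simp_all

lemma period_map_invertible: "cmod z < r \<Longrightarrow> invertible (period_map z)"
  using linear_algebraic_group_invertible[OF algebraic] period_map_in_group by blast

lemma period_map_holomorphic: "matrix_holomorphic_on period_map (ball 0 r)"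
  by (rule flow_holomorphic_compose) auto

text \<open>Filter out of the residue all eigenvalues of \<open>Ad (m z)\<close> other than \<open>1\<close>. They are the same for all
  \<open>z \<noteq> 0\<close>, so the result depends holomorphically on \<open>z\<close>, and at \<open>z = 0\<close> nothing is removed because
  the residue commutes with \<open>m 0\<close>.\<close>

lemma centralizer_section_semisimple:
  fixes D :: "complex^'n^'n"
  assumes D: "\<forall>i j. i \<noteq> j \<longrightarrow> D $ i $ j = 0"
    and diag: "\<And>z. cmod z < r \<Longrightarrow> z \<noteq> 0 \<Longrightarrow>
       \<exists>Q. invertible Q \<and> period_map z = Q ** D ** matrix_inv Q"
  obtains C where "centralizer_section r C"
proof -
  let ?m = period_map
  have "finite ((\<lambda>(i, j). D $ i $ i / D $ j $ j) ` UNIV - {1})" by simp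
  then obtain cs where cs: "set cs = (\<lambda>(i, j). D $ i $ i / D $ j $ j) ` UNIV - {1}"
    using finite_list by blast
  define C where "C = (\<lambda>cs z. foldr (eigenvalue_filter (?m z)) cs (generator 0))"
  have C_simps: "C [] z = generator 0" "C (c # cs) z = eigenvalue_filter (?m z) c (C cs z)" for c cs z
    by (simp_all add: C_def)
  have hol: "matrix_holomorphic_on (C cs) (ball 0 r)" for cs
  proof (induction cs)
    case (Cons c cs)
    then show ?case
      unfolding C_simps eigenvalue_filter_def
      by (intro matrix_holomorphic_scale matrix_holomorphic_diff matrix_holomorphic_mult
          matrix_holomorphic_inv period_map_holomorphic period_map_invertible) auto
  qed (simp add: C_simps matrix_holomorphic_const)
  have tan: "C cs z \<in> tangent_algebra G" if "cmod z < r" for cs z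
  proof (induction cs)
    case (Cons c cs)
    then show ?case
      unfolding C_simps eigenvalue_filter_def
      by (intro tangent_algebra_scale tangent_algebra_diff tangent_algebra_conjugate algebraic
          period_map_in_group that)
  qed (use generator_tangent[of 0] radius in \<open>simp add: C_simps\<close>)
  have zero: "C cs 0 = generator 0" if "1 \<notin> set cs" for cs
    using that
  proof (induction cs)
    case (Cons c cs)
    have "?m 0 ** generator 0 ** matrix_inv (?m 0) = generator 0"
      using period_map_invertible[of 0] radius by (simp add: generator_0_commutes matrix_inv_cancel)
    moreover have "generator 0 - matrix_scale c (generator 0) = matrix_scale (1 - c) (generator 0)"
      by (simp add: vec_eq_iff algebra_simps)
    ultimately have "eigenvalue_filter (?m 0) c (generator 0) = matrix_scale (1 / (1 - c)) (matrix_scale (1 - c) (generator 0))"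
      by (simp only: eigenvalue_filter_def)
    also have "\<dots> = generator 0" using Cons.prems by auto
    finally show ?case using Cons by (simp add: C_simps)
  qed (simp add: C_simps)
  have comm: "C cs z ** ?m z = ?m z ** C cs z" if z: "cmod z < r" for z
  proof (cases "z = 0")
    case True
    then show ?thesis using zero[of cs] cs generator_0_commutes by simp
  next
    case False
    then obtain Q where Q: "invertible Q" "?m z = Q ** D ** matrix_inv Q" using diag z by blast
    let ?I = "matrix_inv Q"
    \<comment> \<open>Off the blocks of equal eigenvalues one of the filters has annihilated the entry.\<close>
    have ent: "(?I ** C cs z ** Q) $ i $ j = 0" if "D $ i $ i / D $ j $ j \<in> set cs" for cs i j
      using that
    proof (induction cs)
      case (Cons c cs)
      then show ?case
        by (auto simp: C_simps eigenvalue_filter_conjugate_nth[OF Q(2) period_map_invertible[OF z] Q(1) D])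
    qed simp
    let ?X = "?I ** C cs z ** Q"
    have "D ** ?X = ?X ** D"
      unfolding vec_eq_iff matrix_mult_diagonal[OF D]
    proof (intro allI)
      fix i j
      show "D $ i $ i * ?X $ i $ j = ?X $ i $ j * D $ j $ j"
      proof (cases "D $ i $ i / D $ j $ j = 1")
        case True
        then have "D $ i $ i = D $ j $ j" by (metis div_0 divide_eq_1_iff)
        then show ?thesis by simp
      next
        case False
        then have "?X $ i $ j = 0" using cs by (intro ent) force
        then show ?thesis by simp
      qed
    qed
    then have "Q ** (D ** ?X) ** ?I = Q ** (?X ** D) ** ?I" by simp
    then show ?thesis
      using Q(1) by (simp add: Q(2) matrix_mul_assoc matrix_inv_cancel matrix_inv_mult)
  qed
  show ?thesis
    by (rule that[of "C cs"]) (use hol tan zero comm cs in \<open>auto simp: centralizer_section_def\<close>)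
qed

lemma local_flow_restrict:
  assumes "0 < s" "s \<le> r"
  shows "local_flow G s F"
proof
  show "matrix_holomorphic2_on (\<lambda>(l, z). F l z) {(l, z). cmod z < s \<and> cmod (exp l * z) < s}"
    by (rule matrix_holomorphic2_subset[OF flow_holomorphic]) (use assms in auto)
qed (use assms algebraic flow_in_group flow_0 flow_add in auto)

text \<open>The matrix of the linear map \<open>X \<mapsto> X m - m X\<close>.\<close>

definition bracket_matrix :: "complex^'n^'n \<Rightarrow> complex^('n \<times> 'n)^('n \<times> 'n)" where
  "bracket_matrix m = (\<chi> p q. (if fst p = fst q then m $ snd q $ snd p else 0) -
     (if snd p = snd q then m $ fst p $ fst q else 0))"

lemma bracket_matrix_mult: "bracket_matrix m *v v =
    vectorize (devectorize v ** m - m ** devectorize v)"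
proof -
  have "(\<Sum>q\<in>UNIV. bracket_matrix m $ (i, j) $ q * v $ q) =
      (\<Sum>l\<in>UNIV. v $ (i, l) * m $ l $ j) - (\<Sum>k\<in>UNIV. m $ i $ k * v $ (k, j))" for i j
  proof -
    have "(\<Sum>q\<in>UNIV. bracket_matrix m $ (i, j) $ q * v $ q) =
      (\<Sum>k\<in>UNIV. \<Sum>l\<in>UNIV. bracket_matrix m $ (i, j) $ (k, l) * v $ (k, l))"
      by (simp add: sum.cartesian_product flip: UNIV_Times_UNIV)
    also have "\<dots> = (\<Sum>k\<in>UNIV. \<Sum>l\<in>UNIV. if i = k then m $ l $ j * v $ (k, l) else 0) -
        (\<Sum>k\<in>UNIV. \<Sum>l\<in>UNIV. if j = l then m $ i $ k * v $ (k, l) else 0)"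
      unfolding sum_subtractf[symmetric]
      by (intro sum.cong refl) (simp add: bracket_matrix_def algebra_simps)
    also have "(\<Sum>k\<in>UNIV. \<Sum>l\<in>UNIV. if i = k then m $ l $ j * v $ (k, l) else 0) =
        (\<Sum>k\<in>UNIV. if i = k then \<Sum>l\<in>UNIV. m $ l $ j * v $ (k, l) else 0)"
      by (intro sum.cong) auto
    finally show ?thesis by (simp add: mult.commute)
  qed
  then show ?thesis by (simp add: vec_eq_iff matrix_vector_mult_def matrix_mult_nth split_paired_all)
qed

text \<open>Conjugation by \<open>g \<in> G\<close> preserves the tangent algebra and carries the bracket with \<open>m\<close> into the
  bracket with \<open>g m g\<^sup>-\<^sup>1\<close>, so the rank of the bracket with the monodromy does not depend on \<open>z\<close>.\<close>

lemma centralizer_section_conjugate: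
  fixes m :: "complex^'n^'n"
  assumes conj: "\<And>z. cmod z < r \<Longrightarrow> \<exists>g\<in>G. period_map z = g ** m ** matrix_inv g"
  obtains \<epsilon> C where "0 < \<epsilon>" "\<epsilon> \<le> r" "centralizer_section \<epsilon> C"
proof -
  let ?V = "{v. devectorize v \<in> tangent_algebra G}"
  let ?L = "\<lambda>z. bracket_matrix (period_map z)"
  have dim: "vec.dim ((*v) (?L z) ` ?V) = vec.dim ((*v) (bracket_matrix m) ` ?V)" if z: "cmod z < r" for z
  proof -
    obtain g where g: "g \<in> G" "period_map z = g ** m ** matrix_inv g" using conj[OF z] by blast
    have ig: "invertible g" by (rule linear_algebraic_group_invertible[OF algebraic g(1)])
    define T :: "complex^'n^'n \<Rightarrow> complex^('n \<times> 'n) \<Rightarrow> complex^('n \<times> 'n)"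
      where "T = (\<lambda>h v. vectorize (h ** devectorize v ** matrix_inv h))"
    have TT: "T (matrix_inv g) (T g v) = v" "T g (T (matrix_inv g) v) = v" for v
    proof -
      have gi: "matrix_inv (matrix_inv g) = g" by (rule matrix_inv_unique) (simp add: matrix_inv_mult ig)
      show "T (matrix_inv g) (T g v) = v" "T g (T (matrix_inv g) v) = v"
        using ig by (simp_all add: T_def gi matrix_mul_assoc matrix_inv_mult matrix_inv_cancel)
    qed
    have lin: "Vector_Spaces.linear (*s) (*s) (T g)"
      unfolding Vector_Spaces.linear_iff T_def
      by (auto simp: vec.vector_space_axioms devectorize_linear vectorize_linear matrix_add_ldistrib
          matrix_add_rdistrib matrix_scale_left matrix_scale_right)
    have VT: "T g v \<in> ?V" "T (matrix_inv g) v \<in> ?V" if "v \<in> ?V" for v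
      using that g(1) by (simp_all add: T_def tangent_algebra_conjugate algebraic linear_algebraic_group_closed)
    have LT: "?L z *v T g v = T g (bracket_matrix m *v v)" for v
      using ig
      by (simp add: bracket_matrix_mult T_def g(2) matrix_diff_ldistrib matrix_diff_rdistrib matrix_mul_assoc
          matrix_inv_cancel matrix_inv_mult)
    have "(*v) (?L z) ` ?V = T g ` ((*v) (bracket_matrix m) ` ?V)"
    proof
      show "(*v) (?L z) ` ?V \<subseteq> T g ` ((*v) (bracket_matrix m) ` ?V)"
      proof
        fix y assume "y \<in> (*v) (?L z) ` ?V"
        then obtain v where v: "v \<in> ?V" "y = ?L z *v v" by blast
        then have "y = T g (bracket_matrix m *v T (matrix_inv g) v)"
          using LT[of "T (matrix_inv g) v"] by (simp add: TT)
        then show "y \<in> T g ` ((*v) (bracket_matrix m) ` ?V)" using VT(2)[OF v(1)] by blast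
      qed
      show "T g ` ((*v) (bracket_matrix m) ` ?V) \<subseteq> (*v) (?L z) ` ?V"
        using VT(1) by (auto simp: LT[symmetric])
    qed
    moreover have "inj_on (T g) (vec.span ((*v) (bracket_matrix m) ` ?V))"
      by (rule inj_on_inverseI[of _ "T (matrix_inv g)"]) (rule TT(1))
    ultimately show ?thesis
      using vec.dim_image_eq[OF lin, of "(*v) (bracket_matrix m) ` ?V"] by simp
  qed
  have Lhol: "matrix_holomorphic_on ?L (ball 0 r)"
    unfolding matrix_holomorphic_on_def
  proof (intro allI)
    fix p q
    have "(\<lambda>z. period_map z $ i $ j) holomorphic_on ball 0 r" for i j
      using period_map_holomorphic by (simp add: matrix_holomorphic_on_def)
    then show "(\<lambda>z. ?L z $ p $ q) holomorphic_on ball 0 r"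
      by (cases "fst p = fst q"; cases "snd p = snd q")
         (auto simp: bracket_matrix_def intro!: holomorphic_intros)
  qed
  have dim_const: "vec.dim ((*v) (?L z) ` ?V) = vec.dim ((*v) (?L 0) ` ?V)" if "z \<in> ball 0 r" for z
    using dim[of z] dim[of 0] that radius by simp
  have A: "vectorize (generator 0) \<in> ?V" using generator_tangent[of 0] radius by simp
  have LA: "?L 0 *v vectorize (generator 0) = 0"
    using generator_0_commutes by (simp add: bracket_matrix_mult vec_eq_iff)
  obtain \<epsilon> c where c: "0 < \<epsilon>" "\<epsilon> \<le> r" "c 0 = vectorize (generator 0)"
    "\<And>i. (\<lambda>z. c z $ i) holomorphic_on ball 0 \<epsilon>" "\<And>z. z \<in> ball 0 \<epsilon> \<Longrightarrow> c z \<in> ?V"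
    "\<And>z. z \<in> ball 0 \<epsilon> \<Longrightarrow> ?L z *v c z = 0"
    using constant_rank_kernel_section[OF subspace_flat_tangent_algebra Lhol radius dim_const A LA]
    by blast
  have "devectorize (c z) ** period_map z = period_map z ** devectorize (c z)" if "z \<in> ball 0 \<epsilon>" for z
  proof -
    from c(6)[OF that] have "devectorize (vectorize (devectorize (c z) ** period_map z - period_map z ** devectorize (c z))) = 0"
      unfolding bracket_matrix_mult by (simp del: vectorize_inverse)
    then show ?thesis by simp
  qed
  then have "centralizer_section \<epsilon> (\<lambda>z. devectorize (c z))"
    using c by (auto simp: centralizer_section_def matrix_holomorphic_on_def)
  then show ?thesis by (rule that[OF c(1,2)])
qed

end

section \<open>The exponential of a matrix\<close>

lemma matrix_pow_0 [simp]: "matrix_pow A 0 = mat 1"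
  by (simp add: matrix_pow_def)

lemma matrix_pow_Suc: "matrix_pow A (Suc k) = A ** matrix_pow A k"
  by (simp add: matrix_pow_def)

lemma matrix_pow_commute: "matrix_pow A k ** A = A ** matrix_pow A k"
  by (induction k) (simp_all add: matrix_pow_Suc flip: matrix_mul_assoc)

lemma matrix_pow_scale: "matrix_pow (matrix_scale c A) k = matrix_scale (c ^ k) (matrix_pow A k)"
  by (induction k) (simp_all add: matrix_pow_Suc matrix_scale_left matrix_scale_right mult_ac)

text \<open>The exponential is the only solution: the derivatives of any solution at \<open>0\<close> are the powers of
  \<open>B\<close>, and its Taylor series is the exponential series. In particular this gives the convergence
  of the latter.\<close>

lemma matrix_exp_solution:
  fixes u :: "complex \<Rightarrow> complex^'n^'n"
  assumes u: "\<And>z. z \<in> ball 0 R \<Longrightarrow> has_matrix_derivative u (B ** u z) z" "u 0 = mat 1"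
    and z: "z \<in> ball 0 R"
  shows "matrix_exp (matrix_scale z B) = u z"
proof -
  have hol: "matrix_holomorphic_on u (ball 0 R)" by (rule matrix_holomorphicI) (use u(1) in blast)
  have R: "0 \<in> ball (0::complex) R" using order_le_less_trans[OF norm_ge_zero, of z R] z by simp
  have deriv: "(deriv ^^ k) (\<lambda>w. u w $ i $ j) w = (matrix_pow B k ** u w) $ i $ j" if "w \<in> ball 0 R" for k w i j
    using that
  proof (induction k arbitrary: w)
    case (Suc k)
    have "deriv ((deriv ^^ k) (\<lambda>w. u w $ i $ j)) w = (matrix_pow B k ** (B ** u w)) $ i $ j"
    proof (rule DERIV_imp_deriv, rule has_field_derivative_transform_within_open[OF _ open_ball Suc.prems])
      have "has_matrix_derivative (\<lambda>w. matrix_pow B k ** u w) (matrix_pow B k ** (B ** u w)) w"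
        using has_matrix_derivative_mult[OF has_matrix_derivative_const[of "matrix_pow B k"] u(1)[OF Suc.prems]]
        by simp
      then show "((\<lambda>w. (matrix_pow B k ** u w) $ i $ j) has_field_derivative (matrix_pow B k ** (B ** u w)) $ i $ j) (at w)"
        by (simp add: has_matrix_derivative_def)
    qed (use Suc.IH in auto)
    then show ?case by (simp add: matrix_mul_assoc matrix_pow_commute matrix_pow_Suc)
  qed simp
  have entry: "(\<lambda>k. ((1 / fact k) *\<^sub>R matrix_pow (matrix_scale z B) k) $ i $ j) sums u z $ i $ j" for i j
  proof -
    have "(\<lambda>k. (deriv ^^ k) (\<lambda>w. u w $ i $ j) 0 / fact k * (z - 0) ^ k) sums u z $ i $ j"
      by (rule holomorphic_power_series[OF _ z]) (use hol in \<open>simp add: matrix_holomorphic_on_def\<close>)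
    moreover have "((1 / fact k) *\<^sub>R matrix_pow (matrix_scale z B) k) $ i $ j =
        (deriv ^^ k) (\<lambda>w. u w $ i $ j) 0 / fact k * (z - 0) ^ k" for k
      by (simp add: deriv[OF R] u(2) matrix_pow_scale) (simp add: scaleR_conv_of_real)
    ultimately show ?thesis by simp
  qed
  have "(\<lambda>k. (1 / fact k) *\<^sub>R matrix_pow (matrix_scale z B) k) sums u z"
    unfolding sums_def
  proof (intro vec_tendstoI)
    fix i j
    show "(\<lambda>n. (\<Sum>k<n. (1 / fact k) *\<^sub>R matrix_pow (matrix_scale z B) k) $ i $ j) \<longlonglongrightarrow> u z $ i $ j"
      using entry[of i j] by (simp add: sums_def)
  qed
  then show ?thesis by (simp add: matrix_exp_def sums_unique[symmetric])
qed

text \<open>Both exponentials solve a linear differential equation near \<open>0\<close>; compare derivatives at \<open>0\<close>.\<close>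

lemma matrix_exp_injective:
  fixes A B :: "complex^'n^'n"
  assumes eq: "\<And>t :: real. matrix_exp (matrix_scale (of_real t) A) = matrix_exp (matrix_scale (of_real t) B)"
  shows "A = B"
proof -
  have deriv: "((\<lambda>t. matrix_exp (matrix_scale (of_real t) A) $ i $ j) has_vector_derivative A $ i $ j) (at (0::real))"
    for A :: "complex^'n^'n" and i j
  proof -
    obtain R u where u: "0 < R" "u 0 = mat 1" "\<And>z. z \<in> ball 0 R \<Longrightarrow> has_matrix_derivative u (A ** u z) z"
      using linear_ode_exists[OF matrix_holomorphic_const, of 1 A] by (metis zero_less_one)
    show ?thesis
    proof (rule has_vector_derivative_transform_within_open[of "\<lambda>t. u (of_real t) $ i $ j" _ _ "ball 0 R"])
      have "has_matrix_derivative u A (of_real 0)" using u(3)[of 0] u(1,2) by simp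
      then show "((\<lambda>t. u (of_real t) $ i $ j) has_vector_derivative A $ i $ j) (at (0::real))"
        unfolding has_matrix_derivative_def by (intro has_vector_derivative_real_field) blast
      show "\<And>t. t \<in> ball 0 R \<Longrightarrow> u (of_real t) $ i $ j = matrix_exp (matrix_scale (of_real t) A) $ i $ j"
        using matrix_exp_solution[OF u(3,2)] by simp
    qed (use u(1) in auto)
  qed
  have "A $ i $ j = B $ i $ j" for i j
    using deriv[of A] deriv[of B] vector_derivative_unique_at unfolding eq by metis
  then show ?thesis by (simp add: vec_eq_iff)
qed

section \<open>Fibres and charts of a principal bundle\<close>

locale algebraic_principal_bundle =
  fixes G :: "(complex^'n^'n) set" and P :: "('p, 'n) principal_bundle"
  assumes algebraic: "linear_algebraic_group G" and principal: "holomorphic_principal_bundle G P"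
begin

lemma group_invertible: "g \<in> G \<Longrightarrow> invertible g"
  by (rule linear_algebraic_group_invertible[OF algebraic])

lemmas group_closed = linear_algebraic_group_closed[OF algebraic]

lemma act_fibre: "p \<in> fibre P z \<Longrightarrow> g \<in> G \<Longrightarrow> act P p g \<in> fibre P z"
  using principal unfolding holomorphic_principal_bundle_def right_action_on_fibres_def by blast

lemma chart_exists: obtains U \<tau> where "(U, \<tau>) \<in> atlas P" "z \<in> U"
  using principal unfolding holomorphic_principal_bundle_def by blast

lemma chart_trivialization: "(U, \<tau>) \<in> atlas P \<Longrightarrow> local_trivialization G P U \<tau>"
  using principal unfolding holomorphic_principal_bundle_def by blast

lemma chart_open: "(U, \<tau>) \<in> atlas P \<Longrightarrow> open U"
  using chart_trivialization unfolding local_trivialization_def by blast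

lemma chart_act: "(U, \<tau>) \<in> atlas P \<Longrightarrow> z \<in> U \<Longrightarrow> p \<in> fibre P z \<Longrightarrow> g \<in> G \<Longrightarrow> \<tau> (act P p g) = \<tau> p ** g"
  using chart_trivialization unfolding local_trivialization_def fibre_def by blast

lemma chart_bij:
  assumes "(U, \<tau>) \<in> atlas P" "z \<in> U" shows "bij_betw \<tau> (fibre P z) G"
proof -
  let ?f = "\<lambda>p. (proj P p, \<tau> p)" and ?E = "{p \<in> total P. proj P p \<in> U}"
  have b: "bij_betw ?f ?E (U \<times> G)"
    using chart_trivialization[OF assms(1)] unfolding local_trivialization_def by blast
  show ?thesis
    unfolding bij_betw_def
  proof
    show "inj_on \<tau> (fibre P z)"
    proof (rule inj_onI)
      fix p q assume "p \<in> fibre P z" "q \<in> fibre P z" "\<tau> p = \<tau> q"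
      then show "p = q"
        using b assms(2) unfolding bij_betw_def inj_on_def fibre_def by auto
    qed
    show "\<tau> ` fibre P z = G"
    proof
      show "\<tau> ` fibre P z \<subseteq> G"
        using b assms(2) unfolding bij_betw_def fibre_def by auto
      show "G \<subseteq> \<tau> ` fibre P z"
      proof
        fix g assume "g \<in> G"
        then have "(z, g) \<in> ?f ` ?E" using b assms(2) unfolding bij_betw_def by blast
        then show "g \<in> \<tau> ` fibre P z" unfolding fibre_def by auto
      qed
    qed
  qed
qed

lemma chart_in_group: "(U, \<tau>) \<in> atlas P \<Longrightarrow> z \<in> U \<Longrightarrow> p \<in> fibre P z \<Longrightarrow> \<tau> p \<in> G"
  using chart_bij bij_betwE by blast

lemma chart_inj: "(U, \<tau>) \<in> atlas P \<Longrightarrow> z \<in> U \<Longrightarrow> p \<in> fibre P z \<Longrightarrow> q \<in> fibre P z \<Longrightarrow> \<tau> p = \<tau> q \<Longrightarrow> p = q"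
  using chart_bij unfolding bij_betw_def inj_on_def by blast

lemma chart_surj:
  assumes "(U, \<tau>) \<in> atlas P" "z \<in> U" "g \<in> G"
  obtains p where "p \<in> fibre P z" "\<tau> p = g"
  using chart_bij[OF assms(1,2)] assms(3) unfolding bij_betw_def by (metis imageE)

lemma fibre_nonempty: obtains p where "p \<in> fibre P z"
  using chart_exists chart_surj group_closed(1) by metis

lemma fibre_transitive:
  assumes p: "p \<in> fibre P z" and q: "q \<in> fibre P z"
  obtains g where "g \<in> G" "q = act P p g"
proof -
  obtain U \<tau> where c: "(U, \<tau>) \<in> atlas P" "z \<in> U" by (rule chart_exists)
  let ?g = "matrix_inv (\<tau> p) ** \<tau> q"
  have g: "?g \<in> G" using chart_in_group[OF c] p q by (intro group_closed) auto
  have "\<tau> (act P p ?g) = \<tau> q"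
    using chart_act[OF c p g] group_invertible[OF chart_in_group[OF c p]] by (simp add: matrix_inv_cancel_left)
  then have "q = act P p ?g" using chart_inj[OF c act_fibre[OF p g] q] by simp
  then show ?thesis using that g by blast
qed

lemma act_eq_iff:
  assumes p: "p \<in> fibre P z" and g: "g \<in> G" "h \<in> G"
  shows "act P p g = act P p h \<longleftrightarrow> g = h"
proof
  assume eq: "act P p g = act P p h"
  obtain U \<tau> where c: "(U, \<tau>) \<in> atlas P" "z \<in> U" by (rule chart_exists)
  have "\<tau> p ** g = \<tau> p ** h" using eq chart_act[OF c p] g by metis
  then have "matrix_inv (\<tau> p) ** (\<tau> p ** g) = matrix_inv (\<tau> p) ** (\<tau> p ** h)" by simp
  then show "g = h"
    using group_invertible[OF chart_in_group[OF c p]] by (simp add: matrix_inv_cancel_left)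
qed simp

text \<open>Both fibres are torsors under \<open>G\<close>.\<close>

lemma equivariant_map_bij:
  assumes f: "equivariant_map G P z P w f"
  shows "bij_betw f (fibre P z) (fibre P w)"
proof -
  obtain p0 where p0: "p0 \<in> fibre P z" by (rule fibre_nonempty)
  have fp0: "f p0 \<in> fibre P w" using f p0 unfolding equivariant_map_def by blast
  have fact: "f (act P p0 g) = act P (f p0) g" if "g \<in> G" for g
    using f p0 that unfolding equivariant_map_def by blast
  show ?thesis
    unfolding bij_betw_def
  proof
    show "inj_on f (fibre P z)"
    proof (rule inj_onI)
      fix p q assume pq: "p \<in> fibre P z" "q \<in> fibre P z" "f p = f q"
      obtain g where g: "g \<in> G" "p = act P p0 g" by (rule fibre_transitive[OF p0 pq(1)])
      obtain h where h: "h \<in> G" "q = act P p0 h" by (rule fibre_transitive[OF p0 pq(2)])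
      have "act P (f p0) g = act P (f p0) h" using pq(3) g h fact by simp
      then show "p = q" using act_eq_iff[OF fp0 g(1) h(1)] g h by simp
    qed
    show "f ` fibre P z = fibre P w"
    proof
      show "f ` fibre P z \<subseteq> fibre P w" using f unfolding equivariant_map_def by blast
      show "fibre P w \<subseteq> f ` fibre P z"
      proof
        fix q assume "q \<in> fibre P w"
        then obtain g where g: "g \<in> G" "q = act P (f p0) g" by (rule fibre_transitive[OF fp0])
        then show "q \<in> f ` fibre P z" using fact act_fibre[OF p0 g(1)] by (metis imageI)
      qed
    qed
  qed
qed

end

section \<open>Representations of the action groupoid\<close>

locale groupoid_rep = algebraic_principal_bundle G P
  for G :: "(complex^'n^'n) set" and P :: "('p, 'n) principal_bundle" +
  fixes \<Phi> :: "complex \<Rightarrow> complex \<Rightarrow> 'p \<Rightarrow> 'p"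
  assumes representation: "groupoid_representation G P \<Phi>"
begin

lemma rep_equivariant: "equivariant_map G P z P (exp l * z) (\<Phi> l z)"
  using representation unfolding groupoid_representation_def by blast

lemma rep_fibre: "p \<in> fibre P z \<Longrightarrow> \<Phi> l z p \<in> fibre P (exp l * z)"
  using rep_equivariant unfolding equivariant_map_def by blast

lemma rep_act: "p \<in> fibre P z \<Longrightarrow> g \<in> G \<Longrightarrow> \<Phi> l z (act P p g) = act P (\<Phi> l z p) g"
  using rep_equivariant unfolding equivariant_map_def by blast

lemma rep_0: "p \<in> fibre P z \<Longrightarrow> \<Phi> 0 z p = p"
  using representation unfolding groupoid_representation_def by blast

lemma rep_add: "p \<in> fibre P z \<Longrightarrow> \<Phi> (l + k) z p = \<Phi> l (exp k * z) (\<Phi> k z p)"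
  using representation unfolding groupoid_representation_def by blast

lemma rep_chart:
  assumes "(U, \<sigma>) \<in> atlas P" "(V, \<tau>) \<in> atlas P"
  obtains h where "matrix_holomorphic2_on h {(l, z). z \<in> U \<and> exp l * z \<in> V}"
    "\<And>l z. z \<in> U \<Longrightarrow> exp l * z \<in> V \<Longrightarrow> h (l, z) \<in> G"
    "\<And>l z p. z \<in> U \<Longrightarrow> exp l * z \<in> V \<Longrightarrow> p \<in> fibre P z \<Longrightarrow> \<tau> (\<Phi> l z p) = h (l, z) ** \<sigma> p"
proof -
  have "\<forall>(U, \<sigma>)\<in>atlas P. \<forall>(V, \<tau>)\<in>atlas P.
        \<exists>h. matrix_holomorphic2_on h {(l, z). z \<in> U \<and> exp l * z \<in> V} \<and>
          (\<forall>l z. z \<in> U \<and> exp l * z \<in> V \<longrightarrow>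
             h (l, z) \<in> G \<and> (\<forall>p\<in>fibre P z. \<tau> (\<Phi> l z p) = h (l, z) ** \<sigma> p))"
    using representation unfolding groupoid_representation_def by (elim conjE)
  from bspec[OF bspec[OF this assms(1), unfolded split_conv] assms(2), unfolded split_conv]
  show ?thesis using that by blast
qed

lemma fixed_fibre: "p \<in> fibre P 0 \<Longrightarrow> \<Phi> l 0 p \<in> fibre P 0"
  using rep_fibre[of p 0 l] by simp

text \<open>An arrow from \<open>1\<close> to \<open>z\<close> conjugates the monodromy at \<open>1\<close> into that at \<open>z\<close>.\<close>

lemma monodromy_transport:
  assumes q1: "q1 \<in> fibre P 1" and m: "m \<in> G" "monodromy \<Phi> 1 q1 = act P q1 m"
    and c: "(U, \<sigma>) \<in> atlas P" "z \<in> U" and z: "z \<noteq> 0"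
    and h: "\<And>p. p \<in> fibre P z \<Longrightarrow> \<sigma> (\<Phi> (2 * of_real pi * \<i>) z p) = h ** \<sigma> p"
  shows "\<exists>g\<in>G. h = g ** m ** matrix_inv g"
proof -
  let ?p = "2 * of_real pi * \<i> :: complex"
  obtain l where l: "exp l = z" using z exp_Ln by blast
  define q where "q = \<Phi> l 1 q1"
  have q: "q \<in> fibre P z" using rep_fibre[OF q1, of l] l by (simp add: q_def)
  have "\<Phi> ?p z q = \<Phi> (?p + l) 1 q1" using rep_add[OF q1, of ?p l] l by (simp add: q_def)
  also have "\<dots> = \<Phi> l 1 (\<Phi> ?p 1 q1)" using rep_add[OF q1, of l ?p] by (simp add: add.commute)
  also have "\<dots> = act P q m" using m rep_act[OF q1 m(1)] by (simp add: monodromy_def q_def)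
  finally have "h ** \<sigma> q = \<sigma> q ** m" using h[OF q] chart_act[OF c q m(1)] by simp
  then have "h = \<sigma> q ** m ** matrix_inv (\<sigma> q)"
    using group_invertible[OF chart_in_group[OF c q]] by (metis matrix_inv_cancel(1))
  then show ?thesis using chart_in_group[OF c q] by blast
qed

end

text \<open>A chart \<open>(U, \<sigma>)\<close> around the fixed point, with a disc of radius \<open>r\<close> inside it, and the cocycle \<open>F\<close>
  that describes the representation in this chart.\<close>

locale rep_with_chart = groupoid_rep G P \<Phi>
  for G :: "(complex^'n^'n) set" and P :: "('p, 'n) principal_bundle"
    and \<Phi> :: "complex \<Rightarrow> complex \<Rightarrow> 'p \<Rightarrow> 'p" +
  fixes U :: "complex set" and \<sigma> :: "'p \<Rightarrow> complex^'n^'n" and r :: real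
    and F :: "complex \<Rightarrow> complex \<Rightarrow> complex^'n^'n"
  assumes chart: "(U, \<sigma>) \<in> atlas P" and chart_radius: "r > 0" "ball 0 r \<subseteq> U"
    and F_holomorphic: "matrix_holomorphic2_on (\<lambda>(l, z). F l z) {(l, z). z \<in> U \<and> exp l * z \<in> U}"
    and F_group: "\<And>l z. z \<in> U \<Longrightarrow> exp l * z \<in> U \<Longrightarrow> F l z \<in> G"
    and F_rep: "\<And>l z p. z \<in> U \<Longrightarrow> exp l * z \<in> U \<Longrightarrow> p \<in> fibre P z \<Longrightarrow> \<sigma> (\<Phi> l z p) = F l z ** \<sigma> p"
begin

lemma chart_zero: "0 \<in> U"
  using chart_radius by auto

lemma small_in_chart: "cmod z < r \<Longrightarrow> z \<in> U"
  using chart_radius by auto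

lemma F_eqI:
  fixes A B :: "complex^'n^'n"
  assumes "z \<in> U" "p \<in> fibre P z" "A ** \<sigma> p = B ** \<sigma> p" shows "A = B"
  using matrix_mult_right_cancel[OF group_invertible[OF chart_in_group[OF chart assms(1,2)]] assms(3)] .

sublocale local_flow G r F
proof
  show "F 0 z = mat 1" if z: "cmod z < r" for z
  proof -
    obtain p where p: "p \<in> fibre P z" by (rule fibre_nonempty)
    note zU = small_in_chart[OF z]
    have "F 0 z ** \<sigma> p = mat 1 ** \<sigma> p"
      using F_rep[OF zU _ p, of 0] rep_0[OF p] zU by simp
    then show ?thesis by (rule F_eqI[OF zU p])
  qed
  show "F (l + k) z = F l (exp k * z) ** F k z"
    if z: "cmod z < r" "cmod (exp k * z) < r" "cmod (exp (l + k) * z) < r" for z k l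
  proof -
    obtain p where p: "p \<in> fibre P z" by (rule fibre_nonempty)
    note zU = small_in_chart[OF z(1)] small_in_chart[OF z(2)] small_in_chart[OF z(3)]
    have el: "exp l * (exp k * z) \<in> U" using zU(3) by (simp add: exp_add mult.assoc)
    have "F (l + k) z ** \<sigma> p = \<sigma> (\<Phi> (l + k) z p)" by (rule F_rep[OF zU(1,3) p, symmetric])
    also have "\<dots> = \<sigma> (\<Phi> l (exp k * z) (\<Phi> k z p))" by (simp only: rep_add[OF p])
    also have "\<dots> = F l (exp k * z) ** \<sigma> (\<Phi> k z p)" by (rule F_rep[OF zU(2) el rep_fibre[OF p]])
    also have "\<dots> = F l (exp k * z) ** (F k z ** \<sigma> p)" by (simp only: F_rep[OF zU(1,2) p])
    finally have "F (l + k) z ** \<sigma> p = (F l (exp k * z) ** F k z) ** \<sigma> p"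
      by (simp only: matrix_mul_assoc)
    then show ?thesis by (rule F_eqI[OF zU(1) p])
  qed
  show "matrix_holomorphic2_on (\<lambda>(l, z). F l z) {(l, z). cmod z < r \<and> cmod (exp l * z) < r}"
    by (rule matrix_holomorphic2_subset[OF F_holomorphic]) (use small_in_chart in auto)
qed (use small_in_chart F_group algebraic chart_radius in auto)

lemma F_0_in_group: "F l 0 \<in> G"
  using F_group chart_zero by simp

lemma matrix_exp_conjugate:
  assumes "g \<in> G"
  shows "matrix_exp (matrix_scale l (matrix_inv g ** generator 0 ** g)) = matrix_inv g ** F l 0 ** g"
proof (rule matrix_exp_solution[where R = "cmod l + 1"])
  have g: "invertible g" by (rule group_invertible[OF assms])
  let ?I = "matrix_inv g"
  show "has_matrix_derivative (\<lambda>l. ?I ** F l 0 ** g) (?I ** generator 0 ** g ** (?I ** F z 0 ** g)) z" for z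
  proof (rule has_matrix_derivative_eq_rhs)
    have d: "has_matrix_derivative (\<lambda>l. F l 0) (generator 0 ** F z 0) z"
      using flow_derivative[of 0 z] radius by simp
    show "has_matrix_derivative (\<lambda>l. ?I ** F l 0 ** g) ((0 ** F z 0 + ?I ** (generator 0 ** F z 0)) ** g + (?I ** F z 0) ** 0) z"
      by (intro has_matrix_derivative_mult has_matrix_derivative_const d)
    show "(0 ** F z 0 + ?I ** (generator 0 ** F z 0)) ** g + (?I ** F z 0) ** 0 = ?I ** generator 0 ** g ** (?I ** F z 0 ** g)"
      using g by (simp add: matrix_mul_assoc matrix_inv_cancel)
  qed
  show "?I ** F 0 0 ** g = mat 1" using g flow_0[of 0] radius by (simp add: matrix_inv_mult)
qed simp

lemma matrix_exp_conjugate_act: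
  assumes p: "p \<in> fibre P 0"
  shows "matrix_exp (matrix_scale l (matrix_inv (\<sigma> p) ** generator 0 ** \<sigma> p)) \<in> G"
    "act P p (matrix_exp (matrix_scale l (matrix_inv (\<sigma> p) ** generator 0 ** \<sigma> p))) = \<Phi> l 0 p"
proof -
  let ?E = "matrix_exp (matrix_scale l (matrix_inv (\<sigma> p) ** generator 0 ** \<sigma> p))"
  have s: "\<sigma> p \<in> G" by (rule chart_in_group[OF chart chart_zero p])
  note E = matrix_exp_conjugate[OF s, of l]
  show EG: "?E \<in> G" unfolding E using s F_0_in_group by (intro group_closed) auto
  have "\<sigma> (act P p ?E) = \<sigma> (\<Phi> l 0 p)"
    using chart_act[OF chart chart_zero p EG] F_rep[of 0 l p] chart_zero p group_invertible[OF s]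
    by (simp add: E matrix_mul_assoc matrix_inv_mult)
  then show "act P p ?E = \<Phi> l 0 p"
    by (rule chart_inj[OF chart chart_zero act_fibre[OF p EG] fixed_fibre[OF p]])
qed

text \<open>The residue is determined by a description that has to be shown to have exactly one solution. In
  the chart it is \<open>\<sigma>(p)\<^sup>-\<^sup>1 a(0) \<sigma>(p)\<close>. Uniqueness only uses real times, for which the exponential of an
  element of the Lie algebra is known to lie in \<open>G\<close>, where the action is free.\<close>

lemma residue_exp:
  assumes p: "p \<in> fibre P 0"
  shows "aut_exp P (aut_scale l (residue_rep G P \<Phi>)) p = \<Phi> l 0 p"
proof -
  let ?R = "\<lambda>\<xi>. \<xi> \<in> aut_algebra G P 0 \<and> (\<forall>l. \<forall>p\<in>fibre P 0. \<Phi> l 0 p = aut_exp P (aut_scale l \<xi>) p)"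
  define \<xi> where "\<xi> = (\<lambda>p\<in>fibre P 0. matrix_inv (\<sigma> p) ** generator 0 ** \<sigma> p)"
  have scaleR: "t *\<^sub>R X = matrix_scale (of_real t) X" for t and X :: "complex^'n^'n"
    by (simp add: vec_eq_iff) (simp add: scaleR_conv_of_real)
  have "\<xi> \<in> aut_algebra G P 0"
    unfolding aut_algebra_def
  proof (intro CollectI conjI ballI)
    show "\<xi> \<in> fibre P 0 \<rightarrow>\<^sub>E lie_algebra G"
      using matrix_exp_conjugate_act(1) by (auto simp: \<xi>_def lie_algebra_def scaleR)
    fix p g assume p: "p \<in> fibre P 0" and g: "g \<in> G"
    show "\<xi> (act P p g) = matrix_inv g ** \<xi> p ** g"
      using act_fibre[OF p g] p chart_act[OF chart chart_zero p g]
        group_invertible[OF g] group_invertible[OF chart_in_group[OF chart chart_zero p]]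
      by (simp add: \<xi>_def matrix_inv_product matrix_mul_assoc)
  qed
  then have "?R \<xi>"
    using matrix_exp_conjugate_act(2) by (auto simp: aut_exp_def aut_scale_def \<xi>_def)
  moreover have "\<eta> = \<xi>" if \<eta>: "?R \<eta>" for \<eta>
  proof
    fix p show "\<eta> p = \<xi> p"
    proof (cases "p \<in> fibre P 0")
      case True
      have lie: "\<eta> p \<in> lie_algebra G" using \<eta> True unfolding aut_algebra_def by auto
      have "\<eta> p = matrix_inv (\<sigma> p) ** generator 0 ** \<sigma> p"
      proof (rule matrix_exp_injective)
        fix t :: real
        have eG: "matrix_exp (matrix_scale (of_real t) (\<eta> p)) \<in> G"
          using lie unfolding lie_algebra_def scaleR by blast
        have "act P p (matrix_exp (matrix_scale (of_real t) (\<eta> p))) = \<Phi> (of_real t) 0 p"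
          using \<eta> True by (simp add: aut_exp_def aut_scale_def)
        then show "matrix_exp (matrix_scale (of_real t) (\<eta> p)) =
            matrix_exp (matrix_scale (of_real t) (matrix_inv (\<sigma> p) ** generator 0 ** \<sigma> p))"
          using act_eq_iff[OF True eG matrix_exp_conjugate_act(1)[OF True, of "of_real t"]]
              matrix_exp_conjugate_act(2)[OF True, of "of_real t"]
          by simp
      qed
      then show ?thesis using True by (simp add: \<xi>_def)
    next
      case False
      then show ?thesis using \<eta> unfolding aut_algebra_def by (auto simp: \<xi>_def PiE_def extensional_def)
    qed
  qed
  ultimately have "?R (residue_rep G P \<Phi>)"
    unfolding residue_rep_def by (rule theI)
  then show ?thesis using p by simp
qed

text \<open>A map conjugating the monodromies at \<open>0\<close> and \<open>1\<close> carries a point over \<open>0\<close> to a point over \<open>1\<close> at which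
  the monodromy is multiplication by the same element \<open>m\<close> of \<open>G\<close>. By transport, in the chart the monodromy is
  conjugate to \<open>m\<close> at every point of the disc.\<close>

lemma conjugate_monodromy_imp_linear_flow:
  assumes "conjugate_automorphisms G P 1 (monodromy \<Phi> 1) 0 (\<Phi> (2 * of_real pi * \<i>) 0)"
  obtains \<rho> u where "\<rho> \<le> r" "linearizing_gauge G F \<rho> u"
proof -
  let ?p = "2 * of_real pi * \<i> :: complex"
  obtain f where f: "equivariant_map G P 0 P 1 f"
    "\<And>q. q \<in> fibre P 1 \<Longrightarrow> monodromy \<Phi> 1 q = f (\<Phi> ?p 0 (inv_into (fibre P 0) f q))"
    using assms unfolding conjugate_automorphisms_def by blast
  obtain p0 where p0: "p0 \<in> fibre P 0" by (rule fibre_nonempty)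
  obtain m where m: "m \<in> G" "\<Phi> ?p 0 p0 = act P p0 m"
    by (rule fibre_transitive[OF p0 fixed_fibre[OF p0]])
  have q1: "f p0 \<in> fibre P 1" using f(1) p0 unfolding equivariant_map_def by blast
  have "inv_into (fibre P 0) f (f p0) = p0"
    using equivariant_map_bij[OF f(1)] p0 by (simp add: bij_betw_def)
  then have mono: "monodromy \<Phi> 1 (f p0) = act P (f p0) m"
    using f p0 m q1 unfolding equivariant_map_def by simp
  have "\<exists>g\<in>G. period_map z = g ** m ** matrix_inv g" if z: "cmod z < r" for z
  proof (cases "z = 0")
    case True
    have s: "\<sigma> p0 \<in> G" by (rule chart_in_group[OF chart chart_zero p0])
    have "period_map 0 ** \<sigma> p0 = \<sigma> p0 ** m"
      using F_rep[of 0 ?p p0] chart_zero p0 m chart_act[OF chart chart_zero p0 m(1)] by simp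
    then have "period_map 0 = \<sigma> p0 ** m ** matrix_inv (\<sigma> p0)"
      using group_invertible[OF s] by (metis matrix_inv_cancel(1))
    then show ?thesis using True s by blast
  next
    case False
    show ?thesis
      by (rule monodromy_transport[OF q1 m(1) mono chart small_in_chart[OF z] False])
         (use F_rep small_in_chart[OF z] in simp)
  qed
  then obtain \<epsilon> C where C: "0 < \<epsilon>" "\<epsilon> \<le> r" "centralizer_section \<epsilon> C"
    using centralizer_section_conjugate by blast
  interpret small: local_flow G \<epsilon> F by (rule local_flow_restrict[OF C(1,2)])
  obtain \<rho> u where u: "\<rho> \<le> \<epsilon>" "linearizing_gauge G F \<rho> u"
    using small.local_linearization[OF C(3)] by blast
  show ?thesis by (rule that[OF _ u(2)]) (use u(1) C(2) in auto)
qed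

text \<open>By transport a diagonal form \<open>D\<close> of the monodromy at \<open>1\<close> is one of the monodromy at every \<open>z \<noteq> 0\<close>.\<close>

lemma semisimple_monodromy_imp_linear_flow:
  assumes "semisimple_automorphism G P 1 (monodromy \<Phi> 1)"
  obtains \<rho> u where "\<rho> \<le> r" "linearizing_gauge G F \<rho> u"
proof -
  obtain q1 where q1: "q1 \<in> fibre P 1" by (rule fibre_nonempty)
  obtain m where m: "m \<in> G" "monodromy \<Phi> 1 q1 = act P q1 m" "semisimple_matrix m"
    using assms q1 unfolding semisimple_automorphism_def by blast
  obtain Q D :: "complex^'n^'n" where QD: "invertible Q" "\<forall>i j. i \<noteq> j \<longrightarrow> D $ i $ j = 0" "m = Q ** D ** matrix_inv Q"
    using m(3) unfolding semisimple_matrix_def by blast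
  have diag: "\<exists>Q. invertible Q \<and> period_map z = Q ** D ** matrix_inv Q" if z: "cmod z < r" "z \<noteq> 0" for z
  proof -
    have "\<exists>g\<in>G. period_map z = g ** m ** matrix_inv g"
      by (rule monodromy_transport[OF q1 m(1,2) chart small_in_chart[OF z(1)] z(2)])
         (use F_rep small_in_chart[OF z(1)] in simp)
    then obtain g where g: "g \<in> G" "period_map z = g ** m ** matrix_inv g" by blast
    have "period_map z = (g ** Q) ** D ** matrix_inv (g ** Q)"
      using g(2) QD group_invertible[OF g(1)] by (simp add: matrix_inv_product matrix_mul_assoc)
    then show ?thesis using invertible_mult[OF group_invertible[OF g(1)] QD(1)] by blast
  qed
  obtain C where C: "centralizer_section r C"
    using centralizer_section_semisimple[OF QD(2) diag] by blast
  show ?thesis using local_linearization[OF C] that by blast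
qed

end

section \<open>From the disc to the whole line\<close>

lemma fibre_linear_bundle: "fibre (linear_bundle P) z = fibre P 0 \<times> {z}"
  by (auto simp: fibre_def linear_bundle_def)

lemma act_linear_bundle: "act (linear_bundle P) (p, z) g = (act P p g, z)"
  by (simp add: linear_bundle_def)

lemma atlas_linear_bundle:
  "c \<in> atlas (linear_bundle P) \<longleftrightarrow> (\<exists>U \<tau>. (U, \<tau>) \<in> atlas P \<and> 0 \<in> U \<and> c = (UNIV, \<lambda>(p, z). \<tau> p))"
  by (auto simp: linear_bundle_def)

locale local_linearization_data = rep_with_chart G P \<Phi> U \<sigma> r F
  for G :: "(complex^'n^'n) set" and P :: "('p, 'n) principal_bundle"
    and \<Phi> :: "complex \<Rightarrow> complex \<Rightarrow> 'p \<Rightarrow> 'p" and U \<sigma> r F +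
  fixes \<rho> :: real and u :: "complex \<Rightarrow> complex^'n^'n"
  assumes small_radius: "\<rho> \<le> r" and gauge: "linearizing_gauge G F \<rho> u"
begin

lemma gauge_radius: "0 < \<rho>"
  and gauge_holomorphic: "matrix_holomorphic_on u (ball 0 \<rho>)"
  and gauge_group: "z \<in> ball 0 \<rho> \<Longrightarrow> u z \<in> G"
  and gauge_linear: "z \<in> ball 0 \<rho> \<Longrightarrow> exp l * z \<in> ball 0 \<rho> \<Longrightarrow> F l z ** u z = u (exp l * z) ** F l 0"
  using gauge unfolding linearizing_gauge_def by blast+

lemma gauge_disc_in_chart: "z \<in> ball 0 \<rho> \<Longrightarrow> z \<in> U"
  using small_radius small_in_chart by auto

text \<open>The isomorphism from the fibre over \<open>0\<close> to that over \<open>z\<close> which is left multiplication by \<open>u z\<close>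
  in the chart.\<close>

definition gauge_map :: "complex \<Rightarrow> 'p \<Rightarrow> 'p" where
  "gauge_map z p = inv_into (fibre P z) \<sigma> (u z ** \<sigma> p)"

lemma gauge_map:
  assumes z: "z \<in> ball 0 \<rho>" and p: "p \<in> fibre P 0"
  shows "gauge_map z p \<in> fibre P z" "\<sigma> (gauge_map z p) = u z ** \<sigma> p"
proof -
  have "u z ** \<sigma> p \<in> G"
    using gauge_group[OF z] chart_in_group[OF chart chart_zero p] by (rule group_closed)
  then have "u z ** \<sigma> p \<in> \<sigma> ` fibre P z"
    using chart_bij[OF chart gauge_disc_in_chart[OF z]] by (simp add: bij_betw_def)
  then show "gauge_map z p \<in> fibre P z" "\<sigma> (gauge_map z p) = u z ** \<sigma> p"
    unfolding gauge_map_def by (auto intro: inv_into_into f_inv_into_f)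
qed

lemma gauge_map_act:
  assumes z: "z \<in> ball 0 \<rho>" and p: "p \<in> fibre P 0" and g: "g \<in> G"
  shows "gauge_map z (act P p g) = act P (gauge_map z p) g"
proof (rule chart_inj[OF chart gauge_disc_in_chart[OF z]])
  show "gauge_map z (act P p g) \<in> fibre P z" by (rule gauge_map(1)[OF z act_fibre[OF p g]])
  show "act P (gauge_map z p) g \<in> fibre P z" by (rule act_fibre[OF gauge_map(1)[OF z p] g])
  show "\<sigma> (gauge_map z (act P p g)) = \<sigma> (act P (gauge_map z p) g)"
    using chart_act[OF chart chart_zero p g] chart_act[OF chart gauge_disc_in_chart[OF z] gauge_map(1)[OF z p] g]
      gauge_map(2)[OF z p] gauge_map(2)[OF z act_fibre[OF p g]] by (simp add: matrix_mul_assoc)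
qed

lemma gauge_map_equivariant:
  assumes z: "z \<in> ball 0 \<rho>" "exp l * z \<in> ball 0 \<rho>" and p: "p \<in> fibre P 0"
  shows "\<Phi> l z (gauge_map z p) = gauge_map (exp l * z) (\<Phi> l 0 p)"
proof (rule chart_inj[OF chart gauge_disc_in_chart[OF z(2)]])
  show "\<Phi> l z (gauge_map z p) \<in> fibre P (exp l * z)" by (rule rep_fibre[OF gauge_map(1)[OF z(1) p]])
  show "gauge_map (exp l * z) (\<Phi> l 0 p) \<in> fibre P (exp l * z)" by (rule gauge_map(1)[OF z(2) fixed_fibre[OF p]])
  show "\<sigma> (\<Phi> l z (gauge_map z p)) = \<sigma> (gauge_map (exp l * z) (\<Phi> l 0 p))"
    using F_rep[OF gauge_disc_in_chart[OF z(1)] gauge_disc_in_chart[OF z(2)] gauge_map(1)[OF z(1) p]] gauge_map(2)[OF z(1) p]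
      gauge_map(2)[OF z(2) fixed_fibre[OF p, of l]] F_rep[of 0 l p] chart_zero p gauge_linear[OF z]
    by (simp add: matrix_mul_assoc)
qed

text \<open>The same isomorphism, transported from the point \<open>exp (- l) * z\<close> of the small disc to \<open>z\<close>.\<close>

definition transported_gauge :: "complex \<Rightarrow> complex \<Rightarrow> 'p \<Rightarrow> 'p" where
  "transported_gauge l z p = \<Phi> l (exp (- l) * z) (gauge_map (exp (- l) * z) (\<Phi> (- l) 0 p))"

lemma exp_cancel: "exp l * (exp (- l) * z) = (z :: complex)" "exp (- l) * (exp l * z) = z"
  by (simp_all add: exp_minus flip: mult.assoc)

text \<open>Two choices of the time \<open>l\<close> differ by an arrow between two points of the small disc, and the gauge
  commutes with such arrows.\<close>

lemma transported_gauge_independent: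
  assumes l: "exp (- l) * z \<in> ball 0 \<rho>" and k: "exp (- k) * z \<in> ball 0 \<rho>" and p: "p \<in> fibre P 0"
  shows "transported_gauge l z p = transported_gauge k z p"
proof -
  let ?w = "exp (- l) * z" and ?v = "exp (- k) * z"
  let ?q = "\<Phi> (- l) 0 p"
  have q: "?q \<in> fibre P 0" by (rule fixed_fibre[OF p])
  have v: "exp (l - k) * ?w = ?v"
    by (simp only: mult.assoc[symmetric] exp_add[symmetric]) simp
  have "\<Phi> (- k) 0 p = \<Phi> (l - k) 0 ?q" using rep_add[OF p, of "l - k" "- l"] by simp
  then have "transported_gauge k z p = \<Phi> k ?v (gauge_map ?v (\<Phi> (l - k) 0 ?q))" by (simp add: transported_gauge_def)
  also have "\<dots> = \<Phi> k ?v (\<Phi> (l - k) ?w (gauge_map ?w ?q))"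
    using gauge_map_equivariant[OF l _ q, of "l - k"] v k by simp
  also have "\<dots> = \<Phi> l ?w (gauge_map ?w ?q)"
    using rep_add[OF gauge_map(1)[OF l q], of k "l - k"] v by simp
  finally show ?thesis by (simp add: transported_gauge_def)
qed

text \<open>A single time works for a whole disc. This is what makes the transported gauge holomorphic.\<close>

lemma contracting_time_exists:
  assumes "R > 0" obtains l where "\<And>z :: complex. cmod z < R \<Longrightarrow> exp (- l) * z \<in> ball 0 \<rho>"
proof
  fix z :: complex assume z: "cmod z < R"
  have eq: "exp (- complex_of_real (ln (R / \<rho>))) = of_real (\<rho> / R)"
    using assms gauge_radius by (simp add: exp_minus exp_of_real)
  show "exp (- complex_of_real (ln (R / \<rho>))) * z \<in> ball 0 \<rho>"
    unfolding eq using z assms gauge_radius by (simp add: norm_mult norm_divide field_simps)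
qed

definition linearizer :: "complex \<Rightarrow> 'p \<Rightarrow> 'p" where
  "linearizer z = transported_gauge (SOME l. exp (- l) * z \<in> ball 0 \<rho>) z"

lemma linearizer_eq_transported_gauge:
  assumes l: "exp (- l) * z \<in> ball 0 \<rho>" and p: "p \<in> fibre P 0"
  shows "linearizer z p = transported_gauge l z p"
  unfolding linearizer_def
  by (rule transported_gauge_independent[OF _ l p]) (rule someI[of "\<lambda>l. exp (- l) * z \<in> ball 0 \<rho>", OF l])

lemma contracting_time: fixes z :: complex obtains l where "exp (- l) * z \<in> ball 0 \<rho>"
  using contracting_time_exists[of "cmod z + 1"] by (metis less_add_one add_nonneg_pos norm_ge_zero zero_less_one)

lemma linearizer_equivariant: "equivariant_map G P 0 P z (linearizer z)"
  unfolding equivariant_map_def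
proof (intro ballI conjI)
  fix p assume p: "p \<in> fibre P 0"
  obtain l where l: "exp (- l) * z \<in> ball 0 \<rho>" by (rule contracting_time)
  show "linearizer z p \<in> fibre P z"
    unfolding linearizer_eq_transported_gauge[OF l p] transported_gauge_def
    using rep_fibre[OF gauge_map(1)[OF l fixed_fibre[OF p, of "- l"]], of l] by (simp add: exp_cancel)
  fix g assume g: "g \<in> G"
  show "linearizer z (act P p g) = act P (linearizer z p) g"
    unfolding linearizer_eq_transported_gauge[OF l p] linearizer_eq_transported_gauge[OF l act_fibre[OF p g]] transported_gauge_def
      rep_act[OF p g] gauge_map_act[OF l fixed_fibre[OF p] g]
    by (rule rep_act[OF gauge_map(1)[OF l fixed_fibre[OF p]] g])
qed

lemma linearizer_fibre: "p \<in> fibre P 0 \<Longrightarrow> linearizer z p \<in> fibre P z"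
  using linearizer_equivariant unfolding equivariant_map_def by blast

lemma linearizer_act: "p \<in> fibre P 0 \<Longrightarrow> g \<in> G \<Longrightarrow> linearizer z (act P p g) = act P (linearizer z p) g"
  using linearizer_equivariant unfolding equivariant_map_def by blast

lemma linearizer_intertwines:
  assumes p: "p \<in> fibre P 0"
  shows "\<Phi> k z (linearizer z p) = linearizer (exp k * z) (\<Phi> k 0 p)"
proof -
  obtain l where l: "exp (- l) * z \<in> ball 0 \<rho>" by (rule contracting_time)
  let ?w = "exp (- l) * z"
  have w: "exp (- (k + l)) * (exp k * z) = ?w"
    by (simp only: mult.assoc[symmetric] exp_add[symmetric]) simp
  have "linearizer (exp k * z) (\<Phi> k 0 p) = transported_gauge (k + l) (exp k * z) (\<Phi> k 0 p)"
    by (rule linearizer_eq_transported_gauge[OF _ fixed_fibre[OF p]]) (simp only: w l)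
  also have "\<dots> = \<Phi> (k + l) ?w (gauge_map ?w (\<Phi> (- (k + l)) 0 (\<Phi> k 0 p)))"
    unfolding transported_gauge_def w ..
  also have "\<Phi> (- (k + l)) 0 (\<Phi> k 0 p) = \<Phi> (- l) 0 p"
    using rep_add[OF p, of "- (k + l)" k] by simp
  also have "\<Phi> (k + l) ?w (gauge_map ?w (\<Phi> (- l) 0 p)) = \<Phi> k z (transported_gauge l z p)"
    using rep_add[OF gauge_map(1)[OF l fixed_fibre[OF p, of "- l"]], of k l] by (simp add: transported_gauge_def exp_cancel)
  finally show ?thesis by (simp add: linearizer_eq_transported_gauge[OF l p])
qed

lemma linearizer_locally_holomorphic:
  assumes V: "(V, \<tau>) \<in> atlas P" and z1: "z1 \<in> V"
  obtains N c where "open N" "z1 \<in> N" "N \<subseteq> V" "matrix_holomorphic_on c N"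
    "\<And>z p. z \<in> N \<Longrightarrow> p \<in> fibre P 0 \<Longrightarrow> \<tau> (linearizer z p) = c z ** \<sigma> p"
proof -
  obtain h where h: "matrix_holomorphic2_on h {(l, z). z \<in> U \<and> exp l * z \<in> V}"
    "\<And>l z. z \<in> U \<Longrightarrow> exp l * z \<in> V \<Longrightarrow> h (l, z) \<in> G"
    "\<And>l z p. z \<in> U \<Longrightarrow> exp l * z \<in> V \<Longrightarrow> p \<in> fibre P z \<Longrightarrow> \<tau> (\<Phi> l z p) = h (l, z) ** \<sigma> p"
    using rep_chart[OF chart V] by blast
  define R where "R = cmod z1 + 1"
  have R: "R > 0" "cmod z1 < R" by (simp_all add: R_def add_nonneg_pos)
  obtain l where l: "\<And>z :: complex. cmod z < R \<Longrightarrow> exp (- l) * z \<in> ball 0 \<rho>"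
    using contracting_time_exists[OF R(1)] by blast
  define N where "N = V \<inter> ball 0 R"
  have N: "open N" unfolding N_def using chart_open[OF V] by auto
  define c where "c = (\<lambda>z. h (l, exp (- l) * z) ** u (exp (- l) * z) ** F (- l) 0)"
  have lN: "exp (- l) * z \<in> ball 0 \<rho>" if "z \<in> N" for z using that l by (auto simp: N_def)
  have hN: "matrix_holomorphic_on (\<lambda>z. h (l, exp (- l) * z)) N"
    unfolding matrix_holomorphic_on_def
  proof (intro allI)
    fix i j
    have op: "open {(l, z). z \<in> U \<and> exp l * z \<in> V}"
    proof -
      have "open ((\<lambda>x :: complex \<times> complex. snd x) -` U \<inter> (\<lambda>x. exp (fst x) * snd x) -` V)"
        using chart_open[OF chart] chart_open[OF V]
        by (intro open_Int open_vimage) (auto intro!: continuous_intros)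
      moreover have "(\<lambda>x :: complex \<times> complex. snd x) -` U \<inter> (\<lambda>x. exp (fst x) * snd x) -` V = {(l, z). z \<in> U \<and> exp l * z \<in> V}"
        by auto
      ultimately show ?thesis by simp
    qed
    show "(\<lambda>z. h (l, exp (- l) * z) $ i $ j) holomorphic_on N"
    proof (rule holomorphic2_compose[OF _ op N, of "\<lambda>x. h x $ i $ j"])
      show "holomorphic2_on (\<lambda>x. h x $ i $ j) {(l, z). z \<in> U \<and> exp l * z \<in> V}"
        using h(1) by (simp add: matrix_holomorphic2_on_def)
      show "(\<lambda>z. exp (- l) * z) holomorphic_on N" by (intro holomorphic_intros)
      fix z assume "z \<in> N"
      then show "(l, exp (- l) * z) \<in> {(l, z). z \<in> U \<and> exp l * z \<in> V}"
        using gauge_disc_in_chart[OF lN] by (simp add: exp_cancel N_def)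
    qed simp
  qed
  have uN: "matrix_holomorphic_on (\<lambda>z. u (exp (- l) * z)) N"
    using lN by (intro matrix_holomorphic_compose[OF gauge_holomorphic] holomorphic_intros) auto
  show ?thesis
  proof (rule that[of N c])
    show "matrix_holomorphic_on c N"
      unfolding c_def by (intro matrix_holomorphic_mult hN uN matrix_holomorphic_const)
    fix z p assume z: "z \<in> N" and p: "p \<in> fibre P 0"
    let ?w = "exp (- l) * z"
    have w: "?w \<in> ball 0 \<rho>" by (rule lN[OF z])
    have "exp l * ?w \<in> V" using z by (simp add: exp_cancel N_def)
    then have "\<tau> (linearizer z p) = h (l, ?w) ** \<sigma> (gauge_map ?w (\<Phi> (- l) 0 p))"
      unfolding linearizer_eq_transported_gauge[OF w p] transported_gauge_def
      by (rule h(3)[OF gauge_disc_in_chart[OF w] _ gauge_map(1)[OF w fixed_fibre[OF p]]])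
    also have "\<sigma> (gauge_map ?w (\<Phi> (- l) 0 p)) = u ?w ** (F (- l) 0 ** \<sigma> p)"
      using gauge_map(2)[OF w fixed_fibre[OF p, of "- l"]] F_rep[of 0 "- l" p] chart_zero p by simp
    finally show "\<tau> (linearizer z p) = c z ** \<sigma> p" by (simp add: c_def matrix_mul_assoc)
  qed (use N z1 R in \<open>auto simp: N_def\<close>)
qed

text \<open>The coordinate expression is determined by the image of one point \<open>p0\<close>, so local expressions
  with different contracting times are parts of one function on \<open>V\<close>.\<close>

lemma linearizer_holomorphic:
  assumes V: "(V, \<tau>) \<in> atlas P" and U': "(U', \<sigma>') \<in> atlas P" "0 \<in> U'"
  obtains h where "matrix_holomorphic_on h V" "\<And>z. z \<in> V \<Longrightarrow> h z \<in> G"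
    "\<And>z p. z \<in> V \<Longrightarrow> p \<in> fibre P 0 \<Longrightarrow> \<tau> (linearizer z p) = h z ** \<sigma>' p"
proof -
  obtain p0 where p0: "p0 \<in> fibre P 0" by (rule fibre_nonempty)
  have s: "\<sigma>' p0 \<in> G" by (rule chart_in_group[OF U' p0])
  define h where "h = (\<lambda>z. \<tau> (linearizer z p0) ** matrix_inv (\<sigma>' p0))"
  show ?thesis
  proof (rule that[of h])
    show "matrix_holomorphic_on h V"
    proof (rule matrix_holomorphicI)
      fix z1 assume z1: "z1 \<in> V"
      obtain N c where N: "open N" "z1 \<in> N" "N \<subseteq> V" "matrix_holomorphic_on c N"
        "\<And>z p. z \<in> N \<Longrightarrow> p \<in> fibre P 0 \<Longrightarrow> \<tau> (linearizer z p) = c z ** \<sigma> p"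
        using linearizer_locally_holomorphic[OF V z1] by blast
      have "matrix_holomorphic_on (\<lambda>z. c z ** \<sigma> p0 ** matrix_inv (\<sigma>' p0)) N"
        by (intro matrix_holomorphic_mult matrix_holomorphic_const N(4))
      from matrix_holomorphic_has_derivative[OF this N(1,2)]
      show "\<exists>F'. has_matrix_derivative h F' z1"
        by (intro exI) (erule has_matrix_derivative_transform[OF _ N(1,2)], simp add: h_def N(5) p0)
    qed
    fix z assume z: "z \<in> V"
    show "h z \<in> G"
      unfolding h_def using chart_in_group[OF V z linearizer_fibre[OF p0]] s by (intro group_closed)
    fix p assume p: "p \<in> fibre P 0"
    obtain g where g: "g \<in> G" "p = act P p0 g" by (rule fibre_transitive[OF p0 p])
    show "\<tau> (linearizer z p) = h z ** \<sigma>' p"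
      using linearizer_act[OF p0 g(1)] chart_act[OF V z linearizer_fibre[OF p0] g(1)] chart_act[OF U' p0 g(1)]
        group_invertible[OF s]
      by (simp add: g(2) h_def matrix_mul_assoc matrix_inv_cancel)
  qed
qed

lemma linearizer_bij: "bij_betw (linearizer z) (fibre P 0) (fibre P z)"
  by (rule equivariant_map_bij[OF linearizer_equivariant])

text \<open>Fibrewise the inverse exists because the linearizer is equivariant; in charts it is left
  multiplication by the inverse of a holomorphic matrix function.\<close>

theorem linearizable: "linearizable G P \<Phi>"
proof -
  let ?L = "linear_approximation G P \<Phi>"
  have L: "?L l z (p, z) = (\<Phi> l 0 p, exp l * z)" if "p \<in> fibre P 0" for l z p
    by (simp add: linear_approximation_def residue_exp[OF that])
  define T where "T = (\<lambda>z (p, _ :: complex). linearizer z p)"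
  define S where "S = (\<lambda>z q. (inv_into (fibre P 0) (linearizer z) q, z))"
  have inv: "inv_into (fibre P 0) (linearizer z) q \<in> fibre P 0"
    "linearizer z (inv_into (fibre P 0) (linearizer z) q) = q" if "q \<in> fibre P z" for z q
    using linearizer_bij[of z] that unfolding bij_betw_def
    by (auto intro: inv_into_into f_inv_into_f)
  have inv_eq: "inv_into (fibre P 0) (linearizer z) q = p" if "p \<in> fibre P 0" "linearizer z p = q" for z p q
    using linearizer_bij[of z] that unfolding bij_betw_def by (metis inv_into_f_f)
  have T: "representation_morphism G (linear_bundle P) ?L P \<Phi> T"
    unfolding representation_morphism_def bundle_morphism_def
  proof (intro conjI allI)
    show "equivariant_map G (linear_bundle P) z P z (T z)" for z
      using linearizer_fibre linearizer_act
      by (auto simp: equivariant_map_def fibre_linear_bundle act_linear_bundle T_def)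
    show "\<forall>p\<in>fibre (linear_bundle P) z. T (exp l * z) (?L l z p) = \<Phi> l z (T z p)" for l z
      by (auto simp: fibre_linear_bundle L T_def linearizer_intertwines)
    show "\<forall>(U, \<sigma>)\<in>atlas (linear_bundle P). \<forall>(V, \<tau>)\<in>atlas P. \<exists>h. matrix_holomorphic_on h (U \<inter> V) \<and>
        (\<forall>z\<in>U \<inter> V. h z \<in> G \<and> (\<forall>p\<in>fibre (linear_bundle P) z. \<tau> (T z p) = h z ** \<sigma> p))"
    proof (clarsimp simp: atlas_linear_bundle fibre_linear_bundle T_def)
      fix V \<tau> U' \<sigma>' assume c: "(V, \<tau>) \<in> atlas P" "(U', \<sigma>') \<in> atlas P" "0 \<in> U'"
      obtain h where "matrix_holomorphic_on h V" "\<And>z. z \<in> V \<Longrightarrow> h z \<in> G"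
        "\<And>z p. z \<in> V \<Longrightarrow> p \<in> fibre P 0 \<Longrightarrow> \<tau> (linearizer z p) = h z ** \<sigma>' p"
        using linearizer_holomorphic[OF c] by blast
      then show "\<exists>h. matrix_holomorphic_on h V \<and>
          (\<forall>z\<in>V. h z \<in> G \<and> (\<forall>p\<in>fibre P 0. \<tau> (linearizer z p) = h z ** \<sigma>' p))" by blast
    qed
  qed
  have S: "representation_morphism G P \<Phi> (linear_bundle P) ?L S"
    unfolding representation_morphism_def bundle_morphism_def
  proof (intro conjI allI)
    show "equivariant_map G P z (linear_bundle P) z (S z)" for z
      unfolding equivariant_map_def
    proof (intro ballI conjI)
      fix q assume q: "q \<in> fibre P z"
      show "S z q \<in> fibre (linear_bundle P) z" using inv[OF q] by (simp add: S_def fibre_linear_bundle)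
      fix g assume g: "g \<in> G"
      have "inv_into (fibre P 0) (linearizer z) (act P q g) = act P (inv_into (fibre P 0) (linearizer z) q) g"
        by (rule inv_eq) (use inv[OF q] g in \<open>auto simp: act_fibre linearizer_act\<close>)
      then show "S z (act P q g) = act (linear_bundle P) (S z q) g"
        by (simp add: S_def act_linear_bundle)
    qed
    show "\<forall>q\<in>fibre P z. S (exp l * z) (\<Phi> l z q) = ?L l z (S z q)" for l z
    proof
      fix q assume q: "q \<in> fibre P z"
      have "inv_into (fibre P 0) (linearizer (exp l * z)) (\<Phi> l z q) = \<Phi> l 0 (inv_into (fibre P 0) (linearizer z) q)"
        by (rule inv_eq) (use inv[OF q] in \<open>auto simp: fixed_fibre linearizer_intertwines[symmetric]\<close>)
      then show "S (exp l * z) (\<Phi> l z q) = ?L l z (S z q)"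
        using inv(1)[OF q] by (simp add: S_def L)
    qed
    show "\<forall>(V, \<tau>)\<in>atlas P. \<forall>(U, \<sigma>)\<in>atlas (linear_bundle P). \<exists>h. matrix_holomorphic_on h (V \<inter> U) \<and>
        (\<forall>z\<in>V \<inter> U. h z \<in> G \<and> (\<forall>q\<in>fibre P z. \<sigma> (S z q) = h z ** \<tau> q))"
    proof (clarsimp simp: atlas_linear_bundle S_def)
      fix V \<tau> U' \<sigma>' assume c: "(V, \<tau>) \<in> atlas P" "(U', \<sigma>') \<in> atlas P" "0 \<in> U'"
      obtain h where h: "matrix_holomorphic_on h V" "\<And>z. z \<in> V \<Longrightarrow> h z \<in> G"
        "\<And>z p. z \<in> V \<Longrightarrow> p \<in> fibre P 0 \<Longrightarrow> \<tau> (linearizer z p) = h z ** \<sigma>' p"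
        using linearizer_holomorphic[OF c] by blast
      have "matrix_holomorphic_on (\<lambda>z. matrix_inv (h z)) V"
        by (rule matrix_holomorphic_inv[OF h(1) group_invertible[OF h(2)]])
      moreover have "matrix_inv (h z) \<in> G" if "z \<in> V" for z by (rule group_closed(3)[OF h(2)[OF that]])
      moreover have "\<sigma>' (inv_into (fibre P 0) (linearizer z) q) = matrix_inv (h z) ** \<tau> q"
        if z: "z \<in> V" and q: "q \<in> fibre P z" for z q
        using h(3)[OF z inv(1)[OF q]] inv(2)[OF q] group_invertible[OF h(2)[OF z]]
        by (simp add: matrix_inv_cancel_left)
      ultimately show "\<exists>h. matrix_holomorphic_on h V \<and>
          (\<forall>z\<in>V. h z \<in> G \<and> (\<forall>q\<in>fibre P z. \<sigma>' (inv_into (fibre P 0) (linearizer z) q) = h z ** \<tau> q))" by blast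
    qed
  qed
  have "representation_isomorphism G (linear_bundle P) ?L P \<Phi> T"
    unfolding representation_isomorphism_def
  proof (intro conjI exI[of _ S] T S allI ballI)
    fix z show "S z (T z p) = p" if "p \<in> fibre (linear_bundle P) z" for p
      using that inv_eq by (auto simp: fibre_linear_bundle S_def T_def)
    show "T z (S z q) = q" if "q \<in> fibre P z" for q
      using inv(2)[OF that] by (simp add: S_def T_def)
  qed
  then show ?thesis unfolding linearizable_def by blast
qed

end

lemma (in groupoid_rep) chart_at_zero:
  obtains U \<sigma> r F where "rep_with_chart G P \<Phi> U \<sigma> r F"
proof -
  obtain U \<sigma> where c: "(U, \<sigma>) \<in> atlas P" "0 \<in> U" by (rule chart_exists)
  obtain r where r: "r > 0" "ball 0 r \<subseteq> U" using chart_open[OF c(1)] c(2) open_contains_ball by blast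
  obtain h where h: "matrix_holomorphic2_on h {(l, z). z \<in> U \<and> exp l * z \<in> U}"
    "\<And>l z. z \<in> U \<Longrightarrow> exp l * z \<in> U \<Longrightarrow> h (l, z) \<in> G"
    "\<And>l z p. z \<in> U \<Longrightarrow> exp l * z \<in> U \<Longrightarrow> p \<in> fibre P z \<Longrightarrow> \<sigma> (\<Phi> l z p) = h (l, z) ** \<sigma> p"
    using rep_chart[OF c(1) c(1)] by blast
  have "rep_with_chart G P \<Phi> U \<sigma> r (\<lambda>l z. h (l, z))"
    by unfold_locales (use c r h in auto)
  then show ?thesis using that by blast
qed

text \<open>Intertwining over the base point \<open>1\<close>, which the time \<open>2 pi i\<close> fixes.\<close>

lemma (in groupoid_rep) linearizable_imp_conjugate:
  assumes "linearizable G P \<Phi>"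
  shows "conjugate_automorphisms G P 1 (monodromy \<Phi> 1)
             0 (aut_exp P (aut_scale (2 * of_real pi * \<i>) (residue_rep G P \<Phi>)))"
proof -
  let ?p = "2 * of_real pi * \<i> :: complex" and ?B = "linear_bundle P" and ?L = "linear_approximation G P \<Phi>"
  obtain T where T: "representation_morphism G ?B ?L P \<Phi> T"
    using assms unfolding linearizable_def representation_isomorphism_def by blast
  define f where "f = (\<lambda>p. T 1 (p, 1))"
  have "equivariant_map G ?B 1 P 1 (T 1)"
    using T unfolding representation_morphism_def bundle_morphism_def by blast
  then have f: "equivariant_map G P 0 P 1 f"
    unfolding equivariant_map_def f_def by (auto simp: fibre_linear_bundle act_linear_bundle)
  have "monodromy \<Phi> 1 q = f (aut_exp P (aut_scale ?p (residue_rep G P \<Phi>)) (inv_into (fibre P 0) f q))"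
    if q: "q \<in> fibre P 1" for q
  proof -
    define p where "p = inv_into (fibre P 0) f q"
    have "q \<in> f ` fibre P 0" using equivariant_map_bij[OF f] q by (simp add: bij_betw_def)
    then have p: "p \<in> fibre P 0" "f p = q"
      unfolding p_def by (auto intro: inv_into_into f_inv_into_f)
    have "T (exp ?p * 1) (?L ?p 1 (p, 1)) = \<Phi> ?p 1 (T 1 (p, 1))"
      using T p(1) unfolding representation_morphism_def fibre_linear_bundle by blast
    then have "f (aut_exp P (aut_scale ?p (residue_rep G P \<Phi>)) p) = \<Phi> ?p 1 q"
      using p(2) by (simp add: f_def linear_approximation_def)
    then show ?thesis by (simp add: monodromy_def p_def[symmetric])
  qed
  then show ?thesis unfolding conjugate_automorphisms_def using f by blast
qed

theorem proposition3p6: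
  fixes G :: "(complex^'n^'n) set"
    and P :: "('p, 'n) principal_bundle"
    and \<Phi> :: "complex \<Rightarrow> complex \<Rightarrow> 'p \<Rightarrow> 'p"
  assumes "connected_reductive_group G"
    and "holomorphic_principal_bundle G P"
    and "groupoid_representation G P \<Phi>"
  shows "(linearizable G P \<Phi> \<longleftrightarrow>
           conjugate_automorphisms G P 1 (monodromy \<Phi> 1)
             0 (aut_exp P (aut_scale (2 * of_real pi * \<i>) (residue_rep G P \<Phi>)))) \<and>
         (semisimple_automorphism G P 1 (monodromy \<Phi> 1) \<longrightarrow> linearizable G P \<Phi>)"
proof -
  interpret groupoid_rep G P \<Phi>
    by unfold_locales (use assms in \<open>auto simp: connected_reductive_group_def reductive_group_def\<close>)
  obtain U \<sigma> r F where "rep_with_chart G P \<Phi> U \<sigma> r F" by (rule chart_at_zero)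
  then interpret rep_with_chart G P \<Phi> U \<sigma> r F .
  let ?p = "2 * of_real pi * \<i> :: complex"
  have linearizableI: "linearizable G P \<Phi>" if "\<rho> \<le> r" "linearizing_gauge G F \<rho> u" for \<rho> u
  proof -
    interpret local_linearization_data G P \<Phi> U \<sigma> r F \<rho> u
      by unfold_locales (rule that)+
    show ?thesis by (rule linearizable)
  qed
  have "linearizable G P \<Phi>"
    if c: "conjugate_automorphisms G P 1 (monodromy \<Phi> 1) 0 (aut_exp P (aut_scale ?p (residue_rep G P \<Phi>)))"
  proof -
    obtain f where f: "equivariant_map G P 0 P 1 f"
      "\<And>q. q \<in> fibre P 1 \<Longrightarrow> monodromy \<Phi> 1 q =
         f (aut_exp P (aut_scale ?p (residue_rep G P \<Phi>)) (inv_into (fibre P 0) f q))"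
      using c unfolding conjugate_automorphisms_def by blast
    have "inv_into (fibre P 0) f q \<in> fibre P 0" if "q \<in> fibre P 1" for q
      using equivariant_map_bij[OF f(1)] that by (auto simp: bij_betw_def intro: inv_into_into)
    then have "\<forall>q\<in>fibre P 1. monodromy \<Phi> 1 q = f (\<Phi> ?p 0 (inv_into (fibre P 0) f q))"
      using f(2) by (simp add: residue_exp)
    then have "conjugate_automorphisms G P 1 (monodromy \<Phi> 1) 0 (\<Phi> ?p 0)"
      using f(1) unfolding conjugate_automorphisms_def by blast
    then show ?thesis
      by (rule conjugate_monodromy_imp_linear_flow) (rule linearizableI)
  qed
  moreover have "linearizable G P \<Phi>" if "semisimple_automorphism G P 1 (monodromy \<Phi> 1)"
    using that by (rule semisimple_monodromy_imp_linear_flow) (rule linearizableI)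
  ultimately show ?thesis using linearizable_imp_conjugate by blast
qed

end
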